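(* Let $p$ be a prime. Then for any positive integer $n$, $$\mathbb J_{1,n}\,|\,T_p=\mathbb J_{1,pn}+p\,\mathbb J_{1,n/p},$$ and $$\mathbb J_{1,0}\,|\,T_p=(p+1)\,\mathbb J_{1,0}-(p-1)\log p .$$
   Context: Notation: $\Gamma=\mathrm{SL}_2(\mathbb Z)$, $\tau=x+iy\in\mathbb H$ (upper half-plane), $e(x)=e^{2\pi i x}$, $\Gamma_\infty$ is the stabilizer of the cusp $i\infty$ in $\Gamma$ (translations up to sign). Sesquiharmonic Maass functions $\mathbb J_{1,n}$. Put $\mathbb J_{1,0}(\tau):=\log(y|\eta(\tau)|^4)+1$, where $\eta$ is the Dedekind eta function. For a positive integer $n$ and $\mathrm{Re}(s)>1$ let $$F_{1,0,-n}(\tau,s):=2\pi\sqrt n\sum_{\gamma\in\Gamma_\infty\backslash\Gamma}(\mathrm{Im}(\gamma\tau))^{1/2}\,I_{s-\frac12}(2\pi n\,\mathrm{Im}(\gamma\tau))\,e(-n\,\mathrm{Re}(\gamma\tau)),$$ with $I_\nu$ the $I$-Bessel function; this has an analytic continuation in $s$ to a neighbourhood of $s=1$, and $\mathbb J_{1,n}(\tau)$ is defined as the coefficient of $(s-1)^1$ in the Taylor expansion of $F_{1,0,-n}(\tau,s)$ at $s=1$. The functions $\mathbb J_{1,n}$ ($n\ge 0$) are $\Gamma$-invariant. Convention: $\mathbb J_{1,n/p}:=0$ if $p\nmid n$. Hecke operator. For a $\Gamma$-invariant function $g$ of weight $0$ on $\mathbb H$ and a prime $p$, $g|T_p:=\sum_{\alpha}g(\alpha\tau)$,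 the sum being over representatives $\alpha$ of $\Gamma\backslash\{\alpha\in M_2(\mathbb Z):\det\alpha=p\}$; explicitly $(g|T_p)(\tau)=g(p\tau)+\sum_{i=0}^{p-1}g\left(\frac{\tau+i}{p}\right)$. *)

theory Defs
  imports "HOL-Complex_Analysis.Complex_Analysis"
begin

definition e :: "complex \<Rightarrow> complex" where
  "e z = exp (2 * of_real pi * \<i> * z)"

definition dedekind_eta :: "complex \<Rightarrow> complex" where
  "dedekind_eta \<tau> = e (\<tau> / 24) * (\<Prod>n. 1 - e (of_nat (Suc n) * \<tau>))"

text \<open>The modified Bessel function \<open>I\<^sub>\<nu>\<close> of complex order. Using \<^const>\<open>rGamma\<close> (the entire
  function \<open>1/\<Gamma>\<close>) makes the series meaningful for every \<open>\<nu>\<close>.\<close>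

definition bessel_I :: "complex \<Rightarrow> complex \<Rightarrow> complex" where
  "bessel_I \<nu> z =
     (z / 2) powr \<nu> * (\<Sum>k. (z / 2) ^ (2 * k) * rGamma (\<nu> + of_nat k + 1) / fact k)"

definition int_mats_det :: "int \<Rightarrow> (int^2^2) set" where
  "int_mats_det m = {A. det A = m}"

abbreviation SL2Z :: "(int^2^2) set" where
  "SL2Z \<equiv> int_mats_det 1"

definition moebius :: "int^2^2 \<Rightarrow> complex \<Rightarrow> complex" where
  "moebius A \<tau> =
     (of_int (A $ 1 $ 1) * \<tau> + of_int (A $ 1 $ 2)) /
     (of_int (A $ 2 $ 1) * \<tau> + of_int (A $ 2 $ 2))"

text \<open>A matrix fixes the cusp \<open>\<i>\<infinity>\<close> iff its lower left entry vanishes; within \<^term>\<open>SL2Z\<close> these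
  are the translations up to sign.\<close>

definition Gamma_inf :: "(int^2^2) set" where
  "Gamma_inf = {A \<in> SL2Z. A $ 2 $ 1 = 0}"

text \<open>\<open>left_quot G X\<close> is the set \<open>G\<setminus>X\<close> of left orbits \<open>G\<alpha>\<close> with \<open>\<alpha> \<in> X\<close>; \<open>rep\<close> chooses a
  representative of an orbit.\<close>

definition left_quot :: "(int^2^2) set \<Rightarrow> (int^2^2) set \<Rightarrow> (int^2^2) set set" where
  "left_quot G X = (\<lambda>\<alpha>. (\<lambda>\<gamma>. \<gamma> ** \<alpha>) ` G) ` X"

definition rep :: "(int^2^2) set \<Rightarrow> int^2^2" where
  "rep C = (SOME \<alpha>. \<alpha> \<in> C)"

text \<open>The Hecke operator \<open>g | T\<^sub>p\<close>, meant for functions \<open>g\<close> on the upper half-plane that are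
  invariant under \<^term>\<open>SL2Z\<close>; for these it does not depend on the representatives.\<close>

definition hecke :: "nat \<Rightarrow> (complex \<Rightarrow> complex) \<Rightarrow> complex \<Rightarrow> complex" where
  "hecke p g \<tau> = (\<Sum>C \<in> left_quot SL2Z (int_mats_det (int p)). g (moebius (rep C) \<tau>))"

text \<open>The series \<open>F\<^sub>1\<^sub>,\<^sub>0\<^sub>,\<^sub>-\<^sub>n(\<tau>, s)\<close>, which converges absolutely for \<open>Re s > 1\<close>.\<close>

definition niebur_seed :: "nat \<Rightarrow> complex \<Rightarrow> complex \<Rightarrow> complex" where
  "niebur_seed n s w =
     of_real (sqrt (Im w)) * bessel_I (s - 1 / 2) (of_real (2 * pi * real n * Im w))
       * e (- of_nat n * of_real (Re w))"

definition niebur_F :: "nat \<Rightarrow> complex \<Rightarrow> complex \<Rightarrow> complex" where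
  "niebur_F n \<tau> s =
     of_real (2 * pi * sqrt (real n)) *
     (\<Sum>\<^sub>\<infinity>C \<in> left_quot Gamma_inf SL2Z. niebur_seed n s (moebius (rep C) \<tau>))"

text \<open>Analytic continuation from \<open>Re s > 1\<close> to a neighbourhood of \<open>s = 1\<close>. By the identity
  theorem any two such continuations agree near \<open>1\<close>.\<close>

definition continues_to_1 :: "(complex \<Rightarrow> complex) \<Rightarrow> (complex \<Rightarrow> complex) \<Rightarrow> bool" where
  "continues_to_1 F f \<longleftrightarrow>
     (\<exists>U. open U \<and> 1 \<in> U \<and> f holomorphic_on ({s. Re s > 1} \<union> U)) \<and>
     (\<forall>s. Re s > 1 \<longrightarrow> f s = F s)"

definition niebur_F_cont :: "nat \<Rightarrow> complex \<Rightarrow> complex \<Rightarrow> complex" where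
  "niebur_F_cont n \<tau> = (SOME f. continues_to_1 (niebur_F n \<tau>) f)"

text \<open>The sesquiharmonic Maass functions \<open>\<J>\<^sub>1\<^sub>,\<^sub>n\<close>; for \<open>n > 0\<close> this is the coefficient of
  \<open>(s - 1)\<^sup>1\<close> in the Taylor expansion at \<open>s = 1\<close>.\<close>

definition JJ1 :: "nat \<Rightarrow> complex \<Rightarrow> complex" where
  "JJ1 n \<tau> =
     (if n = 0 then of_real (ln (Im \<tau> * norm (dedekind_eta \<tau>) ^ 4) + 1)
      else fps_nth (fps_expansion (niebur_F_cont n \<tau>) 1) 1)"

text \<open>\<open>JJ1_quot n p\<close> is \<open>\<J>\<^sub>1\<^sub>,\<^sub>n\<^sub>/\<^sub>p\<close>, which is \<open>0\<close> unless \<open>p\<close> divides \<open>n\<close>.\<close>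

definition JJ1_quot :: "nat \<Rightarrow> nat \<Rightarrow> complex \<Rightarrow> complex" where
  "JJ1_quot n p \<tau> = (if p dvd n then JJ1 (n div p) \<tau> else 0)"

end

theory Submission
  imports Defs "HOL-Number_Theory.Number_Theory" "HOL-Real_Asymp.Real_Asymp"
begin

text \<open>For \<open>n > 0\<close> and \<open>Re s > 1\<close>, let \<open>\<delta>\<close> run over the upper triangular representatives of
  \<open>\<Gamma>\<setminus>M\<^sub>p\<close> and \<open>t\<close> over a transversal of \<open>\<Gamma>\<^sub>\<infinity>\<setminus>\<Gamma>\<close>. Both the products \<open>t\<delta>\<close> and the
  products \<open>\<delta>t\<close> form a transversal of \<open>\<Gamma>\<^sub>\<infinity>\<setminus>M\<^sub>p\<close>. Summing the seed over the first gives
  \<open>F\<^sub>n | T\<^sub>p\<close>, over the second \<open>F\<^sub>p\<^sub>n + p F\<^sub>n\<^sub>/\<^sub>p\<close>.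

  This identity extends past \<open>s = 1\<close> once every \<open>F\<^sub>n\<close> is continued to a fixed half-plane
  \<open>Re s > 15/16\<close>. The part of the series with lower left entry \<open>c\<close> is a sum over the units
  \<open>r\<close> modulo \<open>c\<close> of \<open>e(- n r\<inverse> / c)\<close> times a slowly varying periodic function of
  \<open>r / c\<close>; a finite Fourier expansion of that function leaves Kloosterman sums, for which
  Kloosterman's fourth moment bound \<open>O(c\<^bsup>3/4 + \<epsilon>\<^esup>)\<close> is enough.

  For \<open>n = 0\<close>, invariance of \<open>y |\<eta>|\<^sup>4\<close> comes from the Kronecker limit formula: the Eisenstein
  sum is compared row by row with the corresponding integrals while \<open>s\<close> tends to \<open>1\<close>, and
  each row is evaluated by the partial fractions of the cotangent. The Hecke sum is then
  computed from \<open>\<Prod>(1 - \<zeta>w) = 1 - w\<^sup>p\<close> over the \<open>p\<close>-th roots of unity \<open>\<zeta>\<close>, applied to the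
  factors of the product for \<open>\<eta>\<close>.\<close>

section \<open>Kloosterman sums\<close>

text \<open>Since \<open>niebur_F_cont\<close> is a choice, some continuation across
  \<open>s = 1\<close> must actually be produced. The trivial estimate, at most \<open>c\<close>
  units with weights of size \<open>c^(-2 Re s)\<close>, stops at \<open>Re s = 1\<close>, so any
  power saving in the sums over units is enough. On \<open>Re s > 15/16\<close> the block of lower
  left entry \<open>c\<close> is bounded by \<open>d(c)\<close>, the number of divisors, times
  \<open>c^(3/4) c^(-15/8) c^(1/16) = c^(-17/16)\<close>: Kloosterman's exponent, twice 15/16, and a
  small power in place of the logarithm that completion costs. The value 15/16 lies halfway between
  7/8, where a saving of \<open>c^(1/4)\<close> runs out, and 1. The saving relies on
  \<open>n \<noteq> 0\<close>; for \<open>n = 0\<close> the Eisenstein series has a pole, and that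
  case is handled by subtracting the pole and passing to a limit. Once the continuation is one
  formula on a half-plane common to all \<open>n\<close> and \<open>\<tau>\<close>, the coefficient
  of \<open>s - 1\<close> is a derivative there and the identity theorem transports the Hecke
  relation.\<close>

lemma e_add: "e (x + y) = e x * e y"
  by (simp add: e_def distrib_left exp_add)

lemma e_of_int [simp]: "e (of_int k) = 1"
  by (auto simp: e_def exp_eq_1)

lemma norm_e_of_real [simp]: "norm (e (of_real x)) = 1"
  by (simp add: e_def norm_exp_eq_Re)

definition ec :: "nat \<Rightarrow> int \<Rightarrow> complex" where
  "ec c k = e (of_real (of_int k / real c))"

lemma ec_add: "ec c (k + l) = ec c k * ec c l"
  by (simp add: ec_def e_add [symmetric] add_divide_distrib)

lemma ec_0 [simp]: "ec c 0 = 1"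
  by (simp add: ec_def e_def)

lemma norm_ec [simp]: "norm (ec c k) = 1"
  unfolding ec_def by (rule norm_e_of_real)

lemma cnj_ec: "cnj (ec c k) = ec c (- k)"
  by (simp add: ec_def e_def exp_cnj)

lemma ec_multiple: "c > 0 \<Longrightarrow> int c dvd k \<Longrightarrow> ec c k = 1"
  by (auto simp: ec_def elim!: dvdE)

lemma ec_cong: "c > 0 \<Longrightarrow> [k = l] (mod int c) \<Longrightarrow> ec c k = ec c l"
  using ec_multiple[of c "k - l"] ec_add[of c "k - l" l]
  by (simp add: cong_iff_dvd_diff)

lemma ec_power: "ec c k ^ j = ec c (int j * k)"
  by (induction j) (auto simp: ec_add algebra_simps)

lemma ec_eq_1_iff:
  assumes "c > 0"
  shows "ec c k = 1 \<longleftrightarrow> int c dvd k"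
proof
  assume "ec c k = 1"
  hence "exp (2 * of_real pi * \<i> * of_real (of_int k / real c)) = 1"
    by (simp add: ec_def e_def)
  then obtain m :: int where "2 * pi * (of_int k / real c) = of_int (2 * m) * pi"
    by (auto simp: exp_eq_1)
  hence "2 * pi * (of_int k / real c) = 2 * pi * of_int m" by (simp add: mult_ac)
  hence "of_int k / real c = of_int m" using pi_neq_zero by (metis mult_cancel_left mult_eq_0_iff zero_neq_numeral)
  hence "of_int k = (of_int (m * int c) :: real)" using assms by (simp add: field_simps)
  hence "k = m * int c" using of_int_eq_iff by blast
  thus "int c dvd k" by simp
qed (use assms in \<open>rule ec_multiple\<close>)

text \<open>Orthogonality of characters: if \<open>c\<close> does not divide \<open>k\<close>, the
  sum is geometric with ratio a nontrivial \<open>c\<close>-th root of unity.\<close>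

lemma sum_ec:
  assumes "c > 0"
  shows "(\<Sum>m\<in>{0..<int c}. ec c (m * k)) = (if int c dvd k then of_nat c else 0)"
proof -
  have "(\<Sum>m\<in>{0..<int c}. ec c (m * k)) = (\<Sum>j<c. ec c (int j * k))"
    by (rule sum.reindex_bij_witness[of _ int nat]) auto
  also have "\<dots> = (\<Sum>j<c. ec c k ^ j)" by (simp add: ec_power)
  also have "\<dots> = (if int c dvd k then of_nat c else 0)"
  proof (cases "int c dvd k")
    case True thus ?thesis using assms by (simp add: ec_multiple)
  next
    case False
    hence "ec c k \<noteq> 1" using assms by (simp add: ec_eq_1_iff)
    moreover have "ec c k ^ c = 1" using assms by (simp add: ec_power ec_multiple)
    ultimately show ?thesis using False by (simp add: geometric_sum)
  qed
  finally show ?thesis .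
qed

text \<open>A unit is carried together with its inverse, so exchanging the two is a visible
  symmetry. For \<open>c = 1\<close> the set is \<open>{(0, 0)}\<close>, as required for the rows
  with lower left entry 1.\<close>

definition unit_pairs :: "nat \<Rightarrow> (int \<times> int) set" where
  "unit_pairs c = {(x, y) \<in> {0..<int c} \<times> {0..<int c}. [x * y = 1] (mod int c)}"

definition kloosterman :: "nat \<Rightarrow> int \<Rightarrow> int \<Rightarrow> complex" where
  "kloosterman c a b = (\<Sum>(x, y)\<in>unit_pairs c. ec c (a * x + b * y))"

lemma finite_unit_pairs [simp]: "finite (unit_pairs c)"
  by (rule finite_subset[of _ "{0..<int c} \<times> {0..<int c}"]) (auto simp: unit_pairs_def)

lemma cong_inverse_unique:
  fixes x y z c :: int
  assumes "[x * y = 1] (mod c)" "[x * z = 1] (mod c)"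
  shows "[y = z] (mod c)"
proof -
  have "[y * (x * z) = y * 1] (mod c)" by (rule cong_mult[OF cong_refl assms(2)])
  moreover have "[z * (x * y) = z * 1] (mod c)" by (rule cong_mult[OF cong_refl assms(1)])
  ultimately show ?thesis by (simp add: mult_ac) (meson cong_sym cong_trans)
qed

lemma residue_cong_eq:
  fixes x y c :: int
  assumes "x \<in> {0..<c}" "y \<in> {0..<c}" "[x = y] (mod c)"
  shows "x = y"
  using assms by (auto simp: cong_def)

lemma inj_on_fst_unit_pairs: "inj_on fst (unit_pairs c)"
proof (rule inj_onI)
  fix p q assume "p \<in> unit_pairs c" "q \<in> unit_pairs c" "fst p = fst q"
  thus "p = q" using residue_cong_eq[of "snd p" "int c" "snd q"] cong_inverse_unique
    by (cases p; cases q) (auto simp: unit_pairs_def)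
qed

lemma unit_pairs_swap: "(x, y) \<in> unit_pairs c \<longleftrightarrow> (y, x) \<in> unit_pairs c"
  by (auto simp: unit_pairs_def mult.commute)

lemma inj_on_snd_unit_pairs: "inj_on snd (unit_pairs c)"
proof (rule inj_onI)
  fix p q assume "p \<in> unit_pairs c" "q \<in> unit_pairs c" "snd p = snd q"
  hence "prod.swap p \<in> unit_pairs c" "prod.swap q \<in> unit_pairs c" "fst (prod.swap p) = fst (prod.swap q)"
    using unit_pairs_swap by (cases p; cases q; force)+
  hence "prod.swap p = prod.swap q" using inj_on_fst_unit_pairs[of c] by (meson inj_onD)
  thus "p = q" by (cases p; cases q) simp
qed

text \<open>With \<open>g = gcd \<alpha> c\<close>, any two solutions agree modulo
  \<open>c / g\<close>, which leaves at most \<open>g\<close> residues modulo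
  \<open>c\<close>.\<close>

lemma card_linear_congruence_le:
  fixes \<alpha> \<beta> :: int
  assumes "c > 0"
  shows "card {x \<in> {0..<int c}. int c dvd \<alpha> * x - \<beta>} \<le> nat (gcd \<alpha> (int c))"
proof (cases "{x \<in> {0..<int c}. int c dvd \<alpha> * x - \<beta>} = {}")
  case True
  show ?thesis unfolding True by simp
next
  case False
  then obtain x0 where x0: "x0 \<in> {0..<int c}" "int c dvd \<alpha> * x0 - \<beta>" by blast
  define g where "g = gcd \<alpha> (int c)"
  have g: "g > 0" using assms by (simp add: g_def)
  obtain c' where c': "int c = g * c'" unfolding g_def by (meson dvdE gcd_dvd2)
  have c'pos: "c' > 0" using c' g assms by (metis of_nat_0_less_iff zero_less_mult_pos)
  have "{x \<in> {0..<int c}. int c dvd \<alpha> * x - \<beta>} \<subseteq> (\<lambda>j. x0 mod c' + j * c') ` {0..<g}"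
  proof
    fix x assume x: "x \<in> {x \<in> {0..<int c}. int c dvd \<alpha> * x - \<beta>}"
    hence "int c dvd \<alpha> * x - \<beta>" by simp
    hence "int c dvd (\<alpha> * x - \<beta>) - (\<alpha> * x0 - \<beta>)" using x0(2) by (rule dvd_diff)
    hence d: "int c dvd \<alpha> * (x - x0)" by (simp add: algebra_simps)
    obtain \<alpha>' where a': "\<alpha> = g * \<alpha>'" unfolding g_def by (meson dvdE gcd_dvd1)
    have "gcd (g * \<alpha>') (g * c') = g" using g_def unfolding a' [symmetric] c' [symmetric] by (rule sym)
    hence "coprime \<alpha>' c'" using g by (simp add: gcd_mult_left coprime_iff_gcd_eq_1)
    moreover have "c' dvd \<alpha>' * (x - x0)" using d g by (simp add: a' c' mult.assoc)
    ultimately have "c' dvd x - x0" by (metis coprime_commute coprime_dvd_mult_right_iff)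
    hence m: "x mod c' = x0 mod c'" by (metis mod_eq_dvd_iff)
    have "x = x0 mod c' + (x div c') * c'" using m by (metis mod_div_mult_eq)
    moreover have "x div c' \<in> {0..<g}"
    proof -
      have "x div c' \<ge> 0" using x c'pos by (simp add: pos_imp_zdiv_nonneg_iff)
      moreover have "x div c' < g"
      proof (rule ccontr)
        assume "\<not> x div c' < g"
        hence "g * c' \<le> x div c' * c'" using c'pos by (intro mult_right_mono) auto
        also have "\<dots> \<le> x" using c'pos by (simp add: minus_mod_eq_div_mult [symmetric])
        finally show False using x c' by simp
      qed
      ultimately show ?thesis by simp
    qed
    ultimately show "x \<in> (\<lambda>j. x0 mod c' + j * c') ` {0..<g}" by blast
  qed
  hence "card {x \<in> {0..<int c}. int c dvd \<alpha> * x - \<beta>} \<le> card ((\<lambda>j. x0 mod c' + j * c') ` {0..<g})"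
    by (intro card_mono) auto
  also have "\<dots> \<le> card {0..<g}" by (rule card_image_le) auto
  finally show ?thesis by (simp add: g_def)
qed

text \<open>The product of two Bezout representations is a multiple of \<open>a b\<close> plus a
  multiple of \<open>c\<close>, hence divisible by the left side.\<close>

lemma gcd_mult_le:
  fixes a b c :: int
  assumes "c > 0"
  shows "gcd (a * b) c \<le> gcd a c * gcd b c"
proof -
  have "gcd (a * b) c dvd gcd a c * gcd b c"
  proof -
    obtain u v where uv: "u * a + v * c = gcd a c" using bezout_int by blast
    obtain u' v' where uv': "u' * b + v' * c = gcd b c" using bezout_int by blast
    have "gcd a c * gcd b c = u * u' * (a * b) + (u * a * v' + v * u' * b + v * v' * c) * c"
      unfolding uv [symmetric] uv' [symmetric] by (simp add: algebra_simps)
    moreover have "gcd (a * b) c dvd u * u' * (a * b)" by (rule dvd_mult) (rule gcd_dvd1)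
    moreover have "gcd (a * b) c dvd (u * a * v' + v * u' * b + v * v' * c) * c"
      by (rule dvd_mult) (rule gcd_dvd2)
    ultimately show ?thesis by (metis dvd_add)
  qed
  thus ?thesis using assms by (intro zdvd_imp_le) auto
qed

text \<open>\<open>gcd v c\<close> is one of the divisors \<open>d\<close> of \<open>c\<close> that
  divide \<open>v\<close>, so it is at most the sum of all of them; after exchanging the sums each
  \<open>d\<close> contributes at most \<open>d (c / d) = c\<close>.\<close>

lemma sum_gcd_le:
  assumes "c > 0"
  shows "(\<Sum>v\<in>{0..<int c}. gcd v (int c)) \<le> int c * int (card {d. d dvd c})"
proof -
  have fin: "finite {d. d dvd c}" using assms by simp
  have "(\<Sum>v\<in>{0..<int c}. gcd v (int c)) \<le> (\<Sum>v\<in>{0..<int c}. \<Sum>d | d dvd c. if int d dvd v then int d else 0)"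
  proof (rule sum_mono)
    fix v
    have "nat (gcd v (int c)) dvd c" by (metis gcd_dvd2 gcd_ge_0_int int_dvd_int_iff nat_0_le)
    moreover have "int (nat (gcd v (int c))) dvd v" by simp
    ultimately have "(\<lambda>d. if int d dvd v then int d else 0) (nat (gcd v (int c)))
        \<le> (\<Sum>d | d dvd c. if int d dvd v then int d else 0)"
      by (intro member_le_sum) (use fin in auto)
    thus "gcd v (int c) \<le> (\<Sum>d | d dvd c. if int d dvd v then int d else 0)" by simp
  qed
  also have "\<dots> = (\<Sum>d | d dvd c. \<Sum>v\<in>{0..<int c}. if int d dvd v then int d else 0)"
    by (rule sum.swap)
  also have "\<dots> \<le> (\<Sum>d | d dvd c. int c)"
  proof (rule sum_mono)
    fix d assume d: "d \<in> {d. d dvd c}"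
    then obtain k where k: "c = d * k" by auto
    hence dk: "d > 0" "k > 0" using assms by auto
    have "{v\<in>{0..<int c}. int d dvd v} \<subseteq> (\<lambda>j. int d * j) ` {0..<int k}"
      using dk by (auto simp: k elim!: dvdE simp: zero_le_mult_iff)
    hence "card {v\<in>{0..<int c}. int d dvd v} \<le> card ((\<lambda>j. int d * j) ` {0..<int k})"
      by (intro card_mono) auto
    also have "\<dots> \<le> card {0..<int k}" by (rule card_image_le) auto
    finally have "card {v\<in>{0..<int c}. int d dvd v} \<le> k" by simp
    moreover have "(\<Sum>v\<in>{0..<int c}. if int d dvd v then int d else 0) = int d * int (card {v\<in>{0..<int c}. int d dvd v})"
      by (subst sum.inter_filter [symmetric]) auto
    ultimately show "(\<Sum>v\<in>{0..<int c}. if int d dvd v then int d else 0) \<le> int c"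
      by (simp add: k mult_left_mono)
  qed
  also have "\<dots> = int c * int (card {d. d dvd c})" by simp
  finally show ?thesis .
qed

text \<open>Parseval in both variables: after opening the square, the sums over \<open>a\<close> and
  \<open>b\<close> each detect a congruence.\<close>

lemma double_second_moment:
  fixes X Y :: "'a \<Rightarrow> int"
  assumes "c > 0" "finite P"
  shows "(\<Sum>a\<in>{0..<int c}. \<Sum>b\<in>{0..<int c}. norm (\<Sum>p\<in>P. ec c (a * X p + b * Y p)) ^ 2) =
    (real c)\<^sup>2 * real (card {(p, q) \<in> P \<times> P. int c dvd X p - X q \<and> int c dvd Y p - Y q})"
proof -
  have norm2: "of_real (norm (\<Sum>p\<in>P. ec c (a * X p + b * Y p)) ^ 2) =
      (\<Sum>(p, q)\<in>P \<times> P. ec c (a * (X p - X q)) * ec c (b * (Y p - Y q)))" for a b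
  proof -
    have "of_real (norm (\<Sum>p\<in>P. ec c (a * X p + b * Y p)) ^ 2) =
        (\<Sum>p\<in>P. ec c (a * X p + b * Y p)) * cnj (\<Sum>p\<in>P. ec c (a * X p + b * Y p))"
      by (simp add: complex_norm_square del: of_real_power)
    also have "\<dots> = (\<Sum>p\<in>P. \<Sum>q\<in>P. ec c (a * X p + b * Y p) * ec c (- (a * X q + b * Y q)))"
      by (simp add: sum_product cnj_ec)
    finally show ?thesis
      by (simp add: sum.cartesian_product ec_add [symmetric] algebra_simps)
  qed
  have "complex_of_real (\<Sum>a\<in>{0..<int c}. \<Sum>b\<in>{0..<int c}. norm (\<Sum>p\<in>P. ec c (a * X p + b * Y p)) ^ 2)
     = (\<Sum>a\<in>{0..<int c}. \<Sum>b\<in>{0..<int c}. \<Sum>(p, q)\<in>P \<times> P. ec c (a * (X p - X q)) * ec c (b * (Y p - Y q)))"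
    by (simp only: of_real_sum norm2)
  also have "\<dots> = (\<Sum>a\<in>{0..<int c}. \<Sum>(p, q)\<in>P \<times> P. \<Sum>b\<in>{0..<int c}. ec c (a * (X p - X q)) * ec c (b * (Y p - Y q)))"
    by (intro sum.cong refl) (subst sum.swap, auto simp: case_prod_unfold)
  also have "\<dots> = (\<Sum>(p, q)\<in>P \<times> P. \<Sum>a\<in>{0..<int c}. \<Sum>b\<in>{0..<int c}. ec c (a * (X p - X q)) * ec c (b * (Y p - Y q)))"
    by (subst sum.swap) (auto simp: case_prod_unfold)
  also have "\<dots> = (\<Sum>(p, q)\<in>P \<times> P. (\<Sum>a\<in>{0..<int c}. ec c (a * (X p - X q))) * (\<Sum>b\<in>{0..<int c}. ec c (b * (Y p - Y q))))"
    by (simp add: sum_product)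
  also have "\<dots> = (\<Sum>(p, q)\<in>P \<times> P. if int c dvd X p - X q \<and> int c dvd Y p - Y q then (of_nat c)\<^sup>2 else 0)"
    by (intro sum.cong refl) (auto simp: sum_ec[OF assms(1)] power2_eq_square)
  also have "\<dots> = (of_nat c)\<^sup>2 * of_nat (card {(p, q) \<in> P \<times> P. int c dvd X p - X q \<and> int c dvd Y p - Y q})"
  proof -
    have "(\<Sum>z\<in>P \<times> P. if int c dvd X (fst z) - X (snd z) \<and> int c dvd Y (fst z) - Y (snd z) then (of_nat c)\<^sup>2 else 0)
       = (\<Sum>z\<in>{z\<in>P \<times> P. int c dvd X (fst z) - X (snd z) \<and> int c dvd Y (fst z) - Y (snd z)}. (of_nat c)\<^sup>2 :: complex)"
      by (rule sum.inter_filter [symmetric]) (use assms in auto)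
    also have "\<dots> = (of_nat c)\<^sup>2 * of_nat (card {z\<in>P \<times> P. int c dvd X (fst z) - X (snd z) \<and> int c dvd Y (fst z) - Y (snd z)})"
      by simp
    also have "{z\<in>P \<times> P. int c dvd X (fst z) - X (snd z) \<and> int c dvd Y (fst z) - Y (snd z)} =
        {(p, q) \<in> P \<times> P. int c dvd X p - X q \<and> int c dvd Y p - Y q}" by auto
    finally show ?thesis by (simp add: case_prod_unfold)
  qed
  finally have "complex_of_real (\<Sum>a\<in>{0..<int c}. \<Sum>b\<in>{0..<int c}. norm (\<Sum>p\<in>P. ec c (a * X p + b * Y p)) ^ 2) =
     complex_of_real ((real c)\<^sup>2 * real (card {(p, q) \<in> P \<times> P. int c dvd X p - X q \<and> int c dvd Y p - Y q}))"
    by simp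
  thus ?thesis using of_real_eq_iff by blast
qed

text \<open>If \<open>x\<^sub>1 + x\<^sub>2 = x\<^sub>3 + x\<^sub>4\<close> for units modulo \<open>c\<close> and the same holds for their inverses, then
  \<open>(x\<^sub>1 + x\<^sub>2)(x\<^sub>3 - x\<^sub>1)(x\<^sub>3 - x\<^sub>2) = 0\<close>; for fixed differences \<open>x\<^sub>3 - x\<^sub>1\<close> and \<open>x\<^sub>3 - x\<^sub>2\<close> this is a
  linear congruence in \<open>x\<^sub>3\<close>.\<close>

lemma card_additive_quadruples:
  assumes "c > 0"
  defines "V \<equiv> unit_pairs c"
  defines "X \<equiv> (\<lambda>((x1 :: int, y1 :: int), (x2 :: int, y2 :: int)). x1 + x2)"
  defines "Y \<equiv> (\<lambda>((x1 :: int, y1 :: int), (x2 :: int, y2 :: int)). y1 + y2)"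
  shows "card {(p, q) \<in> (V \<times> V) \<times> (V \<times> V). int c dvd X p - X q \<and> int c dvd Y p - Y q}
     \<le> 2 * (c * card {d. d dvd c})\<^sup>2"
proof -
  define B where "B = {(p, q) \<in> (V \<times> V) \<times> (V \<times> V). int c dvd X p - X q \<and> int c dvd Y p - Y q}"
  \<comment> \<open>The pair \<open>z\<close> holds \<open>v = x\<^sub>3 - x\<^sub>1\<close> and
    \<open>w = x\<^sub>3 - x\<^sub>2\<close>. Since
    \<open>x\<^sub>1 + x\<^sub>2 = 2 x\<^sub>3 - v - w\<close>, the product relation becomes
    \<open>v w (2 x\<^sub>3 - v - w) = 0\<close> modulo \<open>c\<close>.\<close>
  define T where "T = (SIGMA z:{0..<int c} \<times> {0..<int c}.
      {x \<in> {0..<int c}. int c dvd (2 * fst z * snd z) * x - fst z * snd z * (fst z + snd z)})"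
  define f where "f = (\<lambda>(((x1 :: int, y1 :: int), (x2 :: int, y2 :: int)), ((x3, y3 :: int), (x4 :: int, y4 :: int))).
      (((x3 - x1) mod int c, (x3 - x2) mod int c), x3))"
  have fin: "finite {x \<in> {0..<int c}. Q x}" for Q by (rule finite_subset[of _ "{0..<int c}"]) auto
  have finT: "finite T" unfolding T_def by (intro finite_SigmaI fin finite_cartesian_product) auto
  have "f ` B \<subseteq> T"
  proof (rule image_subsetI)
    fix p assume "p \<in> B"
    moreover obtain x1 y1 x2 y2 x3 y3 x4 y4 where p: "p = (((x1, y1), (x2, y2)), ((x3, y3), (x4, y4)))"
      by (metis prod.exhaust)
    ultimately have "(((x1, y1), (x2, y2)), ((x3, y3), (x4, y4))) \<in> B" by simp
    hence V: "(x1, y1) \<in> V" "(x2, y2) \<in> V" "(x3, y3) \<in> V" "(x4, y4) \<in> V"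
      and s: "int c dvd (x1 + x2) - (x3 + x4)" "int c dvd (y1 + y2) - (y3 + y4)"
      by (auto simp: B_def X_def Y_def)
    define v w where "v = (x3 - x1) mod int c" and "w = (x3 - x2) mod int c"
    have u: "[x1 * y1 = 1] (mod int c)" "[x2 * y2 = 1] (mod int c)"
        "[x3 * y3 = 1] (mod int c)" "[x4 * y4 = 1] (mod int c)"
      using V by (auto simp: V_def unit_pairs_def)
    have y: "[y1 + y2 = y3 + y4] (mod int c)" and x: "[x1 + x2 = x3 + x4] (mod int c)"
      using s by (auto simp: cong_iff_dvd_diff)
    have "[(y1 + y2) * (x1 * x2 * (x3 * x4)) = (y3 + y4) * (x1 * x2 * (x3 * x4))] (mod int c)"
      by (rule cong_mult[OF y cong_refl])
    moreover have "[(y1 + y2) * (x1 * x2 * (x3 * x4)) = (1 * x2 + x1 * 1) * (x3 * x4)] (mod int c)"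
    proof -
      have "(y1 + y2) * (x1 * x2 * (x3 * x4)) = ((x1 * y1) * x2 + x1 * (x2 * y2)) * (x3 * x4)"
        by (simp add: algebra_simps)
      thus ?thesis using u by (metis cong_add cong_mult cong_refl)
    qed
    moreover have "[(y3 + y4) * (x1 * x2 * (x3 * x4)) = (1 * x4 + x3 * 1) * (x1 * x2)] (mod int c)"
    proof -
      have "(y3 + y4) * (x1 * x2 * (x3 * x4)) = ((x3 * y3) * x4 + x3 * (x4 * y4)) * (x1 * x2)"
        by (simp add: algebra_simps)
      thus ?thesis using u by (metis cong_add cong_mult cong_refl)
    qed
    ultimately have "[(x1 + x2) * (x3 * x4) = (x3 + x4) * (x1 * x2)] (mod int c)"
      by (simp add: add.commute) (meson cong_sym cong_trans)
    hence d1: "int c dvd (x1 + x2) * (x3 * x4) - (x3 + x4) * (x1 * x2)"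
      by (simp add: cong_iff_dvd_diff)
    have "(x1 + x2) * ((x3 - x1) * (x3 - x2)) =
       - ((x1 + x2) * (x3 * x4) - (x3 + x4) * (x1 * x2))
       + ((x1 + x2) - (x3 + x4)) * (x1 * x2 - (x1 + x2) * x3)"
      by (simp add: algebra_simps)
    hence "int c dvd (x1 + x2) * ((x3 - x1) * (x3 - x2))"
      using d1 s(1) by (metis dvd_add dvd_minus_iff dvd_mult2)
    moreover have "[(2 * v * w) * x3 - v * w * (v + w) =
        (2 * (x3 - x1) * (x3 - x2)) * x3 - (x3 - x1) * (x3 - x2) * ((x3 - x1) + (x3 - x2))] (mod int c)"
      unfolding v_def w_def by (intro cong_diff cong_mult cong_add cong_refl) (auto simp: cong_def)
    moreover have "(2 * (x3 - x1) * (x3 - x2)) * x3 - (x3 - x1) * (x3 - x2) * ((x3 - x1) + (x3 - x2))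
        = (x1 + x2) * ((x3 - x1) * (x3 - x2))" by (simp add: algebra_simps)
    ultimately have "int c dvd (2 * v * w) * x3 - v * w * (v + w)"
      by (metis cong_dvd_iff)
    thus "f p \<in> T" unfolding p
      using V assms(1) by (auto simp: f_def T_def v_def w_def V_def unit_pairs_def)
  qed
  \<comment> \<open>\<open>x\<^sub>3\<close> and the two differences return \<open>x\<^sub>1\<close>
    and \<open>x\<^sub>2\<close>, the equation of sums returns \<open>x\<^sub>4\<close>, and each
    \<open>y\<close> is determined by its \<open>x\<close>.\<close>
  moreover have "inj_on f B"
  proof (rule inj_onI)
    fix p q assume pq: "p \<in> B" "q \<in> B" "f p = f q"
    obtain x1 y1 x2 y2 x3 y3 x4 y4 where p: "p = (((x1, y1), (x2, y2)), ((x3, y3), (x4, y4)))"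
      by (metis prod.exhaust)
    obtain x1' y1' x2' y2' x3' y3' x4' y4' where q: "q = (((x1', y1'), (x2', y2')), ((x3', y3'), (x4', y4')))"
      by (metis prod.exhaust)
    have V: "(x1, y1) \<in> V" "(x2, y2) \<in> V" "(x3, y3) \<in> V" "(x4, y4) \<in> V"
      and s: "int c dvd (x1 + x2) - (x3 + x4)"
      using pq p by (auto simp: B_def X_def Y_def)
    have V': "(x1', y1') \<in> V" "(x2', y2') \<in> V" "(x3', y3') \<in> V" "(x4', y4') \<in> V"
      and s': "int c dvd (x1' + x2') - (x3' + x4')"
      using pq q by (auto simp: B_def X_def Y_def)
    have R: "x1 \<in> {0..<int c}" "x2 \<in> {0..<int c}" "x3 \<in> {0..<int c}" "x4 \<in> {0..<int c}"
       "x1' \<in> {0..<int c}" "x2' \<in> {0..<int c}" "x3' \<in> {0..<int c}" "x4' \<in> {0..<int c}"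
      using V V' by (auto simp: V_def unit_pairs_def)
    have 3: "x3 = x3'" and m: "(x3 - x1) mod int c = (x3' - x1') mod int c"
       "(x3 - x2) mod int c = (x3' - x2') mod int c" using pq(3) by (auto simp: p q f_def)
    have d: "int c dvd x1' - x1" "int c dvd x2' - x2"
      using m 3 by (auto simp: mod_eq_dvd_iff)
    hence 1: "x1 = x1'" and 2: "x2 = x2'"
      using R residue_cong_eq[of x1' "int c" x1] residue_cong_eq[of x2' "int c" x2]
      by (auto simp: cong_iff_dvd_diff)
    have "int c dvd ((x1 + x2) - (x3 + x4)) - ((x1' + x2') - (x3' + x4'))"
      using s s' by (rule dvd_diff)
    hence 4: "x4 = x4'" using R residue_cong_eq[of x4' "int c" x4]
      by (simp add: cong_iff_dvd_diff 1 2 3)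
    show "p = q" using V V' inj_on_fst_unit_pairs[of c] unfolding p q V_def 1 2 3 4
      by (metis fst_conv inj_onD)
  qed
  ultimately have "card B \<le> card T" using finT by (rule_tac card_inj_on_le)
  also have "card T = (\<Sum>z\<in>{0..<int c} \<times> {0..<int c}.
      card {x \<in> {0..<int c}. int c dvd (2 * fst z * snd z) * x - fst z * snd z * (fst z + snd z)})"
    unfolding T_def by (rule card_SigmaI) (simp, intro ballI fin)
  also have "\<dots> \<le> (\<Sum>z\<in>{0..<int c} \<times> {0..<int c}. nat (2 * (gcd (fst z) (int c) * gcd (snd z) (int c))))"
  proof (rule sum_mono)
    fix z :: "int \<times> int"
    \<comment> \<open>The factor 2 of the final count is the bound for
      \<open>gcd 2 c\<close>.\<close>
    have "gcd (2 * fst z * snd z) (int c) \<le> gcd (2 * fst z) (int c) * gcd (snd z) (int c)"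
      using assms by (intro gcd_mult_le) simp
    also have "\<dots> \<le> (gcd 2 (int c) * gcd (fst z) (int c)) * gcd (snd z) (int c)"
      using assms by (intro mult_right_mono gcd_mult_le) auto
    also have "\<dots> \<le> (2 * gcd (fst z) (int c)) * gcd (snd z) (int c)"
      by (intro mult_right_mono) (auto intro: zdvd_imp_le)
    finally have "nat (gcd (2 * fst z * snd z) (int c)) \<le> nat (2 * (gcd (fst z) (int c) * gcd (snd z) (int c)))"
      by (simp add: mult.assoc nat_mono)
    thus "card {x \<in> {0..<int c}. int c dvd (2 * fst z * snd z) * x - fst z * snd z * (fst z + snd z)}
      \<le> nat (2 * (gcd (fst z) (int c) * gcd (snd z) (int c)))"
      using card_linear_congruence_le[OF assms(1)] by (rule order.trans[rotated])
  qed
  also have "\<dots> = nat (2 * (\<Sum>v\<in>{0..<int c}. gcd v (int c))\<^sup>2)"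
  proof -
    have "(\<Sum>z\<in>{0..<int c} \<times> {0..<int c}. 2 * (gcd (fst z) (int c) * gcd (snd z) (int c)))
        = 2 * (\<Sum>v\<in>{0..<int c}. gcd v (int c))\<^sup>2"
      unfolding sum_distrib_left [symmetric]
      by (simp add: power2_eq_square sum_product sum.cartesian_product case_prod_unfold)
    moreover have "int (\<Sum>z\<in>{0..<int c} \<times> {0..<int c}. nat (2 * (gcd (fst z) (int c) * gcd (snd z) (int c))))
        = (\<Sum>z\<in>{0..<int c} \<times> {0..<int c}. 2 * (gcd (fst z) (int c) * gcd (snd z) (int c)))"
      by simp
    moreover have "int A = B \<Longrightarrow> B = 2 * E \<Longrightarrow> A = nat (2 * E)" for A B E by simp
    ultimately show ?thesis by blast
  qed
  also have "\<dots> \<le> nat (2 * (int c * int (card {d. d dvd c}))\<^sup>2)"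
    using sum_gcd_le[OF assms(1)] by (intro nat_mono mult_left_mono power_mono sum_nonneg) auto
  also have "\<dots> = 2 * (c * card {d. d dvd c})\<^sup>2"
  proof -
    have "2 * (int c * int (card {d. d dvd c}))\<^sup>2 = int (2 * (c * card {d. d dvd c})\<^sup>2)" by simp
    thus ?thesis by (metis nat_int)
  qed
  finally show ?thesis by (simp add: B_def)
qed

text \<open>The square of a Kloosterman sum is an exponential sum over pairs of units, so its fourth
  moment is a second moment that counts additive quadruples.\<close>

lemma kloosterman_fourth_moment:
  assumes "c > 0"
  shows "(\<Sum>a\<in>{0..<int c}. \<Sum>b\<in>{0..<int c}. norm (kloosterman c a b) ^ 4)
    \<le> 2 * real c ^ 4 * real (card {d. d dvd c}) ^ 2"
proof -
  define V where "V = unit_pairs c"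
  define X where "X = (\<lambda>((x1 :: int, y1 :: int), (x2 :: int, y2 :: int)). x1 + x2)"
  define Y where "Y = (\<lambda>((x1 :: int, y1 :: int), (x2 :: int, y2 :: int)). y1 + y2)"
  have "norm (kloosterman c a b) ^ 4 = norm (\<Sum>p\<in>V \<times> V. ec c (a * X p + b * Y p)) ^ 2" for a b
  proof -
    have "kloosterman c a b ^ 2 = (\<Sum>p\<in>V. \<Sum>q\<in>V. ec c (a * fst p + b * snd p) * ec c (a * fst q + b * snd q))"
      by (simp add: kloosterman_def V_def case_prod_unfold power2_eq_square sum_product)
    also have "\<dots> = (\<Sum>p\<in>V \<times> V. ec c (a * X p + b * Y p))"
      by (simp add: X_def Y_def sum.cartesian_product case_prod_unfold ec_add [symmetric] algebra_simps)
    finally have "norm (\<Sum>p\<in>V \<times> V. ec c (a * X p + b * Y p)) = norm (kloosterman c a b) ^ 2"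
      by (metis norm_power)
    thus ?thesis by simp
  qed
  hence "(\<Sum>a\<in>{0..<int c}. \<Sum>b\<in>{0..<int c}. norm (kloosterman c a b) ^ 4) =
      (real c)\<^sup>2 * real (card {(p, q) \<in> (V \<times> V) \<times> (V \<times> V). int c dvd X p - X q \<and> int c dvd Y p - Y q})"
    using double_second_moment[OF assms, of "V \<times> V" X Y] by (simp add: V_def)
  also have "\<dots> \<le> (real c)\<^sup>2 * real (2 * (c * card {d. d dvd c})\<^sup>2)"
    unfolding V_def X_def Y_def
    by (intro mult_left_mono of_nat_mono card_additive_quadruples[OF assms]) auto
  also have "\<dots> = 2 * real c ^ 4 * real (card {d. d dvd c}) ^ 2"
    by (simp add: power_mult_distrib power2_eq_square power4_eq_xxxx)
  finally show ?thesis .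
qed

lemma kloosterman_cong:
  assumes "c > 0" "[a = a'] (mod int c)" "[b = b'] (mod int c)"
  shows "kloosterman c a b = kloosterman c a' b'"
  unfolding kloosterman_def using assms
  by (intro sum.cong refl) (auto intro!: ec_cong cong_add cong_mult)

text \<open>Multiplying the units by \<open>t\<close> multiplies their inverses by
  \<open>t'\<close>, and this permutes \<open>unit_pairs c\<close>.\<close>

lemma kloosterman_twist:
  assumes "c > 0" "(t, t') \<in> unit_pairs c"
  shows "kloosterman c (t * a) (t' * b) = kloosterman c a b"
proof -
  define C where "C = int c"
  have C: "C > 0" using assms(1) by (simp add: C_def)
  have tt: "[t * t' = 1] (mod C)" using assms by (auto simp: unit_pairs_def C_def)
  have *: "(r * x mod C, r' * y mod C) \<in> unit_pairs c"
    if "[r * r' = 1] (mod C)" "(x, y) \<in> unit_pairs c" for r r' x y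
  proof -
    have "[(r * r') * (x * y) = 1 * 1] (mod C)"
      using that by (intro cong_mult) (auto simp: unit_pairs_def C_def)
    hence "[(r * x mod C) * (r' * y mod C) = 1] (mod C)" by (simp add: cong_def mod_mult_eq algebra_simps)
    thus ?thesis using C by (auto simp: unit_pairs_def C_def)
  qed
  have **: "r' * (r * x mod C) mod C = x" if "[r * r' = 1] (mod C)" "x \<in> {0..<C}" for r r' x
  proof -
    have "[(r * r') * x = 1 * x] (mod C)" using that by (intro cong_mult) auto
    thus ?thesis using that(2) by (simp add: cong_def mod_mult_right_eq algebra_simps)
  qed
  have "kloosterman c a b = (\<Sum>(x, y)\<in>unit_pairs c. ec c (a * (t * x mod C) + b * (t' * y mod C)))"
    unfolding kloosterman_def
  proof (rule sum.reindex_bij_witness[of _ "\<lambda>p. (t * fst p mod C, t' * snd p mod C)" "\<lambda>p. (t' * fst p mod C, t * snd p mod C)"])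
    fix p assume p: "p \<in> unit_pairs c"
    hence r: "fst p \<in> {0..<C}" "snd p \<in> {0..<C}" by (auto simp: unit_pairs_def C_def)
    have tt': "[t' * t = 1] (mod C)" using tt by (simp add: mult.commute)
    show "(t * fst p mod C, t' * snd p mod C) \<in> unit_pairs c" "(t' * fst p mod C, t * snd p mod C) \<in> unit_pairs c"
      using *[OF tt, of "fst p" "snd p"] *[OF tt', of "fst p" "snd p"] p by simp_all
    show "(t * fst (t' * fst p mod C, t * snd p mod C) mod C, t' * snd (t' * fst p mod C, t * snd p mod C) mod C) = p"
      "(t' * fst (t * fst p mod C, t' * snd p mod C) mod C, t * snd (t * fst p mod C, t' * snd p mod C) mod C) = p"
      using **[OF tt] **[OF tt'] r by simp_all
    show "(case (t' * fst p mod C, t * snd p mod C) of (x, y) \<Rightarrow> ec c (a * (t * x mod C) + b * (t' * y mod C)))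
        = (case p of (x, y) \<Rightarrow> ec c (a * x + b * y))"
      using **[OF tt] **[OF tt'] r by (simp add: case_prod_unfold)
  qed
  also have "\<dots> = kloosterman c (t * a) (t' * b)"
    unfolding kloosterman_def
  proof (intro sum.cong refl, safe)
    fix x y
    show "ec c (a * (t * x mod C) + b * (t' * y mod C)) = ec c (t * a * x + t' * b * y)"
      using assms(1) unfolding C_def
      by (intro ec_cong) (auto simp: cong_def mod_add_eq mod_mult_right_eq algebra_simps
          intro!: cong_add[unfolded cong_def])
  qed
  finally show ?thesis ..
qed

lemma totient_le_card_unit_pairs:
  assumes "c > 0"
  shows "totient c \<le> card (unit_pairs c)"
proof -
  \<comment> \<open>Totatives lie in \<open>{1..c}\<close>, residues in \<open>{0..<c}\<close>;
    sending 0 to \<open>c\<close> reconciles them and matters only for \<open>c = 1\<close>.\<close>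
  have "totatives c \<subseteq> (\<lambda>k. if k = 0 then c else k) ` nat ` fst ` unit_pairs c"
  proof
    fix k assume "k \<in> totatives c"
    hence k: "k > 0" "k \<le> c" "coprime k c" by (auto simp: totatives_def)
    hence "coprime (int k) (int c)" by simp
    then obtain y where y: "[int k * y = 1] (mod int c)" using cong_solve_coprime_int by blast
    have "(int k mod int c, y mod int c) \<in> unit_pairs c"
      using y assms by (auto simp: unit_pairs_def cong_def mod_mult_eq)
    hence "nat (int k mod int c) \<in> nat ` fst ` unit_pairs c" by force
    moreover have "(if nat (int k mod int c) = 0 then c else nat (int k mod int c)) = k"
      using k by (cases "k = c") (auto simp: zmod_int)
    ultimately show "k \<in> (\<lambda>k. if k = 0 then c else k) ` nat ` fst ` unit_pairs c"
      by (rule image_eqI[rotated, OF _ sym])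
  qed
  hence "totient c \<le> card ((\<lambda>k. if k = 0 then c else k) ` nat ` fst ` unit_pairs c)"
    unfolding totient_def by (intro card_mono) auto
  also have "\<dots> \<le> card (unit_pairs c)"
    by (meson card_image_le finite_imageI finite_unit_pairs order.trans)
  finally show ?thesis .
qed

text \<open>A lower bound for the number of twists without estimating the totient: \<open>c\<close>
  is the sum of \<open>totient d\<close> over its divisors, and each summand is at most
  \<open>totient c\<close>. The loss of a divisor count is harmless in the final series.\<close>

lemma le_divisors_mult_card_unit_pairs:
  assumes "c > 0"
  shows "c \<le> card {d. d dvd c} * card (unit_pairs c)"
proof -
  have "c = (\<Sum>d | d dvd c. totient d)" by (simp add: totient_divisor_sum)
  also have "\<dots> \<le> (\<Sum>d | d dvd c. totient c)"
    using assms by (intro sum_mono) (auto intro!: dvd_imp_le totient_dvd)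
  also have "\<dots> \<le> card {d. d dvd c} * card (unit_pairs c)"
    using totient_le_card_unit_pairs[OF assms] by simp
  finally show ?thesis .
qed

text \<open>The sum does not change under \<open>(a, b) \<mapsto> (t a, t\<inverse> b)\<close>; averaging over these twists turns the
  fourth moment into a bound for a single sum.\<close>

lemma kloosterman_bound:
  assumes c: "c > 0" and b: "b \<noteq> 0"
  shows "norm (kloosterman c a b) \<le> 2 * \<bar>b\<bar> * real c powr (3/4) * real (card {d. d dvd c})"
proof -
  define C where "C = int c"
  define D where "D = real (card {d. d dvd c})"
  define R where "R = {0..<C} \<times> {0..<C}"
  define g where "g = (\<lambda>(t, t'). (t * a mod C, t' * b mod C))"
  define N where "N = (\<lambda>z. norm (kloosterman c (fst z) (snd z)) ^ 4)"
  define K where "K = norm (kloosterman c a b)"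
  have finR: "finite R" by (simp add: R_def)
  have D1: "D \<ge> 1" using c by (auto simp: D_def Suc_le_eq card_gt_0_iff)
  have gR: "g ` unit_pairs c \<subseteq> R" using c by (auto simp: g_def R_def C_def)
  have "real (card (unit_pairs c)) * K ^ 4 = (\<Sum>v\<in>unit_pairs c. N (g v))"
  proof -
    have "N (g v) = K ^ 4" if v: "v \<in> unit_pairs c" for v
    proof -
      obtain t t' where tt: "v = (t, t')" by (cases v)
      have "kloosterman c (t * a mod C) (t' * b mod C) = kloosterman c (t * a) (t' * b)"
        by (rule kloosterman_cong[OF c]) (auto simp: C_def cong_def)
      thus ?thesis using kloosterman_twist[OF c, of t t' a b] v by (simp add: N_def g_def tt K_def)
    qed
    thus ?thesis by simp
  qed
  also have "\<dots> = (\<Sum>z\<in>R. \<Sum>v | v \<in> unit_pairs c \<and> g v = z. N (g v))"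
    by (rule sum.group [symmetric]) (use finR gR in auto)
  also have "\<dots> = (\<Sum>z\<in>R. real (card {v \<in> unit_pairs c. g v = z}) * N z)"
    by (intro sum.cong refl) simp
  \<comment> \<open>The second coordinate of \<open>z\<close> fixes \<open>t' b\<close> modulo
    \<open>c\<close>, so at most \<open>gcd b c\<close> twists reach \<open>z\<close>. As
    \<open>b \<noteq> 0\<close>, this is at most \<open>\<bar>b\<bar>\<close> independently of
    \<open>c\<close>.\<close>
  also have "\<dots> \<le> (\<Sum>z\<in>R. \<bar>b\<bar> * N z)"
  proof (intro sum_mono mult_right_mono)
    fix z assume z: "z \<in> R"
    have "snd ` {v \<in> unit_pairs c. g v = z} \<subseteq> {x \<in> {0..<int c}. int c dvd b * x - snd z}"
      using z by (auto simp: unit_pairs_def g_def C_def R_def mult.commute mod_eq_dvd_iff [symmetric])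
    moreover have "inj_on snd {v \<in> unit_pairs c. g v = z}"
      using inj_on_snd_unit_pairs by (rule inj_on_subset) auto
    ultimately have "card {v \<in> unit_pairs c. g v = z} \<le> card {x \<in> {0..<int c}. int c dvd b * x - snd z}"
      by (intro card_inj_on_le[of snd]) (auto intro: finite_subset[of _ "{0..<int c}"])
    also have "\<dots> \<le> nat (gcd b (int c))" by (rule card_linear_congruence_le[OF c])
    also have "\<dots> \<le> nat \<bar>b\<bar>" using b by (intro nat_mono zdvd_imp_le) auto
    finally show "real (card {v \<in> unit_pairs c. g v = z}) \<le> \<bar>b\<bar>" by linarith
  qed (auto simp: N_def)
  also have "\<dots> = \<bar>b\<bar> * (\<Sum>x\<in>{0..<C}. \<Sum>y\<in>{0..<C}. norm (kloosterman c x y) ^ 4)"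
    by (simp add: R_def N_def sum.cartesian_product sum_distrib_left case_prod_unfold)
  also have "\<dots> \<le> \<bar>b\<bar> * (2 * real c ^ 4 * D ^ 2)"
    unfolding C_def D_def by (intro mult_left_mono kloosterman_fourth_moment[OF c]) auto
  finally have 1: "real (card (unit_pairs c)) * K ^ 4 \<le> \<bar>b\<bar> * (2 * real c ^ 4 * D ^ 2)" .
  have "real c \<le> D * real (card (unit_pairs c))"
    using le_divisors_mult_card_unit_pairs[OF c] by (metis D_def of_nat_le_iff of_nat_mult)
  \<comment> \<open>Up to divisors there are \<open>c\<close> twists; averaging over them gains one
    factor \<open>c\<close> against \<open>c^4\<close>, and the fourth root turns \<open>c^3\<close>
    into \<open>c^(3/4)\<close>.\<close>
  hence "real c * K ^ 4 \<le> D * real (card (unit_pairs c)) * K ^ 4"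
    by (intro mult_right_mono) (auto simp: K_def)
  also have "\<dots> \<le> D * (\<bar>b\<bar> * (2 * real c ^ 4 * D ^ 2))"
    using 1 D1 by (simp add: mult.assoc mult_left_mono)
  finally have "real c * K ^ 4 \<le> real c * ((2 * \<bar>b\<bar>) * real c ^ 3 * D ^ 3)"
    by (simp add: power3_eq_cube power4_eq_xxxx power2_eq_square mult_ac)
  hence "K ^ 4 \<le> (2 * \<bar>b\<bar>) * real c ^ 3 * D ^ 3" using c by simp
  \<comment> \<open>The constants are enlarged to fourth powers so that the root can be taken
    exactly.\<close>
  also have "\<dots> \<le> (2 * \<bar>b\<bar>) ^ 4 * real c ^ 3 * D ^ 4"
  proof (intro mult_mono order.refl)
    show "real_of_int (2 * \<bar>b\<bar>) \<le> real_of_int ((2 * \<bar>b\<bar>) ^ 4)"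
      using b self_le_power[of "2 * \<bar>b\<bar>" 4] by (subst of_int_le_iff) auto
    show "D ^ 3 \<le> D ^ 4" using D1 by (intro power_increasing) auto
  qed (use D1 in auto)
  also have "real c ^ 3 = (real c powr (3/4)) ^ 4"
    using c by (simp add: powr_power)
  also have "real_of_int ((2 * \<bar>b\<bar>) ^ 4) * (real c powr (3/4)) ^ 4 * D ^ 4 = (2 * \<bar>b\<bar> * real c powr (3/4) * D) ^ 4"
    by (simp add: power_mult_distrib)
  finally have "K \<le> 2 * \<bar>b\<bar> * real c powr (3/4) * D"
    by (rule power_le_imp_le_base[of K 3, simplified]) (use D1 in auto)
  thus ?thesis by (simp add: K_def D_def)
qed

section \<open>Sums over units with a slowly varying weight\<close>

text \<open>The chord from 1 to \<open>ec c m\<close> has length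
  \<open>2 \<bar>sin (pi m / c)\<bar>\<close>; the right side is the distance from
  \<open>m / c\<close> to the nearest integer.\<close>

lemma norm_ec_minus_1_ge:
  assumes "m \<in> {1..<int c}"
  shows "norm (ec c m - 1) \<ge> min (of_int m) (of_int (int c - m)) / real c"
proof -
  \<comment> \<open>Third order Taylor bound, using \<open>pi / 2 < 16/10\<close> and
    \<open>(16/10)^2 / 6 < 1/2\<close>.\<close>
  have sin_ge: "sin x \<ge> x / 2" if "0 \<le> x" "x \<le> pi / 2" for x :: real
  proof -
    have x2: "x ^ 2 \<le> (16/10) ^ 2" using that pi_less_4 pi_approx by (intro power_mono) auto
    have "\<bar>sin x - (\<Sum>m<3. sin_coeff m * x ^ m)\<bar> \<le> inverse (fact 3) * \<bar>x\<bar> ^ 3"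
      by (rule Maclaurin_sin_bound)
    also have "(\<Sum>m<3. sin_coeff m * x ^ m) = x"
      by (simp add: numeral_3_eq_3 sin_coeff_def)
    also have "inverse (fact 3) * \<bar>x\<bar> ^ 3 = x * x ^ 2 / 6"
      using that by (simp add: fact_numeral power3_eq_cube power2_eq_square)
    also have "\<dots> \<le> x * (16/10)^2 / 6" using that x2 by (intro divide_right_mono mult_left_mono) auto
    finally have "\<bar>sin x - x\<bar> \<le> x * (16/10)^2 / 6" .
    moreover have "x * (16/10)^2 / 6 \<le> x / 2" using that by (simp add: power2_eq_square)
    ultimately show ?thesis by linarith
  qed
  define \<theta> where "\<theta> = of_int m / real c"
  have \<theta>: "0 \<le> \<theta>" "\<theta> \<le> 1" using assms by (auto simp: \<theta>_def field_simps)
  have "norm (ec c m - 1) = 2 * \<bar>sin (pi * \<theta>)\<bar>"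
  proof -
    have "ec c m = cis (2 * pi * \<theta>)"
      by (simp add: ec_def e_def cis_conv_exp \<theta>_def mult_ac)
    hence "norm (ec c m - 1) ^ 2 = (cos (2 * (pi * \<theta>)) - 1)\<^sup>2 + (sin (2 * (pi * \<theta>)))\<^sup>2"
      by (simp add: cmod_power2 mult_ac)
    also have "\<dots> = 2 - 2 * cos (2 * (pi * \<theta>))"
      using sin_cos_squared_add[of "2 * (pi * \<theta>)"] by (simp add: power2_eq_square algebra_simps)
    also have "\<dots> = (2 * \<bar>sin (pi * \<theta>)\<bar>) ^ 2"
      by (simp add: cos_double_sin power_mult_distrib)
    finally show ?thesis by (metis abs_ge_zero mult_nonneg_nonneg norm_ge_zero power2_eq_imp_eq zero_le_numeral)
  qed
  also have "2 * \<bar>sin (pi * \<theta>)\<bar> \<ge> min \<theta> (1 - \<theta>)"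
  proof (cases "\<theta> \<le> 1/2")
    case True
    have "sin (pi * \<theta>) \<ge> (pi * \<theta>) / 2" using True \<theta> by (intro sin_ge) auto
    moreover have "pi * \<theta> \<ge> 1 * \<theta>" using \<theta> pi_gt3 by (intro mult_right_mono) auto
    ultimately have "2 * sin (pi * \<theta>) \<ge> \<theta>" by linarith
    thus ?thesis by linarith
  next
    case False
    have *: "sin (pi * (1 - \<theta>)) = sin (pi * \<theta>)" by (simp add: algebra_simps sin_diff)
    have "sin (pi * (1 - \<theta>)) \<ge> (pi * (1 - \<theta>)) / 2" using False \<theta> by (intro sin_ge) auto
    hence "sin (pi * \<theta>) \<ge> (pi * (1 - \<theta>)) / 2" unfolding * .
    moreover have "pi * (1 - \<theta>) \<ge> 1 * (1 - \<theta>)" using \<theta> pi_gt3 by (intro mult_right_mono) auto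
    moreover have "a / 2 \<le> b \<Longrightarrow> 1 * d \<le> a \<Longrightarrow> d \<le> 2 * b" for a b d :: real by simp
    ultimately have "2 * sin (pi * \<theta>) \<ge> 1 - \<theta>" by blast
    thus ?thesis by linarith
  qed
  finally show ?thesis using assms by (simp add: \<theta>_def min_divide_distrib_right field_simps)
qed

text \<open>Completion: expanding \<open>H\<close> in characters modulo \<open>c\<close> reduces a sum over units weighted by the
  slowly varying \<open>H\<close> to Kloosterman sums.\<close>

lemma norm_twisted_unit_sum_le:
  fixes H :: "int \<Rightarrow> complex"
  assumes c: "c > 0" and per: "\<And>r. H (r + int c) = H r"
    and M: "\<And>r. r \<in> {0..<int c} \<Longrightarrow> norm (H r) \<le> M"
    and L: "\<And>r. r \<in> {0..<int c} \<Longrightarrow> norm (H (r + 1) - H r) \<le> M / c"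
    and B: "\<And>a. norm (kloosterman c a b) \<le> B"
  shows "norm (\<Sum>(x, y)\<in>unit_pairs c. ec c (b * y) * H x) \<le> B * (M * (1 + 2 * (\<Sum>m=1..c. 1 / real m)))"
proof -
  \<comment> \<open>The finite Fourier coefficients of \<open>H\<close>.\<close>
  define F where "F = (\<lambda>m. (\<Sum>r\<in>{0..<int c}. H r * ec c (- (m * r))) / of_nat c)"
  have B0: "B \<ge> 0" by (rule order.trans[OF norm_ge_zero B[of 0]])
  have M0: "M \<ge> 0" using order.trans[OF norm_ge_zero M[of 0]] c by simp
  have inv: "H x = (\<Sum>m\<in>{0..<int c}. F m * ec c (m * x))" if x: "x \<in> {0..<int c}" for x
  proof -
    have "(\<Sum>m\<in>{0..<int c}. F m * ec c (m * x)) =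
        (\<Sum>m\<in>{0..<int c}. \<Sum>r\<in>{0..<int c}. H r / of_nat c * ec c (m * (x - r)))"
      unfolding F_def sum_distrib_right sum_divide_distrib
    proof (intro sum.cong refl)
      fix m r
      have "ec c (- (m * r)) * ec c (m * x) = ec c (m * (x - r))"
        unfolding ec_add [symmetric] by (simp add: algebra_simps)
      thus "H r * ec c (- (m * r)) / of_nat c * ec c (m * x) = H r / of_nat c * ec c (m * (x - r))"
        by (simp add: mult.assoc)
    qed
    also have "\<dots> = (\<Sum>r\<in>{0..<int c}. H r / of_nat c * (\<Sum>m\<in>{0..<int c}. ec c (m * (x - r))))"
      by (subst sum.swap) (simp add: sum_distrib_left)
    also have "\<dots> = (\<Sum>r\<in>{0..<int c}. if r = x then H x else 0)"
    proof (intro sum.cong refl)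
      fix r assume r: "r \<in> {0..<int c}"
      have "int c dvd x - r \<longleftrightarrow> x = r"
        using x r residue_cong_eq[of x "int c" r] by (auto simp: cong_iff_dvd_diff)
      thus "H r / of_nat c * (\<Sum>m\<in>{0..<int c}. ec c (m * (x - r))) = (if r = x then H x else 0)"
        using c by (simp add: sum_ec)
    qed
    also have "\<dots> = H x" using x by simp
    finally show ?thesis ..
  qed
  have "(\<Sum>(x, y)\<in>unit_pairs c. ec c (b * y) * H x)
      = (\<Sum>(x, y)\<in>unit_pairs c. \<Sum>m\<in>{0..<int c}. F m * ec c (m * x + b * y))"
  proof (intro sum.cong refl, safe)
    fix x y assume "(x, y) \<in> unit_pairs c"
    hence x: "x \<in> {0..<int c}" by (auto simp: unit_pairs_def)
    show "ec c (b * y) * H x = (\<Sum>m\<in>{0..<int c}. F m * ec c (m * x + b * y))"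
      by (subst inv[OF x]) (simp add: sum_distrib_left ec_add mult_ac)
  qed
  also have "\<dots> = (\<Sum>m\<in>{0..<int c}. F m * kloosterman c m b)"
    unfolding case_prod_unfold by (subst sum.swap) (simp add: kloosterman_def case_prod_unfold sum_distrib_left)
  finally have "norm (\<Sum>(x, y)\<in>unit_pairs c. ec c (b * y) * H x) \<le> (\<Sum>m\<in>{0..<int c}. norm (F m) * norm (kloosterman c m b))"
    using norm_sum[of "\<lambda>m. F m * kloosterman c m b" "{0..<int c}"] by (simp add: norm_mult)
  also have "\<dots> \<le> (\<Sum>m\<in>{0..<int c}. norm (F m) * B)"
    by (intro sum_mono mult_left_mono B) auto
  also have "\<dots> = B * (\<Sum>m\<in>{0..<int c}. norm (F m))" by (simp add: sum_distrib_left mult.commute)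
  also have "\<dots> \<le> B * (M * (1 + 2 * (\<Sum>m=1..c. 1 / real m)))"
  proof (intro mult_left_mono B0)
    have F0: "norm (F 0) \<le> M"
    proof -
      have "norm (\<Sum>r\<in>{0..<int c}. H r) \<le> (\<Sum>r\<in>{0..<int c}. M)" by (intro sum_norm_le M)
      thus ?thesis using c by (simp add: F_def norm_divide divide_le_eq mult.commute)
    qed
    \<comment> \<open>Replacing \<open>H r\<close> by \<open>H (r + 1) - H r\<close> multiplies the
      \<open>m\<close>-th coefficient by \<open>ec c m - 1\<close>. The differences are at most
      \<open>M / c\<close>, so the chord bound yields \<open>1/m + 1/(c - m)\<close>, whose sum over
      \<open>m\<close> is only logarithmic in \<open>c\<close>.\<close>
    have Fm: "norm (F m) \<le> M * (1 / of_int m + 1 / of_int (int c - m))" if m: "m \<in> {1..<int c}" for m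
    proof -
      have "(\<Sum>r\<in>{0..<int c}. H (r + 1) * ec c (- (m * r))) = (\<Sum>r\<in>{1..int c}. H r * ec c (- (m * (r - 1))))"
        by (rule sum.reindex_bij_witness[of _ "\<lambda>r. r - 1" "\<lambda>r. r + 1"]) auto
      also have "\<dots> = (\<Sum>r\<in>{1..int c}. (H r * ec c (- (m * r))) * ec c m)"
        unfolding mult.assoc ec_add [symmetric] by (intro sum.cong refl) (simp add: algebra_simps)
      also have "\<dots> = (\<Sum>r\<in>{1..<int c}. (H r * ec c (- (m * r))) * ec c m) + (H (int c) * ec c (- (m * int c))) * ec c m"
      proof -
        have "{1..int c} = insert (int c) {1..<int c}" using c by auto
        thus ?thesis by simp
      qed
      also have "H (int c) * ec c (- (m * int c)) = H 0 * ec c (- (m * 0))"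
        using per[of 0] c by (simp add: ec_multiple)
      also have "(\<Sum>r\<in>{1..<int c}. (H r * ec c (- (m * r))) * ec c m) + H 0 * ec c (- (m * 0)) * ec c m
          = (\<Sum>r\<in>{0..<int c}. (H r * ec c (- (m * r))) * ec c m)"
      proof -
        have "{0..<int c} = insert 0 {1..<int c}" using c by auto
        thus ?thesis by simp
      qed
      also have "\<dots> = ec c m * (of_nat c * F m)"
        unfolding sum_distrib_right [symmetric] using c by (simp add: F_def)
      finally have "(\<Sum>r\<in>{0..<int c}. (H (r + 1) - H r) * ec c (- (m * r))) = (ec c m - 1) * (of_nat c * F m)"
        using c by (simp add: left_diff_distrib sum_subtractf F_def)
      moreover have "norm (\<Sum>r\<in>{0..<int c}. (H (r + 1) - H r) * ec c (- (m * r))) \<le> (\<Sum>r\<in>{0..<int c}. M / c)"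
        using L by (intro sum_norm_le) (simp add: norm_mult)
      ultimately have "norm (ec c m - 1) * (real c * norm (F m)) \<le> M"
        using c by (simp add: norm_mult)
      moreover have "min (of_int m) (of_int (int c - m)) / real c * (real c * norm (F m))
           \<le> norm (ec c m - 1) * (real c * norm (F m))"
        by (intro mult_right_mono norm_ec_minus_1_ge m) auto
      ultimately have *: "min (of_int m) (of_int (int c - m)) * norm (F m) \<le> M" using c by simp
      have mp: "of_int m > (0::real)" "of_int (int c - m) > (0::real)" using m by auto
      have "norm (F m) \<le> M / min (of_int m) (of_int (int c - m))"
        using * mp by (simp add: pos_le_divide_eq mult.commute)
      also have "\<dots> \<le> M * (1 / of_int m + 1 / of_int (int c - m))"
      proof -
        have "1 / min a b \<le> 1 / a + 1 / b" if "a > 0" "b > 0" for a b :: real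
          using that by (auto simp: min_def)
        from mult_left_mono[OF this[OF mp] M0] show ?thesis by simp
      qed
      finally show ?thesis .
    qed
    have "(\<Sum>m\<in>{0..<int c}. norm (F m)) = norm (F 0) + (\<Sum>m\<in>{1..<int c}. norm (F m))"
    proof -
      have "{0..<int c} = insert 0 {1..<int c}" using c by auto
      thus ?thesis by simp
    qed
    also have "\<dots> \<le> M + (\<Sum>m\<in>{1..<int c}. M * (1 / of_int m + 1 / of_int (int c - m)))"
      by (intro add_mono F0 sum_mono Fm)
    also have "\<dots> = M * (1 + ((\<Sum>m\<in>{1..<int c}. 1 / of_int m) + (\<Sum>m\<in>{1..<int c}. 1 / of_int (int c - m))))"
      by (simp add: sum_distrib_left sum.distrib distrib_left)
    also have "(\<Sum>m\<in>{1..<int c}. 1 / of_int (int c - m)) = (\<Sum>m\<in>{1..<int c}. 1 / of_int m :: real)"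
      by (rule sum.reindex_bij_witness[of _ "\<lambda>m. int c - m" "\<lambda>m. int c - m"]) auto
    also have "(\<Sum>m\<in>{1..<int c}. 1 / of_int m :: real) = (\<Sum>m\<in>{1..<c}. 1 / real m)"
      by (rule sum.reindex_bij_witness[of _ int nat]) auto
    also have "(\<Sum>m\<in>{1..<c}. 1 / real m) + (\<Sum>m\<in>{1..<c}. 1 / real m) = 2 * (\<Sum>m\<in>{1..<c}. 1 / real m)" by simp
    also have "M * (1 + 2 * (\<Sum>m\<in>{1..<c}. 1 / real m)) \<le> M * (1 + 2 * (\<Sum>m=1..c. 1 / real m))"
      using M0 by (intro mult_left_mono add_left_mono sum_mono2) auto
    finally show "(\<Sum>m\<in>{0..<int c}. norm (F m)) \<le> M * (1 + 2 * (\<Sum>m=1..c. 1 / real m))" .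
  qed
  finally show ?thesis .
qed

text \<open>A small power replaces the logarithm: \<open>1/m \<le> c^(1/16) m^(-17/16)\<close> for
  \<open>m \<le> c\<close>. The choice 1/16 keeps the total exponent of \<open>c\<close> below
  -1.\<close>

lemma harmonic_sum_le:
  "\<exists>C\<ge>0. \<forall>c>0. 1 + 2 * (\<Sum>m=1..c. 1 / real m) \<le> C * real c powr (1/16)"
proof -
  have sm: "summable (\<lambda>m. real m powr (-17/16))" by (subst summable_real_powr_iff) simp
  define S where "S = (\<Sum>m. real m powr (-17/16))"
  have S0: "S \<ge> 0" unfolding S_def by (rule suminf_nonneg[OF sm]) simp
  have "1 + 2 * (\<Sum>m=1..c. 1 / real m) \<le> (1 + 2 * S) * real c powr (1/16)" if c: "c > 0" for c
  proof -
    have "(\<Sum>m=1..c. 1 / real m) \<le> (\<Sum>m=1..c. real c powr (1/16) * real m powr (-17/16))"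
    proof (rule sum_mono)
      fix m assume m: "m \<in> {1..c}"
      have "1 / real m = real m powr (1/16) * real m powr (-17/16)"
        using m by (simp add: powr_minus_divide [of _ 1, symmetric] flip: powr_add)
      also have "\<dots> \<le> real c powr (1/16) * real m powr (-17/16)"
        using m by (intro mult_right_mono powr_mono2) auto
      finally show "1 / real m \<le> real c powr (1/16) * real m powr (-17/16)" .
    qed
    also have "\<dots> = real c powr (1/16) * (\<Sum>m=1..c. real m powr (-17/16))" by (simp add: sum_distrib_left)
    also have "\<dots> \<le> real c powr (1/16) * S"
      unfolding S_def by (intro mult_left_mono sum_le_suminf sm) auto
    finally have "(\<Sum>m=1..c. 1 / real m) \<le> real c powr (1/16) * S" .
    moreover have "1 \<le> real c powr (1/16)" using c by (intro ge_one_powr_ge_zero) auto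
    ultimately show ?thesis by (simp add: algebra_simps)
  qed
  thus ?thesis using S0 by (intro exI[of _ "1 + 2 * S"]) auto
qed

text \<open>The Dirichlet series of the divisor function is the square of zeta: a product of two
  convergent series, regrouped along \<open>c = x y\<close>.\<close>

lemma summable_on_divisor_powr:
  "(\<lambda>c. real (card {d. d dvd c}) * real c powr (-17/16)) summable_on {1..}"
proof -
  define a where "a = (\<lambda>m. real m powr (-17/16))"
  have sm: "summable a" unfolding a_def by (subst summable_real_powr_iff) simp
  have "a summable_on UNIV" by (rule norm_summable_imp_summable_on) (use sm in \<open>simp add: a_def\<close>)
  hence S: "a summable_on {1..}" by (rule summable_on_subset) simp
  have "(\<lambda>(x, y). a x * a y) summable_on {1..} \<times> {1..}"
  proof (rule summable_on_SigmaI)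
    show "((\<lambda>y. case (x, y) of (x, y) \<Rightarrow> a x * a y) has_sum a x * infsum a {1..}) {1..}" for x
      unfolding prod.case by (intro has_sum_cmult_right has_sum_infsum S)
    show "(\<lambda>x. a x * infsum a {1..}) summable_on {1..}" by (intro summable_on_cmult_left S)
  qed (auto simp: a_def)
  also have "?this \<longleftrightarrow> (\<lambda>(c, d). a d * a (c div d)) summable_on (SIGMA c:{1..}. {d. d dvd c})"
    by (rule summable_on_reindex_bij_witness[of _ "\<lambda>(c, d). (d, c div d)" "\<lambda>(x, y). (x * y, x)"])
       (auto simp: Suc_le_eq intro!: Nat.gr0I elim!: dvdE)
  finally have "(\<lambda>c. \<Sum>\<^sub>\<infinity>d\<in>{d. d dvd c}. a d * a (c div d)) summable_on {1..}"
    using summable_on_Sigma_banach[of "\<lambda>c d. a d * a (c div d)" "{1..}" "\<lambda>c. {d. d dvd c}"] by simp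
  also have "?this \<longleftrightarrow> (\<lambda>c. real (card {d. d dvd c}) * real c powr (-17/16)) summable_on {1..}"
  proof (intro summable_on_cong)
    fix c :: nat assume c: "c \<in> {1..}"
    have "(\<Sum>\<^sub>\<infinity>d\<in>{d. d dvd c}. a d * a (c div d)) = (\<Sum>d | d dvd c. a d * a (c div d))"
      using c by (intro infsum_finite) auto
    also have "\<dots> = (\<Sum>d | d dvd c. a c)"
      by (intro sum.cong refl) (auto simp: a_def powr_mult [symmetric] of_nat_mult [symmetric] simp del: of_nat_mult)
    finally show "(\<Sum>\<^sub>\<infinity>d\<in>{d. d dvd c}. a d * a (c div d)) = real (card {d. d dvd c}) * real c powr (-17/16)"
      by (simp add: a_def)
  qed
  finally show ?thesis .
qed

section \<open>Holomorphic series and the entire factor of the Bessel function\<close>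

lemma holomorphic_on_infsum:
  fixes f :: "'a \<Rightarrow> complex \<Rightarrow> complex"
  assumes S: "open S" and hol: "\<And>i. i \<in> I \<Longrightarrow> f i holomorphic_on S"
    and bound: "\<And>R. \<exists>M. M summable_on I \<and> (\<forall>i\<in>I. \<forall>w\<in>S. norm w \<le> R \<longrightarrow> norm (f i w) \<le> M i)"
  shows "(\<lambda>w. \<Sum>\<^sub>\<infinity>i\<in>I. f i w) holomorphic_on S"
proof -
  have "\<exists>f'. ((\<lambda>w. \<Sum>\<^sub>\<infinity>i\<in>I. f i w) has_field_derivative f') (at z)" if z: "z \<in> S" for z
  proof -
    obtain r where r: "r > 0" "cball z r \<subseteq> S" using S z by (meson open_contains_cball)
    \<comment> \<open>The closed ball lies in the disc of radius \<open>norm z + r\<close> about 0,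
      so one majorant serves the whole ball.\<close>
    obtain M where M: "M summable_on I" "\<And>i w. i \<in> I \<Longrightarrow> w \<in> S \<Longrightarrow> norm w \<le> norm z + r \<Longrightarrow> norm (f i w) \<le> M i"
      using bound by meson
    have ul: "uniform_limit (cball z r) (\<lambda>X w. \<Sum>i\<in>X. f i w) (\<lambda>w. \<Sum>\<^sub>\<infinity>i\<in>I. f i w) (finite_subsets_at_top I)"
    proof (rule Weierstrass_m_test_general[OF _ M(1)])
      fix i w assume i: "i \<in> I" and w: "w \<in> cball z r"
      have "norm w \<le> norm z + norm (w - z)" by (metis add.commute diff_add_cancel norm_triangle_ineq)
      hence "norm w \<le> norm z + r" using w by (simp add: dist_norm norm_minus_commute)
      thus "norm (f i w) \<le> M i" using i w r by (intro M(2)) auto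
    qed
    have "\<forall>\<^sub>F X in finite_subsets_at_top I. continuous_on (cball z r) (\<lambda>w. \<Sum>i\<in>X. f i w) \<and>
            (\<lambda>w. \<Sum>i\<in>X. f i w) holomorphic_on ball z r"
    proof (rule eventually_finite_subsets_at_top_weakI)
      fix X assume X: "finite X" "X \<subseteq> I"
      have "(\<lambda>w. \<Sum>i\<in>X. f i w) holomorphic_on S" using X hol by (intro holomorphic_on_sum) auto
      thus "continuous_on (cball z r) (\<lambda>w. \<Sum>i\<in>X. f i w) \<and> (\<lambda>w. \<Sum>i\<in>X. f i w) holomorphic_on ball z r"
        using r by (meson ball_subset_cball holomorphic_on_imp_continuous_on holomorphic_on_subset order_trans)
    qed
    from holomorphic_uniform_limit[OF this ul] have "(\<lambda>w. \<Sum>\<^sub>\<infinity>i\<in>I. f i w) holomorphic_on ball z r" by auto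
    thus ?thesis using r by (metis at_within_open centre_in_ball field_differentiable_def holomorphic_on_def open_ball)
  qed
  thus ?thesis using S by (auto simp: holomorphic_on_open)
qed

text \<open>The factor of the Bessel function that is entire in \<open>t = (z/2)^2\<close>:
  \<open>I_(s - 1/2)(z) = (z/2)^(s - 1/2) bessel_E s t\<close>.\<close>

definition bessel_E :: "complex \<Rightarrow> complex \<Rightarrow> complex" where
  "bessel_E s t = (\<Sum>k. (rGamma (s + 1/2 + of_nat k) / fact k) * t ^ k)"

text \<open>By \<open>1/\<Gamma>(z) = z / \<Gamma>(z + 1)\<close>, each unit step divides by a
  number of modulus at least 1.\<close>

lemma norm_rGamma_plus_of_nat_le:
  assumes "Re z \<ge> 1"
  shows "norm (rGamma (z + of_nat k)) \<le> norm (rGamma z)"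
proof (induction k)
  case (Suc k)
  have "norm (z + of_nat k) \<ge> 1" using assms complex_Re_le_cmod[of "z + of_nat k"] by simp
  hence "norm (rGamma (z + of_nat (Suc k))) \<le> norm (z + of_nat k) * norm (rGamma (z + of_nat (Suc k)))"
    by (simp add: mult_le_cancel_right1)
  also have "\<dots> = norm (rGamma (z + of_nat k))"
    using rGamma_plus1[of "z + of_nat k"] by (metis add.assoc add.commute norm_mult of_nat_Suc)
  finally show ?case using Suc by simp
qed simp

context
  fixes s :: complex
  assumes s: "Re s > 1/2"
begin

lemma norm_bessel_E_term_le:
  "norm (rGamma (s + 1/2 + of_nat k) / fact k * t ^ k) \<le> norm (rGamma (s + 1/2)) * (norm t ^ k / fact k)"
proof -
  have "norm (rGamma (s + 1/2 + of_nat k)) \<le> norm (rGamma (s + 1/2))"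
    using s by (intro norm_rGamma_plus_of_nat_le) simp
  thus ?thesis
    by (simp add: norm_mult norm_divide norm_power divide_right_mono mult_right_mono)
qed

lemma summable_norm_bessel_E: "summable (\<lambda>k. norm (rGamma (s + 1/2 + of_nat k) / fact k * t ^ k))"
proof (rule summable_comparison_test')
  show "summable (\<lambda>k. norm (rGamma (s + 1/2)) * (norm t ^ k / fact k))"
    using summable_exp[of "norm t"] by (intro summable_mult) (simp add: field_simps)
qed (use norm_bessel_E_term_le in simp)

lemma norm_bessel_E_le: "norm (bessel_E s t) \<le> norm (rGamma (s + 1/2)) * exp (norm t)"
proof -
  have "norm (bessel_E s t) \<le> (\<Sum>k. norm (rGamma (s + 1/2 + of_nat k) / fact k * t ^ k))"
    unfolding bessel_E_def by (rule summable_norm[OF summable_norm_bessel_E])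
  also have "\<dots> \<le> (\<Sum>k. norm (rGamma (s + 1/2)) * (norm t ^ k / fact k))"
    using norm_bessel_E_term_le summable_norm_bessel_E summable_exp[of "norm t"]
    by (intro suminf_le summable_mult) (simp_all add: field_simps)
  also have "\<dots> = norm (rGamma (s + 1/2)) * exp (norm t)"
    using summable_exp[of "norm t"] by (subst suminf_mult) (simp_all add: exp_def field_simps scaleR_conv_of_real)
  finally show ?thesis .
qed

text \<open>Termwise differentiation shifts \<open>k\<close> by one, and the coefficients absorb the
  shift into \<open>s\<close>.\<close>

lemma bessel_E_has_field_derivative:
  "(bessel_E s has_field_derivative bessel_E (s + 1) t) (at t)"
proof -
  have "((\<lambda>t. \<Sum>k. (rGamma (s + 1/2 + of_nat k) / fact k) * t ^ k) has_field_derivative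
      (\<Sum>k. diffs (\<lambda>k. rGamma (s + 1/2 + of_nat k) / fact k) k * t ^ k)) (at t)"
    by (rule termdiffs_strong_converges_everywhere) (rule summable_norm_cancel[OF summable_norm_bessel_E])
  also have "diffs (\<lambda>k. rGamma (s + 1/2 + of_nat k) / fact k) = (\<lambda>k. rGamma (s + 1 + 1/2 + of_nat k) / fact k)"
    by (auto simp: diffs_def fact_reduce add_ac simp del: of_nat_Suc) (simp add: add_ac)?
  finally show ?thesis by (simp add: bessel_E_def [abs_def])
qed

end

lemma holomorphic_bessel_E: "(\<lambda>s. bessel_E s t) holomorphic_on {s. Re s > 1/2}"
proof -
  have "bounded ((\<lambda>s::complex. rGamma (s + 1/2)) ` cball 0 R)" for R :: real
    by (intro compact_imp_bounded compact_continuous_image holomorphic_on_imp_continuous_on holomorphic_intros) auto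
  hence "\<exists>G. \<forall>s::complex. norm s \<le> R \<longrightarrow> norm (rGamma (s + 1/2)) \<le> G" for R
    unfolding bounded_iff by (metis image_eqI mem_cball_0)
  then obtain G where G: "\<And>R s::complex. norm s \<le> R \<Longrightarrow> norm (rGamma (s + 1/2)) \<le> G R" by metis
  have "(\<lambda>s. \<Sum>\<^sub>\<infinity>k. rGamma (s + 1/2 + of_nat k) / fact k * t ^ k) holomorphic_on {s. Re s > 1/2}"
  proof (rule holomorphic_on_infsum)
    fix R
    have "(\<lambda>k. G R * (norm t ^ k / fact k)) summable_on UNIV"
      using summable_exp[of "norm t"]
      by (intro summable_on_cmult_right norm_summable_imp_summable_on) (simp add: field_simps)
    moreover have "norm (rGamma (w + 1/2 + of_nat k) / fact k * t ^ k) \<le> G R * (norm t ^ k / fact k)"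
      if "Re w > 1/2" "norm w \<le> R" for w k
      using norm_bessel_E_term_le[OF that(1), of k t] G[OF that(2)]
      by (meson divide_nonneg_nonneg fact_ge_zero mult_right_mono norm_ge_zero order_trans zero_le_power)
    ultimately show "\<exists>M. M summable_on UNIV \<and> (\<forall>k\<in>UNIV. \<forall>w\<in>{s. Re s > 1/2}. norm w \<le> R \<longrightarrow>
        norm (rGamma (w + 1/2 + of_nat k) / fact k * t ^ k) \<le> M k)"
      by (intro exI[of _ "\<lambda>k. G R * (norm t ^ k / fact k)"]) auto
  qed (simp_all only: open_halfspace_Re_gt, auto intro!: holomorphic_intros)
  moreover have "(\<Sum>\<^sub>\<infinity>k. rGamma (s + 1/2 + of_nat k) / fact k * t ^ k) = bessel_E s t" if "Re s > 1/2" for s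
    unfolding bessel_E_def
    by (intro infsumI norm_summable_imp_has_sum summable_norm_bessel_E that summable_sums
          summable_norm_cancel[OF summable_norm_bessel_E])
  ultimately show ?thesis by (subst (asm) holomorphic_cong[OF refl]) auto
qed

section \<open>Analytic continuation of the Niebur Poincare series\<close>

lemma summable_on_int_powr:
  assumes "\<sigma> > 1"
  shows "(\<lambda>k::int. (1 + \<bar>of_int k\<bar>) powr (-\<sigma>) :: real) summable_on UNIV"
proof -
  define g where "g = (\<lambda>k::int. (1 + \<bar>of_int k\<bar>) powr (-\<sigma>) :: real)"
  have "summable (\<lambda>m. real (m + 1) powr (-\<sigma>))"
    by (rule summable_ignore_initial_segment) (use assms in \<open>simp add: summable_real_powr_iff\<close>)
  hence N: "(\<lambda>m. real (m + 1) powr (-\<sigma>)) summable_on UNIV"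
    by (intro norm_summable_imp_summable_on) simp
  have "g summable_on {0..} \<longleftrightarrow> (\<lambda>m. real (m + 1) powr (-\<sigma>)) summable_on UNIV"
    by (rule summable_on_reindex_bij_witness[of _ int nat]) (auto simp: g_def add.commute)
  hence 1: "g summable_on {0..}" using N by simp
  have "g summable_on {..0} \<longleftrightarrow> (\<lambda>m. real (m + 1) powr (-\<sigma>)) summable_on UNIV"
    by (rule summable_on_reindex_bij_witness[of _ "\<lambda>m. - int m" "\<lambda>k. nat (- k)"]) (auto simp: g_def add.commute)
  hence 2: "g summable_on {..0}" using N by simp
  have "g summable_on ({0..} \<union> {..0})" using 1 2 by (rule summable_on_union)
  also have "{0..} \<union> {..0} = (UNIV :: int set)" by auto
  finally show ?thesis by (simp add: g_def)
qed

lemma summable_on_int_powr_15_8: "(\<lambda>k::int. (1 + \<bar>of_int k\<bar>) powr (-15/8) :: real) summable_on UNIV"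
  using summable_on_int_powr[of "15/8"] by simp

lemma has_sum_diff:
  fixes f g :: "'a \<Rightarrow> complex"
  assumes "(f has_sum a) A" "(g has_sum b) A"
  shows "((\<lambda>x. f x - g x) has_sum (a - b)) A"
  using has_sum_add[OF assms(1) has_sum_uminusI[OF assms(2)]] by simp

text \<open>\<open>sqrt (Im w)\<close> cancels the half power in the Bessel factor and leaves
  exactly \<open>(Im w)^s\<close>. The powers are written as exponentials of real logarithms so that
  holomorphy in \<open>s\<close> is visible.\<close>

lemma niebur_seed_eq:
  assumes "n > 0" "Im w > 0"
  shows "niebur_seed n s w = exp ((s - 1/2) * of_real (ln (pi * real n))) * exp (s * of_real (ln (Im w))) *
    bessel_E s (of_real ((pi * real n * Im w)\<^sup>2)) * e (- of_nat n * of_real (Re w))"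
proof -
  define Y where "Y = Im w"
  have Y: "Y > 0" using assms by (simp add: Y_def)
  have z: "complex_of_real (2 * pi * real n * Y) / 2 = of_real (pi * real n * Y)" by simp
  have ln: "ln (pi * real n * Y) = ln (pi * real n) + ln Y" using assms Y by (simp add: ln_mult)
  have "(of_real (pi * real n * Y) :: complex) powr (s - 1/2) = exp ((s - 1/2) * of_real (ln (pi * real n * Y)))"
  proof -
    have "(of_real (pi * real n * Y) :: complex) \<noteq> 0" using assms Y by auto
    moreover have "Ln (of_real (pi * real n * Y)) = of_real (ln (pi * real n * Y))"
      using assms Y by (intro Ln_of_real) auto
    ultimately show ?thesis unfolding powr_def by (simp only: if_False)
  qed
  moreover have "complex_of_real (sqrt Y) = exp (of_real (ln Y) / 2)"
  proof -
    have "sqrt Y = exp (ln Y / 2)" using Y by (simp add: powr_half_sqrt [symmetric] powr_def)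
    thus ?thesis by (simp add: exp_of_real [symmetric])
  qed
  moreover have "(\<Sum>k. (of_real (pi * real n * Y)) ^ (2 * k) * rGamma (s - 1/2 + of_nat k + 1) / fact k)
     = bessel_E s (of_real ((pi * real n * Y)\<^sup>2))"
    unfolding bessel_E_def
  proof (intro suminf_cong)
    fix k :: nat
    have "s - 1/2 + of_nat k + 1 = s + 1/2 + of_nat k" by (simp add: field_simps)
    thus "(of_real (pi * real n * Y)) ^ (2 * k) * rGamma (s - 1/2 + of_nat k + 1) / fact k =
      rGamma (s + 1/2 + of_nat k) / fact k * (of_real ((pi * real n * Y)\<^sup>2)) ^ k"
      by (simp only: power_mult of_real_power) (simp add: mult_ac)
  qed
  ultimately have "niebur_seed n s w = exp (of_real (ln Y) / 2) * (exp ((s - 1/2) * of_real (ln (pi * real n) + ln Y))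
     * bessel_E s (of_real ((pi * real n * Y)\<^sup>2))) * e (- of_nat n * of_real (Re w))"
    unfolding niebur_seed_def bessel_I_def Y_def [symmetric] z ln [symmetric] by simp
  also have "exp ((s - 1/2) * of_real (ln (pi * real n) + ln Y)) =
     exp ((s - 1/2) * of_real (ln (pi * real n))) * exp (s * of_real (ln Y)) * exp (- (of_real (ln Y) / 2))"
    unfolding exp_add [symmetric] by (simp add: algebra_simps)
  finally show ?thesis
    by (simp add: Y_def [symmetric] exp_minus mult_ac)
qed

text \<open>A matrix with rows \<open>(a, b)\<close> and \<open>(c, d)\<close> in \<open>\<Gamma>\<close> sends \<open>\<tau>\<close> to \<open>a/c - 1/(c\<^sup>2 (\<tau> + d/c))\<close>, so its
  term is \<open>e(- n a/c)\<close> times \<open>niebur_phi\<close> at \<open>u = d/c\<close>.\<close>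

definition niebur_phi :: "nat \<Rightarrow> complex \<Rightarrow> nat \<Rightarrow> complex \<Rightarrow> real \<Rightarrow> complex" where
  "niebur_phi n \<tau> c s u = niebur_seed n s (- 1 / (of_nat c ^ 2 * (\<tau> + of_real u)))"

context
  fixes n :: nat and \<tau> :: complex
  assumes n: "n > 0" and \<tau>: "Im \<tau> > 0"
begin

lemma niebur_phi_eq:
  fixes u :: real and c :: nat
  assumes c: "c > 0"
  defines "D \<equiv> (\<lambda>u. (Re \<tau> + u)\<^sup>2 + (Im \<tau>)\<^sup>2)"
  shows "niebur_phi n \<tau> c s u = exp ((s - 1/2) * of_real (ln (pi * real n))) *
    (exp (s * of_real (ln (Im \<tau> / D u / (real c)\<^sup>2))) *
     bessel_E s (of_real ((pi * real n * (Im \<tau> / D u / (real c)\<^sup>2))\<^sup>2)) *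
     exp (2 * of_real pi * \<i> * (of_nat n * of_real ((Re \<tau> + u) / D u / (real c)\<^sup>2))))"
proof -
  define w where "w = - 1 / (of_nat c ^ 2 * (\<tau> + of_real u))"
  have w: "w = (1 / (real c)\<^sup>2) *\<^sub>R (- 1 / (\<tau> + of_real u))"
    by (simp add: w_def scaleR_conv_of_real)
  have Im: "Im w = Im \<tau> / D u / (real c)\<^sup>2" and Re: "Re w = - ((Re \<tau> + u) / D u / (real c)\<^sup>2)"
    unfolding w scaleR_complex.sel by (simp_all add: D_def Re_divide Im_divide mult.commute)
  have "Im w > 0" unfolding Im D_def using \<tau> c by (simp add: add_nonneg_pos)
  from niebur_seed_eq[OF n this, of s] show ?thesis
    unfolding niebur_phi_def w_def [symmetric] Im Re by (simp add: e_def mult_ac)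
qed

text \<open>All decay sits in the factor \<open>E1\<close>, whose modulus is exactly the stated
  power. Since \<open>y / D u \<le> 1 / y\<close> and \<open>c \<ge> 1\<close>, the other factors
  and the derivatives of all arguments in \<open>u\<close> stay bounded, so the derivative is no
  larger than the value up to a constant.\<close>

lemma niebur_phi_deriv_bounds:
  fixes R :: real
  defines "A \<equiv> (\<lambda>u. Im \<tau> / ((Re \<tau> + u)\<^sup>2 + (Im \<tau>)\<^sup>2))"
  shows "\<exists>M\<ge>0. \<forall>c>0. \<forall>s. Re s > 1/2 \<longrightarrow> norm s \<le> R \<longrightarrow> (\<forall>u.
     norm (niebur_phi n \<tau> c s u) \<le> M * (A u / (real c)\<^sup>2) powr Re s \<and>
     (\<exists>d. (niebur_phi n \<tau> c s has_vector_derivative d) (at u) \<and> norm d \<le> M * (A u / (real c)\<^sup>2) powr Re s))"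
proof -
  define y where "y = Im \<tau>"
  define D where "D = (\<lambda>u. (Re \<tau> + u)\<^sup>2 + y\<^sup>2)"
  have y: "y > 0" using \<tau> by (simp add: y_def)
  have D: "D u > 0" "D u \<ge> y\<^sup>2" for u using y by (auto simp: D_def add_nonneg_pos)
  define q where "q = (pi * real n / y)\<^sup>2"
  define K where "K = exp ((\<bar>R\<bar> + 1) * \<bar>ln (pi * real n)\<bar>)"
  have "bounded ((\<lambda>s::complex. rGamma (s + 1/2)) ` cball 0 (\<bar>R\<bar> + 1))"
    by (intro compact_imp_bounded compact_continuous_image holomorphic_on_imp_continuous_on holomorphic_intros) auto
  then obtain G where G: "G > 0" "\<And>s::complex. norm s \<le> \<bar>R\<bar> + 1 \<Longrightarrow> norm (rGamma (s + 1/2)) \<le> G"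
    by (auto simp: bounded_pos)
  \<comment> \<open>The summand 1 accounts for the value, the other three for the derivatives of
    \<open>E1\<close>, \<open>E2\<close> and \<open>E3\<close> in this order.\<close>
  define C where "C = 1 + \<bar>R\<bar> / y + 2 * q / y + 2 * pi * real n / y\<^sup>2"
  define M where "M = K * (G * exp q * C)"
  have q0: "q \<ge> 0" by (simp add: q_def)
  have C1: "C \<ge> 1" using y q0 by (simp add: C_def)
  have M0: "M \<ge> 0" using G C1 by (simp add: M_def K_def)
  show ?thesis
  proof (intro exI[of _ M] conjI M0 allI impI)
    fix c :: nat and s :: complex and u :: real
    assume c: "c > 0" and s: "Re s > 1/2" "norm s \<le> R"
    have R: "R \<ge> 0" using s(2) norm_ge_zero order_trans by blast
    define \<epsilon> where "\<epsilon> = 1 / (real c)\<^sup>2"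
    have \<epsilon>: "\<epsilon> > 0" "\<epsilon> \<le> 1" using c by (auto simp: \<epsilon>_def)
    define X where "X = Re \<tau> + u"
    define P where "P = (A u / (real c)\<^sup>2) powr Re s"
    have A: "A v / (real c)\<^sup>2 = y / D v * \<epsilon>" for v by (simp add: A_def D_def y_def \<epsilon>_def)
    have Apos: "y / D v * \<epsilon> > 0" for v using y D \<epsilon> by simp
    have P0: "P \<ge> 0" by (simp add: P_def)
    define Q where "Q = (\<lambda>v. (pi * real n * (y / D v * \<epsilon>))\<^sup>2)"
    define E1 where "E1 = (\<lambda>v. exp (s * complex_of_real (ln (y / D v * \<epsilon>))))"
    define E2 where "E2 = (\<lambda>v. bessel_E s (complex_of_real (Q v)))"
    define E3 where "E3 = (\<lambda>v. exp (2 * of_real pi * \<i> * of_nat n * complex_of_real ((Re \<tau> + v) / D v * \<epsilon>)))"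
    define K0 where "K0 = exp ((s - 1/2) * complex_of_real (ln (pi * real n)))"
    have phi: "niebur_phi n \<tau> c s = (\<lambda>v. K0 * (E1 v * E2 v * E3 v))"
      by (rule ext) (simp add: niebur_phi_eq[OF c] K0_def E1_def E2_def E3_def Q_def D_def y_def \<epsilon>_def mult.assoc)
    have Q: "Q u \<ge> 0" "Q u \<le> q"
    proof -
      have "y / D u * \<epsilon> \<le> y / y\<^sup>2 * 1" using D \<epsilon> y by (intro mult_mono divide_left_mono) auto
      also have "\<dots> = 1 / y" by (simp add: power2_eq_square)
      finally have "pi * real n * (y / D u * \<epsilon>) \<le> pi * real n * (1 / y)" by (intro mult_left_mono) auto
      thus "Q u \<le> q" unfolding Q_def q_def using Apos[of u]
        by (intro power_mono mult_nonneg_nonneg[of "pi * real n"]) auto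
    qed (simp add: Q_def)
    have nK: "norm K0 \<le> K"
    proof -
      have "norm K0 = exp ((Re s - 1/2) * ln (pi * real n))" by (simp add: K0_def norm_exp_eq_Re)
      also have "(Re s - 1/2) * ln (pi * real n) \<le> (\<bar>R\<bar> + 1) * \<bar>ln (pi * real n)\<bar>"
      proof -
        have "(Re s - 1/2) * ln (pi * real n) \<le> \<bar>Re s - 1/2\<bar> * \<bar>ln (pi * real n)\<bar>"
          unfolding abs_mult [symmetric] by (rule abs_ge_self)
        also have "\<dots> \<le> (\<bar>R\<bar> + 1) * \<bar>ln (pi * real n)\<bar>"
          using s complex_Re_le_cmod[of s] by (intro mult_right_mono) auto
        finally show ?thesis .
      qed
      finally show ?thesis by (simp add: K_def)
    qed
    have n1: "norm (E1 u) = P" using Apos[of u] y D(1)[of u] \<epsilon>(1)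
      by (simp add: E1_def norm_exp_eq_Re P_def A powr_def)
    have nE: "norm (bessel_E z (of_real (Q u))) \<le> G * exp q" if "Re z > 1/2" "norm z \<le> \<bar>R\<bar> + 1" for z
    proof -
      have "norm (bessel_E z (of_real (Q u))) \<le> norm (rGamma (z + 1/2)) * exp (norm (complex_of_real (Q u)))"
        by (rule norm_bessel_E_le[OF that(1)])
      also have "\<dots> \<le> G * exp q" using G that Q by (intro mult_mono) auto
      finally show ?thesis .
    qed
    have n2: "norm (E2 u) \<le> G * exp q" unfolding E2_def using s by (intro nE) auto
    have n2': "norm (bessel_E (s + 1) (of_real (Q u))) \<le> G * exp q"
      using s norm_triangle_ineq[of s 1] by (intro nE) auto
    have n3: "norm (E3 u) = 1" by (simp add: E3_def norm_exp_eq_Re)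
    have GC: "G * exp q \<le> G * exp q * C" using G C1 by simp
    show "norm (niebur_phi n \<tau> c s u) \<le> M * (A u / (real c)\<^sup>2) powr Re s"
    proof -
      have "norm (niebur_phi n \<tau> c s u) = norm K0 * (P * norm (E2 u))"
        by (simp add: phi norm_mult n1 n3)
      also have "\<dots> \<le> K * (P * (G * exp q * C))"
        using nK n2 GC P0 by (intro mult_mono mult_left_mono) (auto simp: K_def)
      finally show ?thesis by (simp add: M_def P_def mult_ac)
    qed
    define l' where "l' = - 2 * X / D u"
    define r' where "r' = (y\<^sup>2 - X\<^sup>2) / (D u)\<^sup>2 * \<epsilon>"
    have dD: "(D has_real_derivative 2 * X) (at u)"
      unfolding D_def X_def by (auto intro!: derivative_eq_intros)
    have "((\<lambda>v. ln (y / D v * \<epsilon>)) has_real_derivative l') (at u)"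
      using dD y D(1)[of u] \<epsilon>(1) unfolding l'_def
      by (auto intro!: derivative_eq_intros simp: field_simps power2_eq_square)
    hence "((\<lambda>v. s * complex_of_real (ln (y / D v * \<epsilon>))) has_vector_derivative s * of_real l') (at u)"
      by (intro has_vector_derivative_mult_right has_vector_derivative_of_real)
    hence d1: "(E1 has_vector_derivative s * of_real l' * E1 u) (at u)"
      unfolding E1_def using field_vector_diff_chain_at[OF _ DERIV_exp] by (auto simp: o_def)
    have "(Q has_real_derivative 2 * l' * Q u) (at u)"
      using dD y D[of u] \<epsilon> unfolding Q_def l'_def
      by (auto intro!: derivative_eq_intros simp: field_simps power2_eq_square)
    hence "((\<lambda>v. complex_of_real (Q v)) has_vector_derivative of_real (2 * l' * Q u)) (at u)"
      by (rule has_vector_derivative_of_real)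
    hence d2: "(E2 has_vector_derivative of_real (2 * l' * Q u) * bessel_E (s + 1) (of_real (Q u))) (at u)"
      unfolding E2_def using field_vector_diff_chain_at[OF _ bessel_E_has_field_derivative[OF s(1)]]
      by (auto simp: o_def)
    have "((\<lambda>v. (Re \<tau> + v) / D v * \<epsilon>) has_real_derivative r') (at u)"
    proof -
      have "((\<lambda>v. (Re \<tau> + v) / D v * \<epsilon>) has_real_derivative ((D u - X * (2 * X)) / (D u)\<^sup>2) * \<epsilon>) (at u)"
        using dD D[of u] by (auto intro!: derivative_eq_intros simp: power2_eq_square X_def algebra_simps)
      moreover have "D u - X * (2 * X) = y\<^sup>2 - X\<^sup>2" by (simp add: D_def X_def power2_eq_square)
      ultimately show ?thesis by (simp add: r'_def)
    qed
    hence "((\<lambda>v. 2 * of_real pi * \<i> * of_nat n * complex_of_real ((Re \<tau> + v) / D v * \<epsilon>)) has_vector_derivative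
         2 * of_real pi * \<i> * of_nat n * of_real r') (at u)"
      by (intro has_vector_derivative_mult_right has_vector_derivative_of_real)
    hence d3: "(E3 has_vector_derivative 2 * of_real pi * \<i> * of_nat n * of_real r' * E3 u) (at u)"
      unfolding E3_def using field_vector_diff_chain_at[OF _ DERIV_exp] by (auto simp: o_def)
    define d where "d = K0 * ((E1 u * E2 u) * (2 * of_real pi * \<i> * of_nat n * of_real r' * E3 u) +
       (E1 u * (of_real (2 * l' * Q u) * bessel_E (s + 1) (of_real (Q u))) + (s * of_real l' * E1 u) * E2 u) * E3 u)"
    have "(niebur_phi n \<tau> c s has_vector_derivative d) (at u)"
      unfolding phi d_def by (intro has_vector_derivative_mult_right has_vector_derivative_mult d1 d2 d3)
    moreover have "norm d \<le> M * (A u / (real c)\<^sup>2) powr Re s"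
    proof -
      \<comment> \<open>\<open>l'\<close> is the logarithmic derivative of \<open>y / D\<close>; the
        bound is the inequality of arithmetic and geometric mean for \<open>\<bar>X\<bar>\<close>
        and \<open>y\<close>.\<close>
      have l': "\<bar>l'\<bar> \<le> 1 / y"
      proof -
        have "2 * \<bar>X\<bar> * y \<le> X\<^sup>2 + y\<^sup>2" using sum_squares_bound[of "\<bar>X\<bar>" y] by simp
        hence "2 * \<bar>X\<bar> / D u \<le> 1 / y" using D[of u] y by (simp add: D_def X_def field_simps)
        thus ?thesis using D[of u] by (simp add: l'_def)
      qed
      have r': "\<bar>r'\<bar> \<le> 1 / y\<^sup>2"
      proof -
        have "\<bar>y\<^sup>2 - X\<^sup>2\<bar> \<le> D u" by (auto simp: D_def X_def abs_le_iff)
        hence "\<bar>y\<^sup>2 - X\<^sup>2\<bar> / (D u)\<^sup>2 \<le> D u / (D u)\<^sup>2" by (intro divide_right_mono) auto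
        also have "\<dots> = 1 / D u" using D[of u] by (simp add: power2_eq_square)
        also have "\<dots> \<le> 1 / y\<^sup>2" using D[of u] y by (intro divide_left_mono) auto
        finally have "\<bar>y\<^sup>2 - X\<^sup>2\<bar> / (D u)\<^sup>2 * \<epsilon> \<le> 1 / y\<^sup>2 * 1" using \<epsilon> by (intro mult_mono) auto
        thus ?thesis using \<epsilon> by (simp add: r'_def abs_mult)
      qed
      have Gq: "G * exp q \<ge> 0" using G by simp
      have "norm ((E1 u * E2 u) * (2 * of_real pi * \<i> * of_nat n * of_real r' * E3 u))
          = P * norm (E2 u) * (2 * pi * real n * \<bar>r'\<bar>)" by (simp add: norm_mult n1 n3)
      also have "\<dots> \<le> P * (G * exp q) * (2 * pi * real n * (1 / y\<^sup>2))"
        using P0 Gq by (intro mult_mono[OF mult_left_mono[OF n2] mult_left_mono[OF r']]) auto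
      finally have "norm ((E1 u * E2 u) * (2 * of_real pi * \<i> * of_nat n * of_real r' * E3 u))
           \<le> P * (G * exp q) * (2 * pi * real n * (1 / y\<^sup>2))" .
      moreover have "norm (E1 u * (of_real (2 * l' * Q u) * bessel_E (s + 1) (of_real (Q u))) * E3 u)
          \<le> P * ((2 * (1 / y) * q) * (G * exp q)) * 1"
      proof -
        have "norm (E1 u * (of_real (2 * l' * Q u) * bessel_E (s + 1) (of_real (Q u))) * E3 u)
            = P * ((2 * \<bar>l'\<bar> * Q u) * norm (bessel_E (s + 1) (of_real (Q u))))"
          using Q by (simp add: norm_mult n1 n3 abs_mult)
        also have "\<dots> \<le> P * ((2 * (1 / y) * q) * (G * exp q))"
          using P0 Q y q0 by (intro mult_left_mono[OF mult_mono[OF mult_mono[OF mult_left_mono[OF l']] n2']]) auto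
        finally show ?thesis by simp
      qed
      moreover have "norm ((s * of_real l' * E1 u) * E2 u * E3 u) \<le> (R * (1 / y) * P) * (G * exp q) * 1"
      proof -
        have "norm ((s * of_real l' * E1 u) * E2 u * E3 u) = norm s * \<bar>l'\<bar> * P * norm (E2 u)"
          by (simp add: norm_mult n1 n3)
        also have "\<dots> \<le> R * (1 / y) * P * (G * exp q)"
          using P0 R y by (intro mult_mono[OF mult_right_mono[OF mult_mono[OF s(2) l']] n2]) auto
        finally show ?thesis by simp
      qed
      ultimately have "norm ((E1 u * E2 u) * (2 * of_real pi * \<i> * of_nat n * of_real r' * E3 u) +
         (E1 u * (of_real (2 * l' * Q u) * bessel_E (s + 1) (of_real (Q u))) + (s * of_real l' * E1 u) * E2 u) * E3 u)
         \<le> P * (G * exp q) * (2 * pi * real n * (1 / y\<^sup>2)) + (P * ((2 * (1 / y) * q) * (G * exp q)) * 1 +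
            (R * (1 / y) * P) * (G * exp q) * 1)"
        unfolding distrib_right by (intro norm_triangle_le add_mono order.refl) auto
      also have "\<dots> = P * (G * exp q * (C - 1))" using R by (simp add: C_def algebra_simps)
      also have "\<dots> \<le> P * (G * exp q * C)" using P0 G by (intro mult_left_mono) auto
      finally have "norm d \<le> K * (P * (G * exp q * C))"
        unfolding d_def norm_mult[of K0] using nK by (intro mult_mono) (auto simp: K_def)
      thus ?thesis by (simp add: M_def P_def mult_ac)
    qed
    ultimately show "\<exists>d. (niebur_phi n \<tau> c s has_vector_derivative d) (at u) \<and> norm d \<le> M * (A u / (real c)\<^sup>2) powr Re s"
      by blast
  qed
qed

text \<open>15/8 is twice 15/16 and still above 1, so the sum over \<open>k\<close> converges to the
  left of \<open>Re s = 1\<close>. The power of \<open>c\<close> keeps its exact exponent for the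
  later absolute convergence in \<open>Re s > 1\<close>. The second bound is the mean value theorem
  on the segment between the two points.\<close>

lemma niebur_phi_bounds:
  obtains M where "M \<ge> 0"
    "\<And>c s u k. c > 0 \<Longrightarrow> Re s > 15/16 \<Longrightarrow> norm s \<le> R \<Longrightarrow> u \<in> {0..2} \<Longrightarrow>
       norm (niebur_phi n \<tau> c s (u + of_int k)) \<le> M * real c powr (- 2 * Re s) * (1 + \<bar>of_int k\<bar>) powr (-15/8)"
    "\<And>c s u v k. c > 0 \<Longrightarrow> Re s > 15/16 \<Longrightarrow> norm s \<le> R \<Longrightarrow> u \<in> {0..2} \<Longrightarrow> v \<in> {0..2} \<Longrightarrow>
       norm (niebur_phi n \<tau> c s (u + of_int k) - niebur_phi n \<tau> c s (v + of_int k))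
         \<le> M * real c powr (- 2 * Re s) * (1 + \<bar>of_int k\<bar>) powr (-15/8) * \<bar>u - v\<bar>"
proof -
  define y where "y = Im \<tau>"
  have y: "y > 0" using \<tau> by (simp add: y_def)
  define A where "A = (\<lambda>u. y / ((Re \<tau> + u)\<^sup>2 + y\<^sup>2))"
  obtain M where M0: "M \<ge> 0" and M: "\<And>c s u. c > 0 \<Longrightarrow> Re s > 1/2 \<Longrightarrow> norm s \<le> R \<Longrightarrow>
     norm (niebur_phi n \<tau> c s u) \<le> M * (A u / (real c)\<^sup>2) powr Re s \<and>
     (\<exists>d. (niebur_phi n \<tau> c s has_vector_derivative d) (at u) \<and> norm d \<le> M * (A u / (real c)\<^sup>2) powr Re s)"
    using niebur_phi_deriv_bounds[of R] unfolding A_def y_def by blast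
  \<comment> \<open>The 3 is 1 plus the bound 2 for \<open>u\<close>. The 1 added in
    \<open>C\<close> below makes \<open>C \<ge> 1\<close>, so that
    \<open>C powr Re s \<le> C powr R\<close>.\<close>
  define b where "b = \<bar>Re \<tau>\<bar> + 3"
  define C where "C = 1 + y * (2 + 2 * b\<^sup>2 / y\<^sup>2)"
  have C1: "C \<ge> 1" using y by (simp add: C_def)
  have A: "A (u + of_int k) \<le> C / (1 + \<bar>of_int k\<bar>)\<^sup>2" if u: "u \<in> {0..2}" for u and k :: int
  proof -
    define Z where "Z = Re \<tau> + (u + of_int k)"
    have "1 + \<bar>of_int k\<bar> \<le> \<bar>Z\<bar> + b" using u by (auto simp: Z_def b_def)
    hence "(1 + \<bar>of_int k\<bar>)\<^sup>2 \<le> (\<bar>Z\<bar> + b)\<^sup>2" by (intro power_mono) auto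
    also have "\<dots> \<le> 2 * Z\<^sup>2 + 2 * b\<^sup>2" using sum_squares_bound[of "\<bar>Z\<bar>" b] by (simp add: power2_sum)
    also have "\<dots> \<le> (2 + 2 * b\<^sup>2 / y\<^sup>2) * (Z\<^sup>2 + y\<^sup>2)" using y by (simp add: field_simps)
    finally have "y * (1 + \<bar>of_int k\<bar>)\<^sup>2 \<le> y * ((2 + 2 * b\<^sup>2 / y\<^sup>2) * (Z\<^sup>2 + y\<^sup>2))"
      using y by (intro mult_left_mono) auto
    also have "\<dots> \<le> C * (Z\<^sup>2 + y\<^sup>2)" unfolding mult.assoc [symmetric] C_def by (intro mult_right_mono) auto
    finally have *: "y * (1 + \<bar>of_int k\<bar>)\<^sup>2 \<le> C * (Z\<^sup>2 + y\<^sup>2)" .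
    have "(1 + \<bar>real_of_int k\<bar>)\<^sup>2 > 0" "Z\<^sup>2 + y\<^sup>2 > 0" using y by (auto simp: add_nonneg_pos)
    thus ?thesis using * unfolding A_def Z_def [symmetric] by (simp add: field_simps)
  qed
  have P: "(A (u + of_int k) / (real c)\<^sup>2) powr Re s \<le> C powr R * (real c powr (- 2 * Re s) * (1 + \<bar>of_int k\<bar>) powr (-15/8))"
    if u: "u \<in> {0..2}" and s: "Re s > 15/16" "norm s \<le> R" and c: "c > 0" for u and k :: int and s c
  proof -
    have R: "Re s \<le> R" using s complex_Re_le_cmod[of s] by linarith
    define j where "j = 1 + \<bar>real_of_int k\<bar>"
    have j: "j \<ge> 1" by (simp add: j_def)
    have "A (u + of_int k) / (real c)\<^sup>2 \<le> C / j\<^sup>2 / (real c)\<^sup>2"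
      unfolding j_def by (intro divide_right_mono A u) auto
    moreover have "A (u + of_int k) / (real c)\<^sup>2 \<ge> 0" using y by (simp add: A_def)
    ultimately have "(A (u + of_int k) / (real c)\<^sup>2) powr Re s \<le> (C / j\<^sup>2 / (real c)\<^sup>2) powr Re s"
      using s by (intro powr_mono2) auto
    also have "C / j\<^sup>2 / (real c)\<^sup>2 = C * (real c powr (-2) * j powr (-2))"
      using c j by (simp add: powr_minus divide_inverse)
    also have "\<dots> powr Re s = C powr Re s * (real c powr (- 2 * Re s) * j powr (- 2 * Re s))"
      using c j C1 by (simp add: powr_mult powr_powr)
    also have "\<dots> \<le> C powr R * (real c powr (- 2 * Re s) * j powr (-15/8))"
      using C1 R s j by (intro mult_mono[OF powr_mono mult_left_mono[OF powr_mono]]) auto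
    finally show ?thesis unfolding j_def .
  qed
  show ?thesis
  proof (rule that[of "M * C powr R"])
    fix c :: nat and s :: complex and k :: int and u :: real
    assume c: "c > 0" and s: "Re s > 15/16" "norm s \<le> R" and u: "u \<in> {0..2}"
    have s': "Re s > 1/2" using s by simp
    show "norm (niebur_phi n \<tau> c s (u + of_int k)) \<le> M * C powr R * real c powr (- 2 * Re s) * (1 + \<bar>of_int k\<bar>) powr (-15/8)"
      using M[OF c s' s(2), of "u + of_int k"] mult_left_mono[OF P[OF u s c, of k] M0]
      unfolding mult.assoc by linarith
  next
    fix c :: nat and s :: complex and k :: int and u v :: real
    assume c: "c > 0" and s: "Re s > 15/16" "norm s \<le> R" and u: "u \<in> {0..2}" and v: "v \<in> {0..2}"
    define B where "B = M * C powr R * real c powr (- 2 * Re s) * (1 + \<bar>of_int k\<bar>) powr (-15/8)"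
    have PB: "M * (A (u + of_int k) / (real c)\<^sup>2) powr Re s \<le> B" if "u \<in> {0..2}" for u
      using mult_left_mono[OF P[OF that s c, of k] M0] by (simp add: B_def mult_ac)
    have s': "Re s > 1/2" using s by simp
    obtain d where d: "\<And>u. (niebur_phi n \<tau> c s has_vector_derivative d u) (at u)"
       "\<And>u. norm (d u) \<le> M * (A u / (real c)\<^sup>2) powr Re s"
      using M[OF c s' s(2)] by metis
    have wlog: "norm (niebur_phi n \<tau> c s (v + of_int k) - niebur_phi n \<tau> c s (u + of_int k)) \<le> B * (v - u)"
      if uv: "u < v" "u \<in> {0..2}" "v \<in> {0..2}" for u v
    proof -
      have "\<exists>x\<in>{u + of_int k<..<v + of_int k}. norm (niebur_phi n \<tau> c s (v + of_int k) - niebur_phi n \<tau> c s (u + of_int k))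
          \<le> norm (((v + of_int k) - (u + of_int k)) *\<^sub>R d x)"
      proof (rule mvt_general)
        show "continuous_on {u + of_int k..v + of_int k} (niebur_phi n \<tau> c s)"
          using d(1) by (intro continuous_at_imp_continuous_on ballI has_vector_derivative_continuous)
      qed (use uv d(1) in \<open>auto simp: has_vector_derivative_def\<close>)
      then obtain x where x: "x \<in> {u + of_int k<..<v + of_int k}"
        "norm (niebur_phi n \<tau> c s (v + of_int k) - niebur_phi n \<tau> c s (u + of_int k)) \<le> (v - u) * norm (d x)"
        using uv by auto
      have "norm (d x) \<le> B" using d(2)[of x] PB[of "x - of_int k"] x(1) uv by auto
      hence "(v - u) * norm (d x) \<le> (v - u) * B" using uv by (intro mult_left_mono) auto
      thus ?thesis using x(2) by (simp add: mult.commute)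
    qed
    show "norm (niebur_phi n \<tau> c s (u + of_int k) - niebur_phi n \<tau> c s (v + of_int k))
        \<le> M * C powr R * real c powr (- 2 * Re s) * (1 + \<bar>of_int k\<bar>) powr (-15/8) * \<bar>u - v\<bar>"
      using wlog[of u v] wlog[of v u] u v unfolding B_def [symmetric]
      by (cases u v rule: linorder_cases) (auto simp: norm_minus_commute)
  qed (use M0 C1 in auto)
qed

lemma holomorphic_niebur_phi:
  assumes "c > 0"
  shows "(\<lambda>s. niebur_phi n \<tau> c s u) holomorphic_on {s. Re s > 1/2}"
  unfolding niebur_phi_eq[OF assms]
  by (intro holomorphic_intros holomorphic_bessel_E)

lemma holomorphic_niebur_seed: "(\<lambda>s. niebur_seed n s \<tau>) holomorphic_on {s. Re s > 1/2}"
  unfolding niebur_seed_eq[OF n \<tau>] by (intro holomorphic_intros holomorphic_bessel_E)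

text \<open>Lower rows \<open>(c, d)\<close> are grouped by \<open>d\<close> modulo
  \<open>c\<close>. The sum over a class is a function of period 1 in \<open>d / c\<close> that
  changes little between neighbouring residues, which is the weight that completion asks
  for.\<close>

definition niebur_h :: "nat \<Rightarrow> complex \<Rightarrow> real \<Rightarrow> complex" where
  "niebur_h c s u = (\<Sum>\<^sub>\<infinity>k. niebur_phi n \<tau> c s (u + of_int k))"

definition niebur_G :: "nat \<Rightarrow> complex \<Rightarrow> complex" where
  "niebur_G c s = (\<Sum>(x, y)\<in>unit_pairs c. ec c (- int n * y) * niebur_h c s (of_int x / real c))"

lemma summable_on_niebur_phi:
  assumes "c > 0" "Re s > 15/16" "u \<in> {0..2}"
  shows "(\<lambda>k::int. norm (niebur_phi n \<tau> c s (u + of_int k))) summable_on UNIV"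
proof -
  from niebur_phi_bounds[of "norm s"] obtain M
    where "\<And>k::int. norm (niebur_phi n \<tau> c s (u + of_int k))
      \<le> M * real c powr (- 2 * Re s) * (1 + \<bar>of_int k\<bar>) powr (-15/8)"
    using assms order.refl by metis
  thus ?thesis
    by (rule_tac summable_on_comparison_test[OF summable_on_cmult_right[OF summable_on_int_powr_15_8]]) auto
qed

lemma niebur_h_plus_1: "niebur_h c s (u + 1) = niebur_h c s u"
  unfolding niebur_h_def
  by (rule infsum_reindex_bij_witness[of _ "\<lambda>k. k - 1" "\<lambda>k. k + 1"]) (auto simp: algebra_simps)

lemma niebur_h_bounds:
  obtains M where "M \<ge> 0"
    "\<And>c s u. c > 0 \<Longrightarrow> Re s > 15/16 \<Longrightarrow> norm s \<le> R \<Longrightarrow> u \<in> {0..2} \<Longrightarrow>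
       norm (niebur_h c s u) \<le> M * real c powr (-15/8)"
    "\<And>c s u v. c > 0 \<Longrightarrow> Re s > 15/16 \<Longrightarrow> norm s \<le> R \<Longrightarrow> u \<in> {0..2} \<Longrightarrow> v \<in> {0..2} \<Longrightarrow>
       norm (niebur_h c s u - niebur_h c s v) \<le> M * real c powr (-15/8) * \<bar>u - v\<bar>"
proof -
  define S where "S = (\<Sum>\<^sub>\<infinity>k::int. (1 + \<bar>of_int k\<bar>) powr (-15/8) :: real)"
  have S0: "S \<ge> 0" unfolding S_def by (rule infsum_nonneg) simp
  obtain M where M0: "M \<ge> 0" and M: "\<And>c s u k. c > 0 \<Longrightarrow> Re s > 15/16 \<Longrightarrow> norm s \<le> R \<Longrightarrow> u \<in> {0..2} \<Longrightarrow>
       norm (niebur_phi n \<tau> c s (u + of_int k)) \<le> M * real c powr (- 2 * Re s) * (1 + \<bar>of_int k\<bar>) powr (-15/8)"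
    "\<And>c s u v k. c > 0 \<Longrightarrow> Re s > 15/16 \<Longrightarrow> norm s \<le> R \<Longrightarrow> u \<in> {0..2} \<Longrightarrow> v \<in> {0..2} \<Longrightarrow>
       norm (niebur_phi n \<tau> c s (u + of_int k) - niebur_phi n \<tau> c s (v + of_int k))
         \<le> M * real c powr (- 2 * Re s) * (1 + \<bar>of_int k\<bar>) powr (-15/8) * \<bar>u - v\<bar>"
    by (fact niebur_phi_bounds[of R])
  have hs: "(((\<lambda>k::int. M * real c powr (- 2 * Re s) * (1 + \<bar>of_int k\<bar>) powr (-15/8))) has_sum
      (M * real c powr (- 2 * Re s) * S)) UNIV" for c s
    unfolding S_def by (intro has_sum_cmult_right has_sum_infsum summable_on_int_powr_15_8)
  have sum: "((\<lambda>k::int. niebur_phi n \<tau> c s (w + of_int k)) has_sum niebur_h c s w) UNIV"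
    if "w \<in> {0..2}" "c > 0" "Re s > 15/16" for w c s
    unfolding niebur_h_def
    by (rule has_sum_infsum[OF abs_summable_summable[OF summable_on_niebur_phi]]) (fact that)+
  have le: "M * real c powr (- 2 * Re s) * S \<le> M * S * real c powr (-15/8)" if "c > 0" "Re s > 15/16" for c s
  proof -
    have "real c powr (- 2 * Re s) \<le> real c powr (-15/8)" using that by (intro powr_mono) auto
    hence "M * S * real c powr (- 2 * Re s) \<le> M * S * real c powr (-15/8)"
      using M0 S0 by (intro mult_left_mono) auto
    thus ?thesis by (simp add: mult_ac)
  qed
  show ?thesis
  proof (rule that[of "M * S"])
    fix c :: nat and s :: complex and u :: real
    assume c: "c > 0" and s: "Re s > 15/16" "norm s \<le> R" and u: "u \<in> {0..2}"
    have "norm (niebur_h c s u) \<le> M * real c powr (- 2 * Re s) * S"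
      by (rule norm_infsum_le[OF sum[OF u c s(1)] hs]) (rule M(1)[OF c s u])
    thus "norm (niebur_h c s u) \<le> M * S * real c powr (-15/8)" using le[OF c s(1)] by linarith
  next
    fix c :: nat and s :: complex and u v :: real
    assume c: "c > 0" and s: "Re s > 15/16" "norm s \<le> R" and u: "u \<in> {0..2}" and v: "v \<in> {0..2}"
    have "norm (niebur_h c s u - niebur_h c s v) \<le> M * real c powr (- 2 * Re s) * S * \<bar>u - v\<bar>"
      by (rule norm_infsum_le[OF has_sum_diff[OF sum[OF u c s(1)] sum[OF v c s(1)]] has_sum_cmult_left[OF hs]])
         (rule M(2)[OF c s u v])
    also have "\<dots> \<le> M * S * real c powr (-15/8) * \<bar>u - v\<bar>" using le[OF c s(1)] by (intro mult_right_mono) auto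
    finally show "norm (niebur_h c s u - niebur_h c s v) \<le> M * S * real c powr (-15/8) * \<bar>u - v\<bar>" .
  qed (use M0 S0 in auto)
qed

lemma holomorphic_niebur_G:
  assumes "c > 0"
  shows "niebur_G c holomorphic_on {s. Re s > 15/16}"
proof -
  have "(\<lambda>s. niebur_h c s (of_int x / real c)) holomorphic_on {s. Re s > 15/16}"
    if "(x, y) \<in> unit_pairs c" for x y
    unfolding niebur_h_def
  proof (rule holomorphic_on_infsum)
    have u: "of_int x / real c \<in> {0..2}" using that assms by (auto simp: unit_pairs_def field_simps)
    fix R
    obtain M where M0: "M \<ge> 0" and M: "\<And>c s u k. c > 0 \<Longrightarrow> Re s > 15/16 \<Longrightarrow> norm s \<le> R \<Longrightarrow> u \<in> {0..2} \<Longrightarrow>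
      norm (niebur_phi n \<tau> c s (u + of_int k)) \<le> M * real c powr (- 2 * Re s) * (1 + \<bar>of_int k\<bar>) powr (-15/8)"
    "\<And>c s u v k. c > 0 \<Longrightarrow> Re s > 15/16 \<Longrightarrow> norm s \<le> R \<Longrightarrow> u \<in> {0..2} \<Longrightarrow> v \<in> {0..2} \<Longrightarrow>
       norm (niebur_phi n \<tau> c s (u + of_int k) - niebur_phi n \<tau> c s (v + of_int k))
         \<le> M * real c powr (- 2 * Re s) * (1 + \<bar>of_int k\<bar>) powr (-15/8) * \<bar>u - v\<bar>"
      by (fact niebur_phi_bounds[of R])
    have "norm (niebur_phi n \<tau> c s (of_int x / real c + of_int k)) \<le> M * (1 + \<bar>of_int k\<bar>) powr (-15/8)"
      if s: "Re s > 15/16" "norm s \<le> R" for s and k :: int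
    proof -
      have "real c powr (- 2 * Re s) \<le> real c powr 0" using assms s by (intro powr_mono) auto
      hence "M * real c powr (- 2 * Re s) \<le> M * 1" using assms M0 by (intro mult_left_mono) auto
      hence "M * real c powr (- 2 * Re s) * (1 + \<bar>of_int k\<bar>) powr (-15/8) \<le> M * 1 * (1 + \<bar>of_int k\<bar>) powr (-15/8)"
        by (intro mult_right_mono) auto
      thus ?thesis using M[OF assms s u, of k] by simp
    qed
    thus "\<exists>M. M summable_on UNIV \<and> (\<forall>k\<in>UNIV. \<forall>w\<in>{s. Re s > 15/16}. norm w \<le> R \<longrightarrow>
        norm (niebur_phi n \<tau> c w (of_int x / real c + of_int k)) \<le> M k)"
      by (intro exI[of _ "\<lambda>k. M * (1 + \<bar>of_int k\<bar>) powr (-15/8)"] conjI summable_on_cmult_right summable_on_int_powr_15_8) auto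
    show "(\<lambda>s. niebur_phi n \<tau> c s (of_int x / real c + of_int k)) holomorphic_on {s. Re s > 15/16}" for k
      by (rule holomorphic_on_subset[OF holomorphic_niebur_phi[OF assms]]) auto
  qed (rule open_halfspace_Re_gt)
  thus ?thesis unfolding niebur_G_def [abs_def] case_prod_unfold
    by (intro holomorphic_intros) auto
qed

text \<open>The weight is at most \<open>M c^(-15/8)\<close> and changes by at most
  \<open>1/c\<close> of that between neighbours, so completion applies:
  \<open>3/4 - 15/8 + 1/16 = -17/16\<close>. Positivity of \<open>n\<close> enters through
  \<open>b = - n \<noteq> 0\<close> in Kloosterman's bound.\<close>

lemma norm_niebur_G_le:
  "\<exists>M. \<forall>c>0. \<forall>s. Re s > 15/16 \<longrightarrow> norm s \<le> R \<longrightarrow>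
     norm (niebur_G c s) \<le> M * (real (card {d. d dvd c}) * real c powr (-17/16))"
proof -
  obtain M where M0: "M \<ge> 0" and M: "\<And>c s u. c > 0 \<Longrightarrow> Re s > 15/16 \<Longrightarrow> norm s \<le> R \<Longrightarrow> u \<in> {0..2} \<Longrightarrow>
       norm (niebur_h c s u) \<le> M * real c powr (-15/8)"
    "\<And>c s u v. c > 0 \<Longrightarrow> Re s > 15/16 \<Longrightarrow> norm s \<le> R \<Longrightarrow> u \<in> {0..2} \<Longrightarrow> v \<in> {0..2} \<Longrightarrow>
       norm (niebur_h c s u - niebur_h c s v) \<le> M * real c powr (-15/8) * \<bar>u - v\<bar>"
    by (fact niebur_h_bounds[of R])
  obtain C where C: "\<And>c. c > 0 \<Longrightarrow> 1 + 2 * (\<Sum>m=1..c. 1 / real m) \<le> C * real c powr (1/16)"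
    using harmonic_sum_le by blast
  show ?thesis
  proof (intro exI[of _ "2 * real n * (M * C)"] allI impI)
    fix c :: nat and s :: complex
    assume c: "c > 0" and s: "Re s > 15/16" "norm s \<le> R"
    define D where "D = real (card {d. d dvd c})"
    define H where "H = (\<lambda>r::int. niebur_h c s (of_int r / real c))"
    have G: "niebur_G c s = (\<Sum>(x, y)\<in>unit_pairs c. ec c (- int n * y) * H x)"
      by (simp add: niebur_G_def H_def)
    have "norm (niebur_G c s) \<le> (2 * \<bar>- int n\<bar> * real c powr (3/4) * D) *
        ((M * real c powr (-15/8)) * (1 + 2 * (\<Sum>m=1..c. 1 / real m)))"
      unfolding G
    proof (rule norm_twisted_unit_sum_le[OF c])
      show "H (r + int c) = H r" for r
        using niebur_h_plus_1[of c s "of_int r / real c"] c by (simp add: H_def add_divide_distrib)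
      fix r assume r: "r \<in> {0..<int c}"
      hence u: "of_int r / real c \<in> {0..2}" "of_int (r + 1) / real c \<in> {0..2}"
        using c by (auto simp: field_simps)
      show "norm (H r) \<le> M * real c powr (-15/8)" using M(1)[OF c s u(1)] by (simp add: H_def)
      have "\<bar>of_int (r + 1) / real c - of_int r / real c\<bar> = 1 / real c"
        using c by (simp add: field_simps)
      thus "norm (H (r + 1) - H r) \<le> M * real c powr (-15/8) / real c"
        using M(2)[OF c s u(2) u(1)] by (simp add: H_def)
    next
      show "norm (kloosterman c a (- int n)) \<le> 2 * \<bar>- int n\<bar> * real c powr (3/4) * D" for a
        unfolding D_def using kloosterman_bound[OF c, of "- int n" a] n by simp
    qed
    also have "\<dots> \<le> (2 * \<bar>- int n\<bar> * real c powr (3/4) * D) * ((M * real c powr (-15/8)) * (C * real c powr (1/16)))"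
      using M0 by (intro mult_left_mono C c) (auto simp: D_def)
    also have "\<dots> = 2 * real n * (M * C) * (D * (real c powr (3/4) * real c powr (-15/8) * real c powr (1/16)))"
      by (simp add: mult_ac)
    also have "real c powr (3/4) * real c powr (-15/8) * real c powr (1/16) = real c powr (-17/16)"
      by (simp flip: powr_add)
    finally show "norm (niebur_G c s) \<le> 2 * real n * (M * C) * (real (card {d. d dvd c}) * real c powr (-17/16))"
      by (simp add: D_def)
  qed
qed

text \<open>The isolated seed belongs to the coset of the identity, with lower left entry 0. The
  blocks \<open>niebur_G c\<close> must stay intact, since the cancellation between units takes
  place inside them.\<close>

definition niebur_F_ext :: "complex \<Rightarrow> complex" where
  "niebur_F_ext s = of_real (2 * pi * sqrt (real n)) * (niebur_seed n s \<tau> + (\<Sum>\<^sub>\<infinity>c\<in>{1..}. niebur_G c s))"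

lemma holomorphic_niebur_F_ext: "niebur_F_ext holomorphic_on {s. Re s > 15/16}"
proof -
  have "(\<lambda>s. \<Sum>\<^sub>\<infinity>c\<in>{1..}. niebur_G c s) holomorphic_on {s. Re s > 15/16}"
  proof (rule holomorphic_on_infsum)
    fix R
    obtain M where "\<And>c s. c > 0 \<Longrightarrow> Re s > 15/16 \<Longrightarrow> norm s \<le> R \<Longrightarrow>
       norm (niebur_G c s) \<le> M * (real (card {d. d dvd c}) * real c powr (-17/16))"
      using norm_niebur_G_le[of R] by blast
    thus "\<exists>M. M summable_on {1..} \<and> (\<forall>c\<in>{1..}. \<forall>w\<in>{s. Re s > 15/16}. norm w \<le> R \<longrightarrow> norm (niebur_G c w) \<le> M c)"
      by (intro exI[of _ "\<lambda>c. M * (real (card {d. d dvd c}) * real c powr (-17/16))"] conjI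
            summable_on_cmult_right summable_on_divisor_powr) auto
    show "niebur_G c holomorphic_on {s. Re s > 15/16}" if "c \<in> {1..}" for c
      using that by (intro holomorphic_niebur_G) auto
  qed (rule open_halfspace_Re_gt)
  thus ?thesis unfolding niebur_F_ext_def [abs_def]
    by (intro holomorphic_intros holomorphic_on_subset[OF holomorphic_niebur_seed]) auto
qed

text \<open>For \<open>Re s > 1\<close> the trivial count of at most \<open>c\<close> units
  suffices: \<open>c c^(-2 Re s)\<close> is summable, so the whole series converges absolutely and
  may be summed block by block.\<close>

lemma niebur_lower_row_sum:
  fixes s :: complex
  assumes s: "Re s > 1"
  defines "f \<equiv> (\<lambda>(c, (x, y), k). ec c (- int n * y) * niebur_phi n \<tau> c s (of_int x / real c + of_int (k :: int)))"
  shows "(f has_sum (\<Sum>\<^sub>\<infinity>c\<in>{1..}. niebur_G c s)) (SIGMA c:{1..}. unit_pairs c \<times> UNIV)"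
proof -
  have s': "Re s > 15/16" using s by simp
  define S where "S = (\<Sum>\<^sub>\<infinity>k::int. (1 + \<bar>of_int k\<bar>) powr (-15/8) :: real)"
  obtain M where M0: "M \<ge> 0" and MM: "\<And>c z u k. c > 0 \<Longrightarrow> Re z > 15/16 \<Longrightarrow> norm z \<le> norm s \<Longrightarrow> u \<in> {0..2} \<Longrightarrow>
     norm (niebur_phi n \<tau> c z (u + of_int k)) \<le> M * real c powr (- 2 * Re z) * (1 + \<bar>of_int k\<bar>) powr (-15/8)"
    "\<And>c z u v k. c > 0 \<Longrightarrow> Re z > 15/16 \<Longrightarrow> norm z \<le> norm s \<Longrightarrow> u \<in> {0..2} \<Longrightarrow> v \<in> {0..2} \<Longrightarrow>
       norm (niebur_phi n \<tau> c z (u + of_int k) - niebur_phi n \<tau> c z (v + of_int k))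
         \<le> M * real c powr (- 2 * Re z) * (1 + \<bar>of_int k\<bar>) powr (-15/8) * \<bar>u - v\<bar>"
    by (fact niebur_phi_bounds[of "norm s"])
  have M: "\<And>c k u. c > 0 \<Longrightarrow> u \<in> {0..2} \<Longrightarrow>
     norm (niebur_phi n \<tau> c s (u + of_int k)) \<le> M * real c powr (- 2 * Re s) * (1 + \<bar>of_int k\<bar>) powr (-15/8)"
    using s' by (intro MM) auto
  have u: "of_int x / real c \<in> {0..2}" if "(x, y) \<in> unit_pairs c" "c \<in> {1..}" for x y c
    using that by (auto simp: unit_pairs_def field_simps)
  define g where "g = (\<lambda>(c, (p :: int \<times> int), k::int). M * real c powr (- 2 * Re s) * (1 + \<bar>of_int k\<bar>) powr (-15/8))"
  have inner: "((\<lambda>z. g (c, z)) has_sum (real (card (unit_pairs c)) * (M * real c powr (- 2 * Re s) * S))) (unit_pairs c \<times> UNIV)" for c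
  proof -
    have 1: "((\<lambda>k. g (c, (p, k))) has_sum (M * real c powr (- 2 * Re s) * S)) UNIV" for p
      unfolding g_def S_def prod.case by (intro has_sum_cmult_right has_sum_infsum summable_on_int_powr_15_8)
    have 2: "((\<lambda>p. M * real c powr (- 2 * Re s) * S) has_sum (real (card (unit_pairs c)) * (M * real c powr (- 2 * Re s) * S))) (unit_pairs c)"
      by (rule has_sum_finiteI) simp_all
    show ?thesis
      by (rule has_sum_SigmaI[OF 1 2], rule summable_on_SigmaI[OF 1 has_sum_imp_summable[OF 2]])
         (use M0 in \<open>auto simp: g_def\<close>)
  qed
  have "(\<lambda>c. real (card (unit_pairs c)) * (M * real c powr (- 2 * Re s) * S)) summable_on {1..}"
  proof (rule summable_on_comparison_test)
    have "summable (\<lambda>c. real c powr (1 - 2 * Re s))" by (subst summable_real_powr_iff) (use s in simp)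
    hence "(\<lambda>c. real c powr (1 - 2 * Re s)) summable_on UNIV" by (intro norm_summable_imp_summable_on) simp
    thus "(\<lambda>c. M * S * real c powr (1 - 2 * Re s)) summable_on {1..}"
      by (rule summable_on_cmult_right[OF summable_on_subset]) auto
    have S0: "S \<ge> 0" unfolding S_def by (rule infsum_nonneg) simp
    fix c :: nat assume c: "c \<in> {1..}"
    have "card (unit_pairs c) = card (fst ` unit_pairs c)"
      by (rule card_image[OF inj_on_fst_unit_pairs, symmetric])
    also have "\<dots> \<le> card {0..<int c}" by (rule card_mono) (auto simp: unit_pairs_def)
    finally have "real (card (unit_pairs c)) \<le> real c" by simp
    hence "real (card (unit_pairs c)) * (M * real c powr (- 2 * Re s) * S) \<le> real c * (M * real c powr (- 2 * Re s) * S)"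
      using M0 S0 by (intro mult_right_mono) auto
    also have "\<dots> = M * S * real c powr (1 - 2 * Re s)" using c by (simp add: powr_diff powr_minus field_simps)
    finally show "real (card (unit_pairs c)) * (M * real c powr (- 2 * Re s) * S) \<le> M * S * real c powr (1 - 2 * Re s)" .
    show "0 \<le> real (card (unit_pairs c)) * (M * real c powr (- 2 * Re s) * S)" using M0 S0 by simp
  qed
  hence "g summable_on (SIGMA c:{1..}. unit_pairs c \<times> UNIV)"
    by (rule summable_on_SigmaI[OF inner]) (use M0 in \<open>auto simp: g_def\<close>)
  hence fsum: "f summable_on (SIGMA c:{1..}. unit_pairs c \<times> UNIV)"
    by (rule abs_summable_summable[OF summable_on_comparison_test])
       (use M u in \<open>auto simp: f_def g_def norm_mult\<close>)
  have 1: "((\<lambda>z. f (c, z)) has_sum niebur_G c s) (unit_pairs c \<times> UNIV)" if c: "c \<in> {1..}" for c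
  proof (rule has_sum_SigmaI)
    show "((\<lambda>k. f (c, p, k)) has_sum (case p of (x, y) \<Rightarrow> ec c (- int n * y) * niebur_h c s (of_int x / real c))) UNIV"
      if p: "p \<in> unit_pairs c" for p
      unfolding f_def case_prod_unfold niebur_h_def fst_conv snd_conv
      using p c u[of "fst p" "snd p" c]
      by (intro has_sum_cmult_right has_sum_infsum[OF abs_summable_summable[OF summable_on_niebur_phi]] s') auto
    show "((\<lambda>(x, y). ec c (- int n * y) * niebur_h c s (of_int x / real c)) has_sum niebur_G c s) (unit_pairs c)"
      unfolding niebur_G_def by (rule has_sum_finiteI) simp_all
    show "(\<lambda>z. f (c, z)) summable_on unit_pairs c \<times> UNIV"
      using summable_on_SigmaD1[of "\<lambda>c z. f (c, z)", OF _ c] fsum by simp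
  qed
  have total: "(f has_sum infsum f (SIGMA c:{1..}. unit_pairs c \<times> UNIV)) (SIGMA c:{1..}. unit_pairs c \<times> UNIV)"
    using fsum by (rule has_sum_infsum)
  have "((\<lambda>c. niebur_G c s) has_sum infsum f (SIGMA c:{1..}. unit_pairs c \<times> UNIV)) {1..}"
    by (rule has_sum_SigmaD[OF total 1])
  from infsumI[OF this] have "(\<Sum>\<^sub>\<infinity>c\<in>{1..}. niebur_G c s) = infsum f (SIGMA c:{1..}. unit_pairs c \<times> UNIV)" .
  with total show ?thesis by (simp only:)
qed

end

section \<open>Transversals\<close>

no_notation fps_nth (infixl \<open>$\<close> 75)

definition mat22 :: "int \<Rightarrow> int \<Rightarrow> int \<Rightarrow> int \<Rightarrow> int^2^2" where
  "mat22 a b c d = vector [vector [a, b], vector [c, d]]"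

lemma mat22_nth [simp]:
  "mat22 a b c d $ 1 $ 1 = a" "mat22 a b c d $ 1 $ 2 = b"
  "mat22 a b c d $ 2 $ 1 = c" "mat22 a b c d $ 2 $ 2 = d"
  by (simp_all add: mat22_def)

lemma mat22_eqI:
  fixes A B :: "int^2^2"
  assumes "A $ 1 $ 1 = B $ 1 $ 1" "A $ 1 $ 2 = B $ 1 $ 2" "A $ 2 $ 1 = B $ 2 $ 1" "A $ 2 $ 2 = B $ 2 $ 2"
  shows "A = B"
  using assms by (simp add: vec_eq_iff forall_2)

lemma mult_22_nth:
  fixes A B :: "int^2^2"
  shows "(A ** B) $ i $ j = A $ i $ 1 * B $ 1 $ j + A $ i $ 2 * B $ 2 $ j"
  by (simp add: matrix_matrix_mult_def sum_2)

lemma mat_1_22_nth [simp]: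
  "(mat 1 :: int^2^2) $ 1 $ 1 = 1" "(mat 1 :: int^2^2) $ 1 $ 2 = 0"
  "(mat 1 :: int^2^2) $ 2 $ 1 = 0" "(mat 1 :: int^2^2) $ 2 $ 2 = 1"
  by (simp_all add: mat_def)

lemma det_mat22 [simp]: "det (mat22 a b c d) = a * d - b * c"
  by (simp add: det_2)

definition adj22 :: "int^2^2 \<Rightarrow> int^2^2" where
  "adj22 A = mat22 (A $ 2 $ 2) (- A $ 1 $ 2) (- A $ 2 $ 1) (A $ 1 $ 1)"

lemma adj22_SL2Z:
  assumes "A \<in> SL2Z"
  shows "adj22 A \<in> SL2Z" "A ** adj22 A = mat 1" "adj22 A ** A = mat 1"
  using assms
  by (auto simp: int_mats_det_def adj22_def det_2 mult_22_nth algebra_simps intro!: mat22_eqI)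

text \<open>\<open>C\<close> need not be invertible over the integers; multiplication by the
  adjugate leaves the scalar \<open>det C\<close>, which cancels entrywise.\<close>

lemma mult_right_cancel_22:
  fixes A B C :: "int^2^2"
  assumes "A ** C = B ** C" "det C \<noteq> 0"
  shows "A = B"
proof -
  have *: "(M ** C) ** adj22 C = (\<chi> i j. det C * M $ i $ j :: int^2^2)" for M
    by (rule mat22_eqI) (simp_all add: mult_22_nth adj22_def det_2 algebra_simps)
  have "(\<chi> i j. det C * A $ i $ j) = (\<chi> i j. det C * B $ i $ j)"
    using *[of A] *[of B] assms(1) by simp
  thus ?thesis using assms(2) by (simp add: vec_eq_iff)
qed

section \<open>Left cosets and sums over them\<close>

definition is_subgroup :: "(int^2^2) set \<Rightarrow> bool" where
  "is_subgroup G \<longleftrightarrow> mat 1 \<in> G \<and> (\<forall>g\<in>G. \<forall>h\<in>G. g ** h \<in> G) \<and> (\<forall>g\<in>G. \<exists>h\<in>G. h ** g = mat 1 \<and> g ** h = mat 1)"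

lemma mult_int_mats_det: "A \<in> int_mats_det m \<Longrightarrow> B \<in> int_mats_det n \<Longrightarrow> A ** B \<in> int_mats_det (m * n)"
  by (simp add: int_mats_det_def det_mul)

lemma is_subgroup_SL2Z: "is_subgroup SL2Z"
  unfolding is_subgroup_def using adj22_SL2Z mult_int_mats_det[of _ 1 _ 1]
  by (auto simp: int_mats_det_def) 

lemma Gamma_inf_subset: "Gamma_inf \<subseteq> SL2Z"
  by (auto simp: Gamma_inf_def)

lemma is_subgroup_Gamma_inf: "is_subgroup Gamma_inf"
proof -
  have "adj22 g \<in> Gamma_inf \<and> adj22 g ** g = mat 1 \<and> g ** adj22 g = mat 1" if "g \<in> Gamma_inf" for g
    using that adj22_SL2Z[of g] by (auto simp: Gamma_inf_def adj22_def)
  moreover have "g ** h \<in> Gamma_inf" if "g \<in> Gamma_inf" "h \<in> Gamma_inf" for g h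
    using that mult_int_mats_det[of g 1 h 1] by (auto simp: Gamma_inf_def mult_22_nth)
  moreover have "mat 1 \<in> Gamma_inf" by (simp add: Gamma_inf_def int_mats_det_def)
  ultimately show ?thesis unfolding is_subgroup_def by blast
qed

definition transversal :: "(int^2^2) set \<Rightarrow> (int^2^2) set \<Rightarrow> (int^2^2) set \<Rightarrow> bool" where
  "transversal G X T \<longleftrightarrow> T \<subseteq> X \<and> (\<forall>x\<in>X. \<exists>t\<in>T. \<exists>g\<in>G. x = g ** t) \<and>
     (\<forall>t\<in>T. \<forall>t'\<in>T. \<forall>g\<in>G. t' = g ** t \<longrightarrow> t' = t)"

lemma transversal_subset: "transversal G X T \<Longrightarrow> T \<subseteq> X"
  by (simp add: transversal_def)

lemma transversalE:
  assumes "transversal G X T" "x \<in> X"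
  obtains t g where "t \<in> T" "g \<in> G" "x = g ** t"
  using assms unfolding transversal_def by meson

lemma transversal_unique:
  assumes "transversal G X T" "t \<in> T" "t' \<in> T" "g \<in> G" "t' = g ** t"
  shows "t' = t"
  using assms unfolding transversal_def by simp

lemma left_coset_eq:
  assumes G: "is_subgroup G" and g: "g \<in> G"
  shows "(\<lambda>\<gamma>. \<gamma> ** (g ** x)) ` G = (\<lambda>\<gamma>. \<gamma> ** x) ` G"
proof -
  obtain h where h: "h \<in> G" "h ** g = mat 1" using G g by (auto simp: is_subgroup_def)
  show ?thesis
  proof (intro equalityI image_subsetI)
    fix \<gamma> assume "\<gamma> \<in> G"
    hence "\<gamma> ** g \<in> G" using G g by (auto simp: is_subgroup_def)
    thus "\<gamma> ** (g ** x) \<in> (\<lambda>\<gamma>. \<gamma> ** x) ` G" by (force simp: matrix_mul_assoc)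
  next
    fix \<gamma> assume "\<gamma> \<in> G"
    hence "\<gamma> ** h \<in> G" using G h by (auto simp: is_subgroup_def)
    moreover have "\<gamma> ** x = (\<gamma> ** h) ** (g ** x)"
      using h by (metis matrix_mul_assoc matrix_mul_lid)
    ultimately show "\<gamma> ** x \<in> (\<lambda>\<gamma>. \<gamma> ** (g ** x)) ` G" by blast
  qed
qed

lemma bij_betw_left_quot:
  assumes G: "is_subgroup G" and T: "transversal G X T"
  shows "bij_betw (\<lambda>t. (\<lambda>\<gamma>. \<gamma> ** t) ` G) T (left_quot G X)"
proof (rule bij_betwI')
  fix t t' assume t: "t \<in> T" "t' \<in> T"
  show "((\<lambda>\<gamma>. \<gamma> ** t) ` G = (\<lambda>\<gamma>. \<gamma> ** t') ` G) = (t = t')"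
  proof
    assume eq: "(\<lambda>\<gamma>. \<gamma> ** t) ` G = (\<lambda>\<gamma>. \<gamma> ** t') ` G"
    have "t' \<in> (\<lambda>\<gamma>. \<gamma> ** t') ` G"
      using G by (intro image_eqI[of _ _ "mat 1"]) (auto simp: is_subgroup_def)
    then obtain g where "g \<in> G" "t' = g ** t" using eq by blast
    from transversal_unique[OF T t this] show "t = t'" by (rule sym)
  qed simp
next
  fix t assume "t \<in> T"
  thus "(\<lambda>\<gamma>. \<gamma> ** t) ` G \<in> left_quot G X" using T by (auto simp: left_quot_def transversal_def)
next
  fix C assume "C \<in> left_quot G X"
  then obtain x where x: "x \<in> X" "C = (\<lambda>\<gamma>. \<gamma> ** x) ` G" by (auto simp: left_quot_def)
  from x(1) obtain t g where "t \<in> T" "g \<in> G" "x = g ** t" by (rule transversalE[OF T])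
  thus "\<exists>t\<in>T. C = (\<lambda>\<gamma>. \<gamma> ** t) ` G" using x left_coset_eq[OF G] by blast
qed

lemma rep_left_coset:
  assumes "is_subgroup G"
  obtains g where "g \<in> G" "rep ((\<lambda>\<gamma>. \<gamma> ** x) ` G) = g ** x"
proof -
  have "mat 1 ** x \<in> (\<lambda>\<gamma>. \<gamma> ** x) ` G" using assms unfolding is_subgroup_def by blast
  hence "rep ((\<lambda>\<gamma>. \<gamma> ** x) ` G) \<in> (\<lambda>\<gamma>. \<gamma> ** x) ` G"
    unfolding rep_def by (rule someI)
  thus ?thesis using that by blast
qed

text \<open>\<open>rep\<close> picks an arbitrary member of the coset, which differs from
  \<open>t\<close> by a left factor in \<open>G\<close>; invariance of \<open>f\<close> absorbs
  it.\<close>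

lemma infsum_left_quot:
  assumes G: "is_subgroup G" and T: "transversal G X T"
    and f: "\<And>g x. g \<in> G \<Longrightarrow> x \<in> X \<Longrightarrow> f (g ** x) = f x"
  shows "(\<Sum>\<^sub>\<infinity>C\<in>left_quot G X. f (rep C)) = (\<Sum>\<^sub>\<infinity>t\<in>T. f t)"
proof -
  have "(\<Sum>\<^sub>\<infinity>C\<in>left_quot G X. f (rep C)) = (\<Sum>\<^sub>\<infinity>t\<in>T. f (rep ((\<lambda>\<gamma>. \<gamma> ** t) ` G)))"
    by (rule infsum_reindex_bij_betw[OF bij_betw_left_quot[OF G T], symmetric])
  also have "\<dots> = (\<Sum>\<^sub>\<infinity>t\<in>T. f t)"
  proof (rule infsum_cong)
    fix t assume t: "t \<in> T"
    obtain g where "g \<in> G" "rep ((\<lambda>\<gamma>. \<gamma> ** t) ` G) = g ** t" by (rule rep_left_coset[OF G])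
    moreover have "t \<in> X" using t T by (auto simp: transversal_def)
    ultimately show "f (rep ((\<lambda>\<gamma>. \<gamma> ** t) ` G)) = f t" using f by simp
  qed
  finally show ?thesis .
qed

lemma sum_left_quot:
  assumes G: "is_subgroup G" and T: "transversal G X T"
    and f: "\<And>g x. g \<in> G \<Longrightarrow> x \<in> X \<Longrightarrow> f (g ** x) = f x"
  shows "(\<Sum>C\<in>left_quot G X. f (rep C)) = (\<Sum>t\<in>T. f t)"
proof -
  have "(\<Sum>C\<in>left_quot G X. f (rep C)) = (\<Sum>t\<in>T. f (rep ((\<lambda>\<gamma>. \<gamma> ** t) ` G)))"
    by (rule sum.reindex_bij_betw[OF bij_betw_left_quot[OF G T], symmetric])
  also have "\<dots> = (\<Sum>t\<in>T. f t)"
  proof (rule sum.cong[OF refl])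
    fix t assume t: "t \<in> T"
    obtain g where "g \<in> G" "rep ((\<lambda>\<gamma>. \<gamma> ** t) ` G) = g ** t" by (rule rep_left_coset[OF G])
    moreover have "t \<in> X" using t T by (auto simp: transversal_def)
    ultimately show "f (rep ((\<lambda>\<gamma>. \<gamma> ** t) ` G)) = f t" using f by simp
  qed
  finally show ?thesis .
qed

text \<open>The left side does not mention \<open>T\<close>, so summability passes between any two
  transversals of the same quotient.\<close>

lemma summable_on_transversal_cong:
  fixes f :: "int^2^2 \<Rightarrow> complex"
  assumes G: "is_subgroup G" and T: "transversal G X T"
    and f: "\<And>g x. g \<in> G \<Longrightarrow> x \<in> X \<Longrightarrow> f (g ** x) = f x"
  shows "(\<lambda>C. f (rep C)) summable_on left_quot G X \<longleftrightarrow> f summable_on T"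
proof -
  have "(\<lambda>C. f (rep C)) summable_on left_quot G X \<longleftrightarrow> (\<lambda>t. f (rep ((\<lambda>\<gamma>. \<gamma> ** t) ` G))) summable_on T"
    by (rule summable_on_reindex_bij_betw[OF bij_betw_left_quot[OF G T], symmetric])
  also have "\<dots> \<longleftrightarrow> f summable_on T"
  proof (rule summable_on_cong)
    fix t assume t: "t \<in> T"
    obtain g where "g \<in> G" "rep ((\<lambda>\<gamma>. \<gamma> ** t) ` G) = g ** t" by (rule rep_left_coset[OF G])
    moreover have "t \<in> X" using t T by (auto simp: transversal_def)
    ultimately show "f (rep ((\<lambda>\<gamma>. \<gamma> ** t) ` G)) = f t" using f by simp
  qed
  finally show ?thesis .
qed

section \<open>Representatives modulo the stabilizer of the cusp\<close>

lemma Gamma_inf_cases: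
  assumes "g \<in> Gamma_inf"
  obtains m where "g = mat22 1 m 0 1" | m where "g = mat22 (-1) m 0 (-1)"
proof -
  have "g $ 1 $ 1 * g $ 2 $ 2 = 1" "g $ 2 $ 1 = 0"
    using assms by (auto simp: Gamma_inf_def int_mats_det_def det_2)
  hence "(g $ 1 $ 1 = 1 \<and> g $ 2 $ 2 = 1) \<or> (g $ 1 $ 1 = -1 \<and> g $ 2 $ 2 = -1)" "g $ 2 $ 1 = 0"
    by (simp_all add: zmult_eq_1_iff)
  hence "g = mat22 1 (g $ 1 $ 2) 0 1 \<or> g = mat22 (-1) (g $ 1 $ 2) 0 (-1)"
    by (auto intro!: mat22_eqI)
  thus ?thesis using that by blast
qed

text \<open>The lower row is \<open>(c, x + c k)\<close>, and \<open>y\<close>, the inverse of \<open>x\<close> modulo \<open>c\<close>, is the upper left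
  entry.\<close>

definition lower_row_rep :: "nat \<times> (int \<times> int) \<times> int \<Rightarrow> int^2^2" where
  "lower_row_rep = (\<lambda>(c, (x, y), k). mat22 y ((y * (x + int c * k) - 1) div int c) (int c) (x + int c * k))"

abbreviation lower_rows :: "(nat \<times> (int \<times> int) \<times> int) set" where
  "lower_rows \<equiv> (SIGMA c:{1..}. unit_pairs c \<times> UNIV)"

definition cusp_reps :: "(int^2^2) set" where
  "cusp_reps = insert (mat 1) (lower_row_rep ` lower_rows)"

lemma lower_row_rep_SL2Z:
  assumes "z \<in> lower_rows"
  shows "lower_row_rep z \<in> SL2Z"
proof -
  obtain c x y k where z: "z = (c, (x, y), k)" by (metis prod.exhaust)
  have c: "c \<ge> 1" and xy: "(x, y) \<in> unit_pairs c" using assms by (auto simp: z)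
  have "int c dvd x * y - 1" using xy by (auto simp: unit_pairs_def cong_iff_dvd_diff)
  hence "int c dvd (x * y - 1) + int c * (y * k)" by (intro dvd_add) auto
  hence "int c dvd y * (x + int c * k) - 1" by (simp add: algebra_simps)
  thus ?thesis by (simp add: int_mats_det_def lower_row_rep_def z)
qed

lemma inj_on_lower_row_rep: "inj_on lower_row_rep lower_rows"
proof (rule inj_onI)
  fix z z' assume z: "z \<in> lower_rows" "z' \<in> lower_rows" "lower_row_rep z = lower_row_rep z'"
  obtain c x y k where 1: "z = (c, (x, y), k)" by (metis prod.exhaust)
  obtain c' x' y' k' where 2: "z' = (c', (x', y'), k')" by (metis prod.exhaust)
  have "lower_row_rep z $ i $ j = lower_row_rep z' $ i $ j" for i j using z by simp
  from this[of 1 1] this[of 2 1] this[of 2 2]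
  have e: "y = y'" "c = c'" "x + int c * k = x' + int c' * k'"
    by (auto simp: 1 2 lower_row_rep_def)
  have x: "x \<in> {0..<int c}" "x' \<in> {0..<int c}" using z e by (auto simp: 1 2 unit_pairs_def)
  have "x - x' = int c * (k' - k)" using e by (simp add: algebra_simps)
  hence "x = x'" using x by (intro residue_cong_eq[of x "int c"]) (auto simp: cong_iff_dvd_diff)
  moreover from this have "k = k'" using e z(1) by (auto simp: 1)
  ultimately show "z = z'" using e by (simp add: 1 2)
qed

lemma mat_1_notin_lower_row_rep: "mat 1 \<notin> lower_row_rep ` lower_rows"
proof
  assume "mat 1 \<in> lower_row_rep ` lower_rows"
  then obtain c x y k where "c \<ge> 1" "mat 1 = lower_row_rep (c, (x, y), k)" by auto
  moreover have "lower_row_rep (c, (x, y), k) $ 2 $ 1 = int c" by (simp add: lower_row_rep_def)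
  ultimately show False by (metis mat_1_22_nth(3) not_one_le_zero of_nat_eq_0_iff)
qed

text \<open>The lower left entry of \<open>A ** adj22 B\<close> is the cross product of the two
  lower rows, which vanishes when they are proportional.\<close>

lemma SL2Z_cong_lower_row:
  fixes A B :: "int^2^2"
  assumes A: "A \<in> SL2Z" and B: "B \<in> SL2Z" and "A $ 2 $ 1 * B $ 2 $ 2 = A $ 2 $ 2 * B $ 2 $ 1"
  shows "A ** adj22 B \<in> Gamma_inf" "A = (A ** adj22 B) ** B"
proof -
  show "A ** adj22 B \<in> Gamma_inf"
    using assms mult_int_mats_det[OF A adj22_SL2Z(1)[OF B]]
    by (auto simp: Gamma_inf_def mult_22_nth adj22_def)
  show "A = (A ** adj22 B) ** B"
    using adj22_SL2Z(3)[OF B] by (metis matrix_mul_assoc matrix_mul_rid)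
qed

text \<open>A coset is a lower row up to sign. The sign is fixed by making the lower left entry
  \<open>c\<close> positive, the other entry \<open>d\<close> splits into its residue
  \<open>x\<close> and quotient \<open>k\<close> modulo \<open>c\<close>, and \<open>y\<close> is
  then forced. The row with \<open>c = 0\<close> is represented by the identity.\<close>

lemma transversal_cusp_reps: "transversal Gamma_inf SL2Z cusp_reps"
  unfolding transversal_def
proof (intro conjI ballI impI)
  show "cusp_reps \<subseteq> SL2Z" using lower_row_rep_SL2Z by (auto simp: cusp_reps_def int_mats_det_def)
next
  fix A assume A: "A \<in> SL2Z"
  show "\<exists>t\<in>cusp_reps. \<exists>g\<in>Gamma_inf. A = g ** t"
  proof (cases "A $ 2 $ 1 = 0")
    case True
    hence "A \<in> Gamma_inf" using A by (simp add: Gamma_inf_def)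
    thus ?thesis by (intro bexI[of _ "mat 1"] bexI[of _ A]) (auto simp: cusp_reps_def)
  next
    case False
    define c where "c = nat \<bar>A $ 2 $ 1\<bar>"
    define d where "d = sgn (A $ 2 $ 1) * A $ 2 $ 2"
    define a where "a = sgn (A $ 2 $ 1) * A $ 1 $ 1"
    have c: "c \<ge> 1" "int c = \<bar>A $ 2 $ 1\<bar>" using False by (auto simp: c_def)
    have sg: "sgn (A $ 2 $ 1) * sgn (A $ 2 $ 1) = 1" using False by (auto simp: sgn_if)
    have "a * d = A $ 1 $ 1 * A $ 2 $ 2" using sg by (simp add: a_def d_def mult_ac)
    also have "\<dots> = 1 + A $ 1 $ 2 * A $ 2 $ 1" using A by (simp add: int_mats_det_def det_2)
    finally have "[d * a = 1] (mod int c)" by (simp add: c cong_iff_dvd_diff mult.commute)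
    hence U: "(d mod int c, a mod int c) \<in> unit_pairs c"
      using c(1) by (auto simp: unit_pairs_def cong_def mod_mult_eq)
    define t where "t = lower_row_rep (c, (d mod int c, a mod int c), d div int c)"
    have tl: "(c, (d mod int c, a mod int c), d div int c) \<in> lower_rows" using U c by auto
    have t: "t $ 2 $ 1 = int c" "t $ 2 $ 2 = d" by (simp_all add: t_def lower_row_rep_def)
    have "A $ 2 $ 1 * t $ 2 $ 2 = A $ 2 $ 2 * t $ 2 $ 1"
      unfolding t c d_def by (simp add: abs_if sgn_if)
    from SL2Z_cong_lower_row[OF A lower_row_rep_SL2Z[OF tl], folded t_def, OF this]
    show ?thesis using tl unfolding cusp_reps_def t_def by blast
  qed
next
  fix t t' g assume t: "t \<in> cusp_reps" "t' \<in> cusp_reps" and g: "g \<in> Gamma_inf" "t' = g ** t"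
  have "\<exists>\<sigma>. (\<sigma> = 1 \<or> \<sigma> = -1) \<and> g $ 2 $ 2 = \<sigma> \<and> g $ 2 $ 1 = 0"
    using g(1) by (cases rule: Gamma_inf_cases) auto
  then obtain \<sigma> where \<sigma>: "\<sigma> = 1 \<or> \<sigma> = -1" "g $ 2 $ 2 = \<sigma>" "g $ 2 $ 1 = 0" by blast
  have row: "t' $ 2 $ j = \<sigma> * t $ 2 $ j" for j using g(2) \<sigma> by (simp add: mult_22_nth)
  have pos: "u $ 2 $ 1 \<ge> 1" if "u \<in> lower_row_rep ` lower_rows" for u :: "int^2^2"
    using that by (auto simp: lower_row_rep_def)
  show "t' = t"
  proof (cases "t = mat 1 \<or> t' = mat 1")
    case True
    hence "t $ 2 $ 1 = 0" "t' $ 2 $ 1 = 0" using row[of 1] \<sigma>(1) by auto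
    moreover have "u = mat 1" if "u \<in> cusp_reps" "u $ 2 $ 1 = 0" for u :: "int^2^2"
      using that pos[of u] unfolding cusp_reps_def by fastforce
    ultimately show ?thesis using t by metis
  next
    case False
    hence m: "t \<in> lower_row_rep ` lower_rows" "t' \<in> lower_row_rep ` lower_rows"
      using t by (auto simp: cusp_reps_def)
    have "\<sigma> = 1" using pos[OF m(1)] pos[OF m(2)] row[of 1] \<sigma>(1) by auto
    obtain c x y k where 1: "(c, (x, y), k) \<in> lower_rows" "t = lower_row_rep (c, (x, y), k)"
    proof -
      from m(1) obtain z where "z \<in> lower_rows" "t = lower_row_rep z" by (rule imageE) 
      thus ?thesis using that by (cases z) auto
    qed
    obtain c' x' y' k' where 2: "(c', (x', y'), k') \<in> lower_rows" "t' = lower_row_rep (c', (x', y'), k')"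
    proof -
      from m(2) obtain z where "z \<in> lower_rows" "t' = lower_row_rep z" by (rule imageE)
      thus ?thesis using that by (cases z) auto
    qed
    have e: "c' = c" "x' + int c * k' = x + int c * k" using row[of 1] row[of 2] \<open>\<sigma> = 1\<close>
      by (simp_all add: 1 2 lower_row_rep_def)
    have x: "x \<in> {0..<int c}" "x' \<in> {0..<int c}" using 1 2 e by (auto simp: unit_pairs_def)
    have "x' - x = int c * (k - k')" using e by (simp add: algebra_simps)
    hence xx: "x' = x" using x by (intro residue_cong_eq[of x' "int c"]) (auto simp: cong_iff_dvd_diff)
    moreover from this have "k' = k" using e 1(1) by auto
    moreover have "y' = y" using inj_onD[OF inj_on_fst_unit_pairs[of c], of "(x', y')" "(x, y)"] 1 2 e xx by auto
    ultimately show ?thesis by (simp add: 1 2 e)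
  qed
qed

lemma transversal_mult_right:
  assumes G: "G \<subseteq> SL2Z" and T: "transversal G SL2Z T" and \<gamma>: "\<gamma> \<in> SL2Z"
  shows "transversal G SL2Z ((\<lambda>t. t ** \<gamma>) ` T)"
  unfolding transversal_def
proof (intro conjI ballI impI)
  show "(\<lambda>t. t ** \<gamma>) ` T \<subseteq> SL2Z"
    using T \<gamma> mult_int_mats_det[of _ 1 \<gamma> 1] by (auto simp: transversal_def)
next
  fix x assume x: "x \<in> SL2Z"
  have "x ** adj22 \<gamma> \<in> SL2Z" using mult_int_mats_det[OF x adj22_SL2Z(1)[OF \<gamma>]] by simp
  then obtain t g where tg: "t \<in> T" "g \<in> G" "x ** adj22 \<gamma> = g ** t" by (rule transversalE[OF T])
  have "x = (x ** adj22 \<gamma>) ** \<gamma>" using adj22_SL2Z(3)[OF \<gamma>] by (metis matrix_mul_assoc matrix_mul_rid)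
  hence "x = g ** (t ** \<gamma>)" using tg by (simp add: matrix_mul_assoc)
  thus "\<exists>t\<in>(\<lambda>t. t ** \<gamma>) ` T. \<exists>g\<in>G. x = g ** t" using tg by blast
next
  fix t t' g assume "t \<in> (\<lambda>t. t ** \<gamma>) ` T" "t' \<in> (\<lambda>t. t ** \<gamma>) ` T" "g \<in> G" "t' = g ** t"
  then obtain u u' where u: "u \<in> T" "u' \<in> T" "t = u ** \<gamma>" "t' = u' ** \<gamma>" "g \<in> G" "u' ** \<gamma> = (g ** u) ** \<gamma>"
    by (auto simp: matrix_mul_assoc)
  have "u' = g ** u" using mult_right_cancel_22[OF u(6)] \<gamma> by (simp add: int_mats_det_def)
  from transversal_unique[OF T u(1,2,5) this] show "t' = t" by (simp add: u)
qed

section \<open>Matrices of determinant \<open>p\<close>\<close>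

definition hecke_reps :: "nat \<Rightarrow> (int^2^2) set" where
  "hecke_reps p = insert (mat22 (int p) 0 0 1) ((\<lambda>j. mat22 1 j 0 (int p)) ` {0..<int p})"

text \<open>Dividing the first column by its gcd \<open>g\<close> gives a primitive vector; Bezout
  completes it to the matrix \<open>U\<close>, and undoing \<open>U\<close> leaves the first column
  \<open>(g, 0)\<close>.\<close>

lemma upper_triangular_left:
  assumes A: "A \<in> int_mats_det m" and m: "m \<noteq> 0"
  obtains U a b d where "U \<in> SL2Z" "A = U ** mat22 a b 0 d" "a > 0" "a * d = m"
proof -
  define g where "g = gcd (A $ 1 $ 1) (A $ 2 $ 1)"
  have det: "A $ 1 $ 1 * A $ 2 $ 2 - A $ 1 $ 2 * A $ 2 $ 1 = m" using A by (simp add: int_mats_det_def det_2)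
  hence "A $ 1 $ 1 \<noteq> 0 \<or> A $ 2 $ 1 \<noteq> 0" using m by auto
  hence g: "g > 0" by (auto simp: g_def)
  obtain a' c' where ac: "A $ 1 $ 1 = g * a'" "A $ 2 $ 1 = g * c'" unfolding g_def by (meson dvdE gcd_dvd1 gcd_dvd2)
  obtain u v where "u * A $ 1 $ 1 + v * A $ 2 $ 1 = g" unfolding g_def using bezout_int by blast
  hence "g * (u * a' + v * c') = g * 1" by (simp add: ac algebra_simps)
  hence uv: "u * a' + v * c' = 1" using g by (metis mult_cancel_left order_less_irrefl)
  define U where "U = mat22 a' (- v) c' u"
  have U: "U \<in> SL2Z" using uv by (simp add: U_def int_mats_det_def algebra_simps)
  define M where "M = adj22 U ** A"
  have AM: "A = U ** M" using adj22_SL2Z(2)[OF U] unfolding M_def by (metis matrix_mul_assoc matrix_mul_lid)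
  have "M $ 2 $ 1 = 0" by (simp add: M_def mult_22_nth adj22_def U_def ac)
  moreover have "M $ 1 $ 1 = g"
  proof -
    have "M $ 1 $ 1 = g * (u * a' + v * c')" by (simp add: M_def mult_22_nth adj22_def U_def ac algebra_simps)
    thus ?thesis using uv by simp
  qed
  ultimately have Me: "M = mat22 g (M $ 1 $ 2) 0 (M $ 2 $ 2)" by (intro mat22_eqI) auto
  have "det A = det U * det M" unfolding AM by (rule det_mul)
  hence "det M = m" using A U by (simp add: int_mats_det_def)
  hence "g * M $ 2 $ 2 = m" by (subst (asm) Me) simp
  thus ?thesis using that[OF U _ g] AM Me by metis
qed

text \<open>The mirror image with the lower row in place of the first column; it is needed for the
  products \<open>\<delta>t\<close>.\<close>

lemma upper_triangular_right:
  assumes A: "A \<in> int_mats_det m" and m: "m \<noteq> 0"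
  obtains V a b d where "V \<in> SL2Z" "A = mat22 a b 0 d ** V" "d > 0" "a * d = m"
proof -
  define g where "g = gcd (A $ 2 $ 1) (A $ 2 $ 2)"
  have det: "A $ 1 $ 1 * A $ 2 $ 2 - A $ 1 $ 2 * A $ 2 $ 1 = m" using A by (simp add: int_mats_det_def det_2)
  hence "A $ 2 $ 1 \<noteq> 0 \<or> A $ 2 $ 2 \<noteq> 0" using m by auto
  hence g: "g > 0" by (auto simp: g_def)
  obtain c' d' where cd: "A $ 2 $ 1 = g * c'" "A $ 2 $ 2 = g * d'" unfolding g_def by (meson dvdE gcd_dvd1 gcd_dvd2)
  obtain u v where "u * A $ 2 $ 1 + v * A $ 2 $ 2 = g" unfolding g_def using bezout_int by blast
  hence "g * (u * c' + v * d') = g * 1" by (simp add: cd algebra_simps)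
  hence uv: "u * c' + v * d' = 1" using g by (metis mult_cancel_left order_less_irrefl)
  define V where "V = mat22 v (- u) c' d'"
  have V: "V \<in> SL2Z" using uv by (simp add: V_def int_mats_det_def algebra_simps)
  define M where "M = A ** adj22 V"
  have AM: "A = M ** V" using adj22_SL2Z(3)[OF V] unfolding M_def by (metis matrix_mul_assoc matrix_mul_rid)
  have "M $ 2 $ 1 = 0" by (simp add: M_def mult_22_nth adj22_def V_def cd)
  moreover have "M $ 2 $ 2 = g"
  proof -
    have "M $ 2 $ 2 = g * (u * c' + v * d')" by (simp add: M_def mult_22_nth adj22_def V_def cd algebra_simps)
    thus ?thesis using uv by simp
  qed
  ultimately have Me: "M = mat22 (M $ 1 $ 1) (M $ 1 $ 2) 0 g" by (intro mat22_eqI) auto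
  have "det A = det M * det V" unfolding AM by (rule det_mul)
  hence "det M = m" using A V by (simp add: int_mats_det_def)
  hence "M $ 1 $ 1 * g = m" by (subst (asm) Me) simp
  thus ?thesis using that[OF V _ g] AM Me by metis
qed

lemma mat22_translation_mult: "mat22 1 k 0 1 ** mat22 a b c d = mat22 (a + k * c) (b + k * d) c d"
  by (intro mat22_eqI) (simp_all add: mult_22_nth)

lemma mat22_translation_Gamma_inf: "mat22 1 k 0 1 \<in> Gamma_inf"
  by (simp add: Gamma_inf_def int_mats_det_def)

context
  fixes p :: nat
  assumes p: "prime p"
begin

lemma hecke_reps_subset: "hecke_reps p \<subseteq> int_mats_det (int p)"
  by (auto simp: hecke_reps_def int_mats_det_def)

lemma det_hecke_reps_nonzero: "r \<in> hecke_reps p \<Longrightarrow> det r \<noteq> 0"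
  using hecke_reps_subset p by (auto simp: int_mats_det_def)

lemma finite_hecke_reps: "finite (hecke_reps p)"
  by (simp add: hecke_reps_def)

lemma hecke_reps_cases:
  assumes "r \<in> hecke_reps p"
  obtains "r = mat22 (int p) 0 0 1" | j where "j \<in> {0..<int p}" "r = mat22 1 j 0 (int p)"
  using assms by (auto simp: hecke_reps_def)

text \<open>Primality leaves only the diagonals \<open>(1, p)\<close> and \<open>(p, 1)\<close>, and
  a translation reduces the upper right entry. The disjunction fits both triangular factorizations,
  which make different diagonal entries positive.\<close>

lemma triangular_reduce:
  assumes "a * d = int p" "a > 0 \<or> d > 0"
  obtains r k where "r \<in> hecke_reps p" "mat22 a b 0 d = mat22 1 k 0 1 ** r"
proof -
  have p0: "int p > 0" using p by (simp add: prime_gt_0_nat)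
  have "0 < a * d" using assms p0 by simp
  hence "0 < a \<and> 0 < d \<or> a < 0 \<and> d < 0" by (simp only: zero_less_mult_iff)
  hence ad: "a > 0" "d > 0" using assms(2) by linarith+
  have "nat a dvd p" using assms(1) ad by (metis dvd_triv_left int_dvd_int_iff nat_0_le order_less_imp_le)
  hence "nat a = 1 \<or> nat a = p" using p by (auto simp: prime_nat_iff)
  hence "a = 1 \<or> a = int p" using ad by linarith
  hence "a = 1 \<and> d = int p \<or> a = int p \<and> d = 1" using assms(1) p0 by auto
  thus ?thesis
  proof
    assume 1: "a = 1 \<and> d = int p"
    have "mat22 1 (b mod int p) 0 (int p) \<in> hecke_reps p" using p0 by (auto simp: hecke_reps_def)
    moreover have "mat22 a b 0 d = mat22 1 (b div int p) 0 1 ** mat22 1 (b mod int p) 0 (int p)"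
      using 1 by (simp add: mat22_translation_mult)
    ultimately show ?thesis by (rule that)
  next
    assume 2: "a = int p \<and> d = 1"
    have "mat22 (int p) 0 0 1 \<in> hecke_reps p" by (auto simp: hecke_reps_def)
    moreover have "mat22 a b 0 d = mat22 1 b 0 1 ** mat22 (int p) 0 0 1"
      using 2 by (simp add: mat22_translation_mult)
    ultimately show ?thesis by (rule that)
  qed
qed

lemma transversal_hecke_reps: "transversal SL2Z (int_mats_det (int p)) (hecke_reps p)"
  unfolding transversal_def
proof (intro conjI ballI impI hecke_reps_subset)
  fix A assume A: "A \<in> int_mats_det (int p)"
  have "int p \<noteq> 0" using p by auto
  from upper_triangular_left[OF A this] obtain U a b d
    where U: "U \<in> SL2Z" "A = U ** mat22 a b 0 d" "a > 0" "a * d = int p" .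
  obtain r k where r: "r \<in> hecke_reps p" "mat22 a b 0 d = mat22 1 k 0 1 ** r"
    by (rule triangular_reduce[OF U(4)]) (use U in auto)
  have "U ** mat22 1 k 0 1 \<in> SL2Z"
    using mult_int_mats_det[OF U(1), of "mat22 1 k 0 1" 1] by (simp add: int_mats_det_def)
  moreover have "A = (U ** mat22 1 k 0 1) ** r" using U r by (simp add: matrix_mul_assoc)
  ultimately show "\<exists>t\<in>hecke_reps p. \<exists>g\<in>SL2Z. A = g ** t" using r by blast
next
  fix t t' g assume t: "t \<in> hecke_reps p" "t' \<in> hecke_reps p" and g: "g \<in> SL2Z" "t' = g ** t"
  have low: "r $ 2 $ 1 = 0 \<and> r $ 1 $ 1 > 0" if "r \<in> hecke_reps p" for r :: "int^2^2"
    using that p by (auto simp: hecke_reps_def prime_gt_0_nat)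
  have "g $ 2 $ 1 * t $ 1 $ 1 = 0" using low[OF t(1)] low[OF t(2)] g(2) by (simp add: mult_22_nth)
  hence "g $ 2 $ 1 = 0" using low[OF t(1)] by simp
  hence G: "g \<in> Gamma_inf" using g by (simp add: Gamma_inf_def)
  have e: "t' $ 1 $ 1 = g $ 1 $ 1 * t $ 1 $ 1" "t' $ 1 $ 2 = g $ 1 $ 1 * t $ 1 $ 2 + g $ 1 $ 2 * t $ 2 $ 2"
    using low[OF t(1)] by (simp_all add: g(2) mult_22_nth)
  have "g $ 1 $ 1 = 1" using G low[OF t(1)] low[OF t(2)] e(1) by (cases rule: Gamma_inf_cases) auto
  with e have e: "t' $ 1 $ 1 = t $ 1 $ 1" "t' $ 1 $ 2 = t $ 1 $ 2 + g $ 1 $ 2 * t $ 2 $ 2" by simp_all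
  have p1: "int p \<noteq> 1" using p by auto
  show "t' = t"
  proof (cases rule: hecke_reps_cases[OF t(1)])
    case 1
    thus ?thesis by (rule_tac hecke_reps_cases[OF t(2)]) (use e(1) p1 in auto)
  next
    case (2 j)
    obtain j' where j': "j' \<in> {0..<int p}" "t' = mat22 1 j' 0 (int p)"
      by (rule_tac hecke_reps_cases[OF t(2)]) (use e(1) p1 2 in auto)
    have "j' - j = g $ 1 $ 2 * int p" using e(2) 2 j' by simp
    hence "j' = j" using 2 j' by (intro residue_cong_eq[of j' "int p"]) (auto simp: cong_iff_dvd_diff)
    thus ?thesis using 2 j' by simp
  qed
qed

text \<open>The quotient by \<open>\<Gamma>_\<infinity>\<close> lies over the quotient by
  \<open>\<Gamma>\<close>: the coset of a matrix modulo \<open>\<Gamma>\<close> determines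
  \<open>r\<close>, and after cancelling \<open>r\<close> the coset modulo
  \<open>\<Gamma>_\<infinity>\<close> determines \<open>t\<close>.\<close>

lemma transversal_cusp_hecke:
  defines "X \<equiv> int_mats_det (int p)"
  shows "transversal Gamma_inf X ((\<lambda>(r, t). t ** r) ` (hecke_reps p \<times> cusp_reps))"
    and "inj_on (\<lambda>(r, t). t ** r) (hecke_reps p \<times> cusp_reps)"
proof -
  have T: "cusp_reps \<subseteq> SL2Z" by (rule transversal_subset[OF transversal_cusp_reps])
  have uniq: "r' = r \<and> t' = t"
    if H: "r \<in> hecke_reps p" "r' \<in> hecke_reps p" "t \<in> cusp_reps" "t' \<in> cusp_reps" "h \<in> Gamma_inf"
      "t' ** r' = h ** (t ** r)" for r r' t t' h
  proof -
    have t: "t \<in> SL2Z" "t' \<in> SL2Z" "h \<in> SL2Z" using H T Gamma_inf_subset by auto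
    have "r' = adj22 t' ** (t' ** r')" using adj22_SL2Z(3)[OF t(2)] by (simp add: matrix_mul_assoc)
    also have "\<dots> = (adj22 t' ** (h ** t)) ** r" by (simp add: H(6) matrix_mul_assoc)
    finally have 1: "r' = (adj22 t' ** (h ** t)) ** r" .
    have "adj22 t' ** (h ** t) \<in> SL2Z"
      using mult_int_mats_det[OF adj22_SL2Z(1)[OF t(2)] mult_int_mats_det[OF t(3) t(1)]] by simp
    from transversal_unique[OF transversal_hecke_reps H(1,2) this 1] have r: "r' = r" .
    have "t' ** r = (h ** t) ** r" using H(6) r by (simp add: matrix_mul_assoc)
    hence "t' = h ** t" using det_hecke_reps_nonzero[OF H(1)] by (rule mult_right_cancel_22)
    from transversal_unique[OF transversal_cusp_reps H(3,4,5) this] r show ?thesis by simp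
  qed
  have one: "mat 1 \<in> Gamma_inf" using is_subgroup_Gamma_inf by (simp add: is_subgroup_def)
  show "inj_on (\<lambda>(r, t). t ** r) (hecke_reps p \<times> cusp_reps)"
    using uniq[OF _ _ _ _ one] by (intro inj_onI) auto
  show "transversal Gamma_inf X ((\<lambda>(r, t). t ** r) ` (hecke_reps p \<times> cusp_reps))"
    unfolding transversal_def
  proof (intro conjI ballI impI)
    show "(\<lambda>(r, t). t ** r) ` (hecke_reps p \<times> cusp_reps) \<subseteq> X"
      using mult_int_mats_det[of _ 1 _ "int p"] T hecke_reps_subset by (auto simp: X_def)
  next
    fix x assume "x \<in> X"
    then obtain r g where 1: "r \<in> hecke_reps p" "g \<in> SL2Z" "x = g ** r"
      unfolding X_def by (rule transversalE[OF transversal_hecke_reps])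
    from 1(2) obtain t h where 2: "t \<in> cusp_reps" "h \<in> Gamma_inf" "g = h ** t"
      by (rule transversalE[OF transversal_cusp_reps])
    have "x = h ** (t ** r)" by (simp add: 1 2 matrix_mul_assoc)
    thus "\<exists>t\<in>(\<lambda>(r, t). t ** r) ` (hecke_reps p \<times> cusp_reps). \<exists>g\<in>Gamma_inf. x = g ** t"
      using 1 2 by (intro bexI[of _ "t ** r"] bexI[of _ h]) auto
  next
    fix x x' h assume x: "x \<in> (\<lambda>(r, t). t ** r) ` (hecke_reps p \<times> cusp_reps)"
      "x' \<in> (\<lambda>(r, t). t ** r) ` (hecke_reps p \<times> cusp_reps)" "h \<in> Gamma_inf" "x' = h ** x"
    from x(1) obtain r t where 1: "r \<in> hecke_reps p" "t \<in> cusp_reps" "x = t ** r" by auto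
    from x(2) obtain r' t' where 2: "r' \<in> hecke_reps p" "t' \<in> cusp_reps" "x' = t' ** r'" by auto
    have "t' ** r' = h ** (t ** r)" using x(4) by (simp add: 1 2)
    from uniq[OF 1(1) 2(1) 1(2) 2(2) x(3) this] show "x' = x" by (simp add: 1 2)
  qed
qed

text \<open>In this order the lower row decides. The lower row of \<open>t\<close> is primitive, so
  the gcd of the lower row of \<open>r ** t\<close> is the lower right entry of \<open>r\<close>.
  Dividing it out gives the lower row of \<open>t\<close> up to sign, hence \<open>t\<close>, and
  cancelling \<open>t\<close> then gives \<open>r\<close>.\<close>

lemma transversal_hecke_cusp:
  defines "X \<equiv> int_mats_det (int p)"
  shows "transversal Gamma_inf X ((\<lambda>(r, t). r ** t) ` (hecke_reps p \<times> cusp_reps))"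
    and "inj_on (\<lambda>(r, t). r ** t) (hecke_reps p \<times> cusp_reps)"
proof -
  have T: "cusp_reps \<subseteq> SL2Z" by (rule transversal_subset[OF transversal_cusp_reps])
  have low: "r $ 2 $ 1 = 0 \<and> r $ 2 $ 2 > 0" if "r \<in> hecke_reps p" for r :: "int^2^2"
    using that p by (auto simp: hecke_reps_def prime_gt_0_nat)
  have gcd: "gcd (t $ 2 $ 1) (t $ 2 $ 2) = 1" if "t \<in> SL2Z" for t :: "int^2^2"
  proof -
    have "t $ 1 $ 1 * t $ 2 $ 2 - t $ 1 $ 2 * t $ 2 $ 1 = 1" using that by (simp add: int_mats_det_def det_2)
    moreover have "gcd (t $ 2 $ 1) (t $ 2 $ 2) dvd t $ 1 $ 1 * t $ 2 $ 2 - t $ 1 $ 2 * t $ 2 $ 1"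
      by (intro dvd_diff dvd_mult) auto
    ultimately show ?thesis by simp
  qed
  have uniq: "r' = r \<and> t' = t"
    if H: "r \<in> hecke_reps p" "r' \<in> hecke_reps p" "t \<in> cusp_reps" "t' \<in> cusp_reps" "h \<in> Gamma_inf"
      "r' ** t' = h ** (r ** t)" for r r' t t' h
  proof -
    have t: "t \<in> SL2Z" "t' \<in> SL2Z" "h \<in> SL2Z" using H T Gamma_inf_subset by auto
    have "\<exists>\<sigma>. (\<sigma> = 1 \<or> \<sigma> = -1) \<and> h $ 2 $ 2 = \<sigma> \<and> h $ 2 $ 1 = 0"
      using H(5) by (cases rule: Gamma_inf_cases) auto
    then obtain \<sigma> where \<sigma>: "\<sigma> = 1 \<or> \<sigma> = -1" "h $ 2 $ 2 = \<sigma>" "h $ 2 $ 1 = 0" by blast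
    have row: "r' $ 2 $ 2 * t' $ 2 $ j = \<sigma> * (r $ 2 $ 2 * t $ 2 $ j)" for j
    proof -
      have "(r' ** t') $ 2 $ j = (h ** (r ** t)) $ 2 $ j" by (simp add: H(6))
      thus ?thesis using \<sigma> low[OF H(1)] low[OF H(2)] by (simp add: mult_22_nth)
    qed
    have \<sigma>gcd: "gcd (\<sigma> * x) (\<sigma> * y) = gcd x y" for x y using \<sigma>(1) by (elim disjE) simp_all
    have "gcd (r' $ 2 $ 2 * t' $ 2 $ 1) (r' $ 2 $ 2 * t' $ 2 $ 2) = gcd (r $ 2 $ 2 * t $ 2 $ 1) (r $ 2 $ 2 * t $ 2 $ 2)"
      by (simp only: row \<sigma>gcd)
    hence "r' $ 2 $ 2 = r $ 2 $ 2"
      unfolding gcd_mult_left gcd[OF t(1)] gcd[OF t(2)] using low[OF H(1)] low[OF H(2)] by simp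
    hence "r $ 2 $ 2 * (t' $ 2 $ j) = r $ 2 $ 2 * (\<sigma> * t $ 2 $ j)" for j using row[of j] by (simp add: mult_ac)
    hence row': "t' $ 2 $ j = \<sigma> * t $ 2 $ j" for j using low[OF H(1)] by (metis mult_cancel_left order_less_irrefl)
    have "t' $ 2 $ 1 * t $ 2 $ 2 = t' $ 2 $ 2 * t $ 2 $ 1" by (simp add: row'[of 1] row'[of 2])
    from SL2Z_cong_lower_row[OF t(2,1) this] have "t' ** adj22 t \<in> Gamma_inf" "t' = (t' ** adj22 t) ** t" .
    from transversal_unique[OF transversal_cusp_reps H(3,4) this] have tt: "t' = t" .
    have "r' ** t = (h ** r) ** t" using H(6) tt by (simp add: matrix_mul_assoc)
    moreover have "det t \<noteq> 0" using t by (simp add: int_mats_det_def)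
    ultimately have "r' = h ** r" by (rule mult_right_cancel_22)
    from transversal_unique[OF transversal_hecke_reps H(1,2) t(3) this] tt show ?thesis by simp
  qed
  have one: "mat 1 \<in> Gamma_inf" using is_subgroup_Gamma_inf by (simp add: is_subgroup_def)
  show "inj_on (\<lambda>(r, t). r ** t) (hecke_reps p \<times> cusp_reps)"
    using uniq[OF _ _ _ _ one] by (intro inj_onI) auto
  show "transversal Gamma_inf X ((\<lambda>(r, t). r ** t) ` (hecke_reps p \<times> cusp_reps))"
    unfolding transversal_def
  proof (intro conjI ballI impI)
    show "(\<lambda>(r, t). r ** t) ` (hecke_reps p \<times> cusp_reps) \<subseteq> X"
      using mult_int_mats_det[of _ "int p" _ 1] T hecke_reps_subset by (auto simp: X_def)
  next
    fix x assume x: "x \<in> X"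
    have "int p \<noteq> 0" using p by auto
    from upper_triangular_right[OF x[unfolded X_def] this] obtain V a b d
      where V: "V \<in> SL2Z" "x = mat22 a b 0 d ** V" "d > 0" "a * d = int p" .
    from V(1) obtain t h where t: "t \<in> cusp_reps" "h \<in> Gamma_inf" "V = h ** t"
      by (rule transversalE[OF transversal_cusp_reps])
    \<comment> \<open>Moving \<open>h\<close> past a triangular matrix changes only the upper right
      entry, apart from the common sign recorded in \<open>s\<close>.\<close>
    define s where "s = mat22 (h $ 1 $ 1) 0 0 (h $ 2 $ 2)"
    have s: "s \<in> Gamma_inf" using t(2) by (cases rule: Gamma_inf_cases) (auto simp: s_def Gamma_inf_def int_mats_det_def)
    have "\<exists>b'. mat22 a b 0 d ** h = s ** mat22 a b' 0 d"
      using t(2)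
    proof (cases rule: Gamma_inf_cases)
      case (1 m)
      thus ?thesis by (intro exI[of _ "a * m + b"] mat22_eqI) (simp_all add: s_def mult_22_nth)
    next
      case (2 m)
      thus ?thesis by (intro exI[of _ "b - a * m"] mat22_eqI) (simp_all add: s_def mult_22_nth)
    qed
    then obtain b' where b': "mat22 a b 0 d ** h = s ** mat22 a b' 0 d" ..
    obtain r k where r: "r \<in> hecke_reps p" "mat22 a b' 0 d = mat22 1 k 0 1 ** r"
      by (rule triangular_reduce[OF V(4)]) (use V in auto)
    have "x = (mat22 a b 0 d ** h) ** t" by (simp add: V t matrix_mul_assoc)
    also have "\<dots> = (s ** mat22 1 k 0 1) ** (r ** t)" by (simp add: b' r matrix_mul_assoc)
    finally have "x = (s ** mat22 1 k 0 1) ** (r ** t)" .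
    moreover have "s ** mat22 1 k 0 1 \<in> Gamma_inf"
      using s mat22_translation_Gamma_inf is_subgroup_Gamma_inf by (auto simp: is_subgroup_def)
    ultimately show "\<exists>t\<in>(\<lambda>(r, t). r ** t) ` (hecke_reps p \<times> cusp_reps). \<exists>g\<in>Gamma_inf. x = g ** t"
      using r t by (intro bexI[of _ "r ** t"] bexI[of _ "s ** mat22 1 k 0 1"]) auto
  next
    fix x x' h assume x: "x \<in> (\<lambda>(r, t). r ** t) ` (hecke_reps p \<times> cusp_reps)"
      "x' \<in> (\<lambda>(r, t). r ** t) ` (hecke_reps p \<times> cusp_reps)" "h \<in> Gamma_inf" "x' = h ** x"
    from x(1) obtain r t where 1: "r \<in> hecke_reps p" "t \<in> cusp_reps" "x = r ** t" by auto
    from x(2) obtain r' t' where 2: "r' \<in> hecke_reps p" "t' \<in> cusp_reps" "x' = r' ** t'" by auto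
    have "r' ** t' = h ** (r ** t)" using x(4) by (simp add: 1 2)
    from uniq[OF 1(1) 2(1) 1(2) 2(2) x(3) this] show "x' = x" by (simp add: 1 2)
  qed
qed

end

section \<open>Moebius action and the explicit Hecke sum\<close>

lemma moebius_denom_nonzero:
  fixes A :: "int^2^2"
  assumes "det A > 0" "Im \<tau> > 0"
  shows "of_int (A $ 2 $ 1) * \<tau> + of_int (A $ 2 $ 2) \<noteq> 0"
proof
  assume 0: "of_int (A $ 2 $ 1) * \<tau> + of_int (A $ 2 $ 2) = 0"
  have "Im (of_int (A $ 2 $ 1) * \<tau> + of_int (A $ 2 $ 2)) = of_int (A $ 2 $ 1) * Im \<tau>" by simp
  hence c: "A $ 2 $ 1 = 0" using 0 assms by simp
  hence "A $ 2 $ 2 = 0" using 0 by simp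
  thus False using c assms by (simp add: det_2)
qed

lemma Im_moebius:
  fixes A :: "int^2^2"
  assumes "det A > 0" "Im \<tau> > 0"
  shows "Im (moebius A \<tau>) = of_int (det A) * Im \<tau> / (norm (of_int (A $ 2 $ 1) * \<tau> + of_int (A $ 2 $ 2)))\<^sup>2"
  by (simp add: moebius_def Im_divide cmod_power2 det_2 algebra_simps)

lemma Im_moebius_pos:
  fixes A :: "int^2^2"
  assumes "det A > 0" "Im \<tau> > 0"
  shows "Im (moebius A \<tau>) > 0"
  using moebius_denom_nonzero[OF assms] assms by (subst Im_moebius[OF assms]) auto

lemma moebius_mult:
  assumes "det B > 0" "Im \<tau> > 0"
  shows "moebius (A ** B) \<tau> = moebius A (moebius B \<tau>)"
proof -
  define v where "v = of_int (B $ 2 $ 1) * \<tau> + of_int (B $ 2 $ 2)"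
  define u where "u = of_int (B $ 1 $ 1) * \<tau> + of_int (B $ 1 $ 2)"
  have v: "v \<noteq> 0" unfolding v_def by (rule moebius_denom_nonzero[OF assms])
  have "moebius A (moebius B \<tau>) = ((of_int (A $ 1 $ 1) * u + of_int (A $ 1 $ 2) * v) / v) /
      ((of_int (A $ 2 $ 1) * u + of_int (A $ 2 $ 2) * v) / v)"
    using v by (simp add: moebius_def u_def [symmetric] v_def [symmetric] add_divide_distrib)
  also have "\<dots> = (of_int (A $ 1 $ 1) * u + of_int (A $ 1 $ 2) * v) / (of_int (A $ 2 $ 1) * u + of_int (A $ 2 $ 2) * v)"
    using v by simp
  also have "\<dots> = moebius (A ** B) \<tau>"
    unfolding moebius_def mult_22_nth u_def v_def by (simp add: algebra_simps)
  finally show ?thesis ..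
qed

lemma moebius_mat_1 [simp]: "moebius (mat 1) \<tau> = \<tau>"
  by (simp add: moebius_def)

lemma moebius_mat22: "moebius (mat22 a b c d) \<tau> = (of_int a * \<tau> + of_int b) / (of_int c * \<tau> + of_int d)"
  by (simp add: moebius_def)

lemma hecke_eq:
  assumes p: "prime p" and \<tau>: "Im \<tau> > 0"
    and inv: "\<And>A w. A \<in> SL2Z \<Longrightarrow> Im w > 0 \<Longrightarrow> g (moebius A w) = g w"
  shows "hecke p g \<tau> = (\<Sum>r\<in>hecke_reps p. g (moebius r \<tau>))"
  unfolding hecke_def
proof (rule sum_left_quot[OF is_subgroup_SL2Z transversal_hecke_reps[OF p]])
  fix A x assume A: "A \<in> SL2Z" and x: "x \<in> int_mats_det (int p)"
  have d: "det x > 0" using x p by (simp add: int_mats_det_def prime_gt_0_nat)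
  show "g (moebius (A ** x) \<tau>) = g (moebius x \<tau>)"
    using inv[OF A Im_moebius_pos[OF d \<tau>]] moebius_mult[OF d \<tau>] by simp
qed

lemma sum_hecke_reps:
  fixes f :: "int^2^2 \<Rightarrow> complex"
  assumes p: "prime p"
  shows "(\<Sum>r\<in>hecke_reps p. f r) = f (mat22 (int p) 0 0 1) + (\<Sum>j\<in>{0..<int p}. f (mat22 1 j 0 (int p)))"
proof -
  have "mat22 (int p) 0 0 1 \<noteq> mat22 1 j 0 (int p)" for j
  proof
    assume "mat22 (int p) 0 0 1 = mat22 1 j 0 (int p)"
    hence "mat22 (int p) 0 0 1 $ 1 $ 1 = mat22 1 j 0 (int p) $ 1 $ 1" by (rule arg_cong)
    thus False using p by auto
  qed
  hence "mat22 (int p) 0 0 1 \<notin> (\<lambda>j. mat22 1 j 0 (int p)) ` {0..<int p}" by auto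
  moreover have "inj_on (\<lambda>j. mat22 1 j 0 (int p)) {0..<int p}"
    by (rule inj_onI) (metis mat22_nth(2))
  ultimately show ?thesis by (simp add: hecke_reps_def sum.reindex)
qed

section \<open>Hecke operators on the Poincare series\<close>

lemma has_sum_finite_sum:
  fixes f :: "'a \<Rightarrow> 'b \<Rightarrow> 'c :: topological_comm_monoid_add"
  assumes "finite J" "\<And>j. j \<in> J \<Longrightarrow> (f j has_sum S j) A"
  shows "((\<lambda>t. \<Sum>j\<in>J. f j t) has_sum (\<Sum>j\<in>J. S j)) A"
  using assms by (induction J rule: finite_induct) (auto intro!: has_sum_add)

lemma niebur_seed_add_real:
  "niebur_seed n s (w + of_real r) = niebur_seed n s w * e (- of_nat n * of_real r)"
  by (simp add: niebur_seed_def distrib_left e_add mult.assoc flip: e_add)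

lemma niebur_seed_add_int: "niebur_seed n s (w + of_int m) = niebur_seed n s w"
proof -
  have "e (- of_nat n * of_real (of_int m)) = 1" using e_of_int[of "- int n * m"] by simp
  thus ?thesis using niebur_seed_add_real[of n s w "of_int m"] by simp
qed

lemma niebur_seed_Gamma_inf:
  assumes g: "g \<in> Gamma_inf" and x: "det x > 0" and \<tau>: "Im \<tau> > 0"
  shows "niebur_seed n s (moebius (g ** x) \<tau>) = niebur_seed n s (moebius x \<tau>)"
proof -
  have "\<exists>m. moebius g w = w + of_int m" for w
    using g
  proof (cases rule: Gamma_inf_cases)
    case (1 m)
    thus ?thesis by (intro exI[of _ m]) (simp add: moebius_mat22)
  next
    case (2 m)
    thus ?thesis by (intro exI[of _ "- m"]) (simp add: moebius_mat22)
  qed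
  then obtain m where "moebius g (moebius x \<tau>) = moebius x \<tau> + of_int m" by blast
  thus ?thesis by (simp add: moebius_mult[OF x \<tau>] niebur_seed_add_int)
qed

lemma niebur_F_eq_infsum:
  assumes \<tau>: "Im \<tau> > 0" and T: "transversal Gamma_inf SL2Z T"
  shows "niebur_F n \<tau> s = of_real (2 * pi * sqrt (real n)) * (\<Sum>\<^sub>\<infinity>t\<in>T. niebur_seed n s (moebius t \<tau>))"
  unfolding niebur_F_def
  by (subst infsum_left_quot[OF is_subgroup_Gamma_inf T])
     (auto simp: int_mats_det_def intro!: niebur_seed_Gamma_inf \<tau>)

text \<open>Right multiplication by \<open>\<gamma>\<close> permutes the cosets. The equality is one
  of functions of \<open>s\<close>, so the choice in \<open>niebur_F_cont\<close> is the same at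
  both points and \<open>JJ1\<close> inherits the invariance.\<close>

lemma niebur_F_SL2Z:
  assumes \<tau>: "Im \<tau> > 0" and \<gamma>: "\<gamma> \<in> SL2Z"
  shows "niebur_F n (moebius \<gamma> \<tau>) = niebur_F n \<tau>"
proof
  fix s
  have d: "det \<gamma> > 0" using \<gamma> by (simp add: int_mats_det_def)
  have inj: "inj_on (\<lambda>t. t ** \<gamma>) cusp_reps"
    using d by (intro inj_onI) (metis mult_right_cancel_22 less_irrefl)
  have "(\<Sum>\<^sub>\<infinity>t\<in>cusp_reps. niebur_seed n s (moebius t (moebius \<gamma> \<tau>))) =
      (\<Sum>\<^sub>\<infinity>t\<in>(\<lambda>t. t ** \<gamma>) ` cusp_reps. niebur_seed n s (moebius t \<tau>))"
    by (subst infsum_reindex[OF inj]) (simp add: o_def moebius_mult[OF d \<tau>])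
  thus "niebur_F n (moebius \<gamma> \<tau>) s = niebur_F n \<tau> s"
    by (simp add: niebur_F_eq_infsum[OF Im_moebius_pos[OF d \<tau>] transversal_cusp_reps]
          niebur_F_eq_infsum[OF \<tau> transversal_mult_right[OF Gamma_inf_subset transversal_cusp_reps \<gamma>]])
qed

lemma niebur_seed_lower_row:
  assumes z: "(c, (x, y), k) \<in> lower_rows" and \<tau>: "Im \<tau> > 0"
  shows "niebur_seed n s (moebius (lower_row_rep (c, (x, y), k)) \<tau>) =
     ec c (- int n * y) * niebur_phi n \<tau> c s (of_int x / real c + of_int k)"
proof -
  have c: "c > 0" using z by simp
  define A where "A = lower_row_rep (c, (x, y), k)"
  define b where "b = A $ 1 $ 2"
  define d where "d = x + int c * k"
  have A: "A = mat22 y b (int c) d" by (intro mat22_eqI) (simp_all add: A_def b_def d_def lower_row_rep_def)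
  have "A \<in> SL2Z" unfolding A_def by (rule lower_row_rep_SL2Z[OF z])
  hence det: "y * d - b * int c = 1" by (simp add: A int_mats_det_def)
  have den: "of_nat c * \<tau> + of_int d \<noteq> 0"
    using moebius_denom_nonzero[of A \<tau>] \<tau> det by (simp add: A)
  have cd: "of_nat c * (of_nat c * \<tau> + of_int d) = of_nat c ^ 2 * (\<tau> + of_real (of_int x / real c + of_int k))"
    using c by (simp add: d_def power2_eq_square algebra_simps)
  have "moebius A \<tau> = (of_int y * \<tau> + of_int b) / (of_nat c * \<tau> + of_int d)"
    by (simp add: A moebius_mat22)
  also have "\<dots> = - 1 / (of_nat c * (of_nat c * \<tau> + of_int d)) + of_int y / of_nat c"
  proof -
    have "of_int y * of_int d - of_int b * of_nat c = (1 :: complex)"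
      using arg_cong[OF det, of "of_int :: int \<Rightarrow> complex"] by simp
    hence "(of_int y * \<tau> + of_int b) * of_nat c = - 1 + of_int y * (of_nat c * \<tau> + of_int d)"
      by (simp add: algebra_simps)
    hence "(of_int y * \<tau> + of_int b) / E = (- 1 + of_int y * E) / (of_nat c * E)"
      if "E = of_nat c * \<tau> + of_int d" for E
      using c that by (metis (no_types, lifting) mult.commute mult_divide_mult_cancel_left of_nat_eq_0_iff less_irrefl)
    hence "(of_int y * \<tau> + of_int b) / (of_nat c * \<tau> + of_int d) =
        (- 1 + of_int y * (of_nat c * \<tau> + of_int d)) / (of_nat c * (of_nat c * \<tau> + of_int d))" by blast
    thus ?thesis using c den by (simp add: diff_divide_distrib)
  qed
  also have "\<dots> = - 1 / (of_nat c ^ 2 * (\<tau> + of_real (of_int x / real c + of_int k))) + of_real (of_int y / real c)"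
    unfolding cd by simp
  finally have "niebur_seed n s (moebius A \<tau>) = niebur_phi n \<tau> c s (of_int x / real c + of_int k) * e (- of_nat n * of_real (of_int y / real c))"
    unfolding niebur_phi_def by (simp only: niebur_seed_add_real)
  also have "e (- of_nat n * of_real (of_int y / real c)) = ec c (- int n * y)"
    by (simp add: ec_def)
  finally show ?thesis by (simp add: A_def mult.commute)
qed

lemma niebur_seed_has_sum:
  assumes n: "n > 0" and \<tau>: "Im \<tau> > 0" and s: "Re s > 1"
  shows "((\<lambda>t. niebur_seed n s (moebius t \<tau>)) has_sum (niebur_seed n s \<tau> + (\<Sum>\<^sub>\<infinity>c\<in>{1..}. niebur_G n \<tau> c s))) cusp_reps"
proof -
  have "((\<lambda>t. niebur_seed n s (moebius t \<tau>)) has_sum (\<Sum>\<^sub>\<infinity>c\<in>{1..}. niebur_G n \<tau> c s)) (lower_row_rep ` lower_rows)"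
    unfolding has_sum_reindex[OF inj_on_lower_row_rep]
  proof (rule has_sum_cong[THEN iffD1, OF _ niebur_lower_row_sum[OF n \<tau> s]])
    fix z assume z: "z \<in> lower_rows"
    obtain c x y k where "z = (c, (x, y), k)" by (metis prod.exhaust)
    thus "(case z of (c, xa, xb) \<Rightarrow> (case xa of (x, y) \<Rightarrow> \<lambda>k. ec c (- int n * y) * niebur_phi n \<tau> c s (of_int x / real c + of_int k)) xb) =
       ((\<lambda>t. niebur_seed n s (moebius t \<tau>)) \<circ> lower_row_rep) z"
      using niebur_seed_lower_row[of c x y k \<tau> n s] z \<tau> by simp
  qed
  from has_sum_insert[OF mat_1_notin_lower_row_rep this] show ?thesis
    by (simp add: cusp_reps_def)
qed

lemma niebur_F_eq_ext:
  assumes "n > 0" "Im \<tau> > 0" "Re s > 1"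
  shows "niebur_F n \<tau> s = niebur_F_ext n \<tau> s"
  unfolding niebur_F_eq_infsum[OF assms(2) transversal_cusp_reps]
  using infsumI[OF niebur_seed_has_sum[OF assms]] by (simp add: niebur_F_ext_def[OF assms(1,2)])

lemma continues_to_1_niebur_F_ext:
  assumes "n > 0" "Im \<tau> > 0"
  shows "continues_to_1 (niebur_F n \<tau>) (niebur_F_ext n \<tau>)"
  unfolding continues_to_1_def
proof (intro conjI exI[of _ "{s. Re s > 15/16}"] allI impI)
  show "open {s. Re s > 15/16}" by (rule open_halfspace_Re_gt)
  show "niebur_F_ext n \<tau> holomorphic_on ({s. Re s > 1} \<union> {s. Re s > 15/16})"
    by (rule holomorphic_on_subset[OF holomorphic_niebur_F_ext[OF assms]]) auto
  show "niebur_F_ext n \<tau> s = niebur_F n \<tau> s" if "Re s > 1" for s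
    using niebur_F_eq_ext[OF assms that] by simp
qed simp

text \<open>The two neighbourhoods of 1 may differ, but their intersection contains a ball around 1.
  The ball is connected and meets \<open>Re s > 1\<close>, where both functions equal
  \<open>F\<close>.\<close>

lemma continues_to_1_deriv_unique:
  assumes "continues_to_1 F f" "continues_to_1 F g"
  shows "deriv f 1 = deriv g 1"
proof -
  obtain U where U: "open U" "1 \<in> U" "f holomorphic_on ({s. Re s > 1} \<union> U)" "\<And>s. Re s > 1 \<Longrightarrow> f s = F s"
    using assms(1) unfolding continues_to_1_def by blast
  obtain V where V: "open V" "1 \<in> V" "g holomorphic_on ({s. Re s > 1} \<union> V)" "\<And>s. Re s > 1 \<Longrightarrow> g s = F s"
    using assms(2) unfolding continues_to_1_def by blast
  obtain r where r: "r > 0" "ball 1 r \<subseteq> U \<inter> V"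
    using U V by (metis IntI open_Int open_contains_ball)
  have eq: "f z = g z" if "z \<in> ball 1 r" for z
  proof (rule analytic_continuation_open[of "ball 1 r \<inter> {s. Re s > 1}" "ball 1 r" f g])
    show "open (ball 1 r \<inter> {s. Re s > 1})" by (intro open_Int open_ball open_halfspace_Re_gt)
    have "1 + of_real (r / 2) \<in> ball 1 r \<inter> {s. Re s > 1}" using r by (simp add: dist_norm)
    thus "ball 1 r \<inter> {s. Re s > 1} \<noteq> {}" by blast
    show "f holomorphic_on ball 1 r" by (rule holomorphic_on_subset[OF U(3)]) (use r in auto)
    show "g holomorphic_on ball 1 r" by (rule holomorphic_on_subset[OF V(3)]) (use r in auto)
  qed (use that U(4) V(4) in auto)
  have "\<forall>\<^sub>F z in nhds 1. f z = g z"
    using eq r(1) by (intro eventually_nhds_in_open[of "ball 1 r", THEN eventually_mono]) auto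
  thus ?thesis by (rule deriv_cong_ev) simp
qed

lemma JJ1_eq_deriv:
  assumes "n > 0" "Im \<tau> > 0"
  shows "JJ1 n \<tau> = deriv (niebur_F_ext n \<tau>) 1"
proof -
  have "continues_to_1 (niebur_F n \<tau>) (niebur_F_cont n \<tau>)"
    unfolding niebur_F_cont_def by (rule someI[of _ "niebur_F_ext n \<tau>"]) (rule continues_to_1_niebur_F_ext[OF assms])
  from continues_to_1_deriv_unique[OF this continues_to_1_niebur_F_ext[OF assms]]
  show ?thesis using assms by (simp add: JJ1_def fps_expansion_def)
qed

lemma JJ1_SL2Z:
  assumes "n > 0" "Im \<tau> > 0" "\<gamma> \<in> SL2Z"
  shows "JJ1 n (moebius \<gamma> \<tau>) = JJ1 n \<tau>"
  using assms by (simp add: JJ1_def niebur_F_cont_def niebur_F_SL2Z)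

text \<open>\<open>n Im (p w) = (p n) Im w\<close>, and likewise for real parts, so only the square
  root of the imaginary part feels the scaling; the prefactor \<open>sqrt n\<close> of
  \<open>niebur_F\<close> compensates it.\<close>

lemma niebur_seed_scale_up:
  assumes "p > 0" "Im w > 0"
  shows "of_real (sqrt (real n)) * niebur_seed n s (of_nat p * w) = of_real (sqrt (real (p * n))) * niebur_seed (p * n) s w"
proof -
  have Re: "Re (of_nat p * w) = real p * Re w" and Im: "Im (of_nat p * w) = real p * Im w"
    by simp_all
  have "complex_of_real (sqrt (real n)) * of_real (sqrt (real p * Im w)) = of_real (sqrt (real (p * n))) * of_real (sqrt (Im w))"
    by (simp add: real_sqrt_mult mult_ac)
  thus ?thesis unfolding niebur_seed_def Re Im
    by (simp add: mult_ac) (simp add: mult.assoc [symmetric])?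
qed

lemma niebur_seed_scale_down:
  assumes "p > 0" "Im w > 0"
  shows "of_real (sqrt (real (p * m))) * niebur_seed (p * m) s (w / of_nat p) = of_real (sqrt (real m)) * niebur_seed m s w"
  using niebur_seed_scale_up[of p "w / of_nat p" m s] assms by simp

lemma hecke_niebur_F_ext:
  assumes p: "prime p" and n: "n > 0" and \<tau>: "Im \<tau> > 0" and s: "Re s > 1"
  shows "(\<Sum>r\<in>hecke_reps p. niebur_F_ext n (moebius r \<tau>) s) =
     niebur_F_ext (p * n) \<tau> s + (if p dvd n then of_nat p * niebur_F_ext (n div p) \<tau> s else 0)"
proof -
  define X where "X = int_mats_det (int p)"
  define f where "f = (\<lambda>A. niebur_seed n s (moebius A \<tau>))"
  have p0: "p > 0" using p by (simp add: prime_gt_0_nat)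
  have dX: "det A > 0" if "A \<in> X" for A using that p0 by (simp add: X_def int_mats_det_def)
  have dR: "det r > 0" if "r \<in> hecke_reps p" for r using hecke_reps_subset[OF p] that dX by (auto simp: X_def)
  have T: "cusp_reps \<subseteq> SL2Z" by (rule transversal_subset[OF transversal_cusp_reps])
  have dT: "det t > 0" if "t \<in> cusp_reps" for t using T that by (auto simp: int_mats_det_def)
  have finv: "f (g ** x) = f x" if "g \<in> Gamma_inf" "x \<in> X" for g x
    unfolding f_def using that dX \<tau> by (intro niebur_seed_Gamma_inf) auto
  define I where "I = hecke_reps p \<times> cusp_reps"
  have sum1: "((\<lambda>t. f (t ** r)) has_sum (niebur_seed n s (moebius r \<tau>) + (\<Sum>\<^sub>\<infinity>c\<in>{1..}. niebur_G n (moebius r \<tau>) c s))) cusp_reps"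
    if "r \<in> hecke_reps p" for r
    unfolding f_def moebius_mult[OF dR[OF that] \<tau>]
    by (rule niebur_seed_has_sum[OF n Im_moebius_pos[OF dR[OF that] \<tau>] s])
  have summable1: "(\<lambda>z. f (snd z ** fst z)) summable_on I"
  proof (rule abs_summable_summable)
    show "(\<lambda>z. norm (f (snd z ** fst z))) summable_on I"
      unfolding I_def
      by (rule iffD2[OF Infinite_Sum.abs_summable_on_Sigma_iff], intro conjI ballI)
         (use has_sum_imp_summable[OF sum1] finite_hecke_reps[OF p] in \<open>auto simp flip: summable_on_iff_abs_summable_on_complex\<close>)
  qed
  have inj1: "inj_on (\<lambda>z. snd z ** fst z) I" and tr1: "transversal Gamma_inf X ((\<lambda>z. snd z ** fst z) ` I)"
    using transversal_cusp_hecke[OF p] by (simp_all add: I_def X_def case_prod_unfold)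
  have inj2: "inj_on (\<lambda>z. fst z ** snd z) I" and tr2: "transversal Gamma_inf X ((\<lambda>z. fst z ** snd z) ` I)"
    using transversal_hecke_cusp[OF p] by (simp_all add: I_def X_def case_prod_unfold)
  \<comment> \<open>Convergence is known on the products \<open>t ** r\<close>; invariance of
    \<open>f\<close> carries it over to the products \<open>r ** t\<close>.\<close>
  have "f summable_on (\<lambda>z. snd z ** fst z) ` I"
    unfolding summable_on_reindex[OF inj1] using summable1 by (simp add: o_def)
  hence "f summable_on (\<lambda>z. fst z ** snd z) ` I"
    using summable_on_transversal_cong[OF is_subgroup_Gamma_inf tr1 finv]
      summable_on_transversal_cong[OF is_subgroup_Gamma_inf tr2 finv] by blast
  hence summable2: "(\<lambda>z. f (fst z ** snd z)) summable_on I"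
    unfolding summable_on_reindex[OF inj2] by (simp add: o_def)
  have slice2: "(\<lambda>t. f (r ** t)) summable_on cusp_reps" if "r \<in> hecke_reps p" for r
    using summable_on_SigmaD1[of "\<lambda>r t. f (r ** t)" "hecke_reps p" "\<lambda>_. cusp_reps", OF _ that] summable2
    by (simp add: I_def case_prod_unfold)
  have "(\<Sum>r\<in>hecke_reps p. \<Sum>\<^sub>\<infinity>t\<in>cusp_reps. f (t ** r)) = (\<Sum>\<^sub>\<infinity>z\<in>I. f (snd z ** fst z))"
    using infsum_Sigma_banach[of "\<lambda>z. f (snd z ** fst z)" "hecke_reps p" "\<lambda>_. cusp_reps"] summable1 finite_hecke_reps[OF p]
    by (simp add: I_def)
  also have "\<dots> = (\<Sum>\<^sub>\<infinity>A\<in>(\<lambda>z. snd z ** fst z) ` I. f A)"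
    by (subst infsum_reindex[OF inj1]) (simp add: o_def)
  also have "\<dots> = (\<Sum>\<^sub>\<infinity>A\<in>(\<lambda>z. fst z ** snd z) ` I. f A)"
    using infsum_left_quot[OF is_subgroup_Gamma_inf tr1 finv] infsum_left_quot[OF is_subgroup_Gamma_inf tr2 finv] by simp
  also have "\<dots> = (\<Sum>\<^sub>\<infinity>z\<in>I. f (fst z ** snd z))"
    by (subst infsum_reindex[OF inj2]) (simp add: o_def)
  also have "\<dots> = (\<Sum>r\<in>hecke_reps p. \<Sum>\<^sub>\<infinity>t\<in>cusp_reps. f (r ** t))"
    using infsum_Sigma_banach[of "\<lambda>z. f (fst z ** snd z)" "hecke_reps p" "\<lambda>_. cusp_reps"] summable2 finite_hecke_reps[OF p]
    by (simp add: I_def)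
  also have "\<dots> = (\<Sum>\<^sub>\<infinity>t\<in>cusp_reps. f (mat22 (int p) 0 0 1 ** t)) +
      (\<Sum>j\<in>{0..<int p}. \<Sum>\<^sub>\<infinity>t\<in>cusp_reps. f (mat22 1 j 0 (int p) ** t))"
    by (rule sum_hecke_reps[OF p])
  also have "(\<Sum>j\<in>{0..<int p}. \<Sum>\<^sub>\<infinity>t\<in>cusp_reps. f (mat22 1 j 0 (int p) ** t)) =
      (\<Sum>\<^sub>\<infinity>t\<in>cusp_reps. \<Sum>j\<in>{0..<int p}. f (mat22 1 j 0 (int p) ** t))"
    by (rule infsumI[OF has_sum_finite_sum, symmetric])
       (auto intro!: has_sum_infsum slice2 simp: hecke_reps_def)
  finally have main: "(\<Sum>r\<in>hecke_reps p. \<Sum>\<^sub>\<infinity>t\<in>cusp_reps. f (t ** r)) =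
     (\<Sum>\<^sub>\<infinity>t\<in>cusp_reps. f (mat22 (int p) 0 0 1 ** t)) +
     (\<Sum>\<^sub>\<infinity>t\<in>cusp_reps. \<Sum>j\<in>{0..<int p}. f (mat22 1 j 0 (int p) ** t))" .
  define K where "K = (\<lambda>m. complex_of_real (sqrt (real m)))"
  have Ft: "niebur_F_ext m \<tau> s = 2 * of_real pi * (\<Sum>\<^sub>\<infinity>t\<in>cusp_reps. K m * niebur_seed m s (moebius t \<tau>))" if "m > 0" for m
    using infsumI[OF niebur_seed_has_sum[OF that \<tau> s]]
    by (simp add: niebur_F_ext_def[OF that \<tau>] K_def infsum_cmult_right')
  have "(\<Sum>r\<in>hecke_reps p. niebur_F_ext n (moebius r \<tau>) s) =
      2 * of_real pi * K n * (\<Sum>r\<in>hecke_reps p. \<Sum>\<^sub>\<infinity>t\<in>cusp_reps. f (t ** r))"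
    unfolding sum_distrib_left
  proof (rule sum.cong[OF refl])
    fix r assume r: "r \<in> hecke_reps p"
    show "niebur_F_ext n (moebius r \<tau>) s = 2 * of_real pi * K n * (\<Sum>\<^sub>\<infinity>t\<in>cusp_reps. f (t ** r))"
      unfolding infsumI[OF sum1[OF r]]
      by (simp add: niebur_F_ext_def[OF n Im_moebius_pos[OF dR[OF r] \<tau>]] K_def)
  qed
  also have "\<dots> = 2 * of_real pi * (\<Sum>\<^sub>\<infinity>t\<in>cusp_reps. K n * f (mat22 (int p) 0 0 1 ** t)) +
     2 * of_real pi * (\<Sum>\<^sub>\<infinity>t\<in>cusp_reps. K n * (\<Sum>j\<in>{0..<int p}. f (mat22 1 j 0 (int p) ** t)))"
    unfolding main infsum_cmult_right' by (simp add: distrib_left mult.assoc)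
  also have "(\<Sum>\<^sub>\<infinity>t\<in>cusp_reps. K n * f (mat22 (int p) 0 0 1 ** t)) =
      (\<Sum>\<^sub>\<infinity>t\<in>cusp_reps. K (p * n) * niebur_seed (p * n) s (moebius t \<tau>))"
  proof (rule infsum_cong)
    fix t assume t: "t \<in> cusp_reps"
    have "f (mat22 (int p) 0 0 1 ** t) = niebur_seed n s (of_nat p * moebius t \<tau>)"
      by (simp add: f_def moebius_mult[OF dT[OF t] \<tau>] moebius_mat22)
    thus "K n * f (mat22 (int p) 0 0 1 ** t) = K (p * n) * niebur_seed (p * n) s (moebius t \<tau>)"
      using niebur_seed_scale_up[OF p0 Im_moebius_pos[OF dT[OF t] \<tau>], of n s] by (simp add: K_def)
  qed
  also have "2 * of_real pi * \<dots> = niebur_F_ext (p * n) \<tau> s" using n p0 by (subst Ft) auto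
  also have "2 * of_real pi * (\<Sum>\<^sub>\<infinity>t\<in>cusp_reps. K n * (\<Sum>j\<in>{0..<int p}. f (mat22 1 j 0 (int p) ** t))) =
     (if p dvd n then of_nat p * niebur_F_ext (n div p) \<tau> s else 0)"
  proof -
    \<comment> \<open>Translation by \<open>j / p\<close> multiplies the seed by
      \<open>e(- n j / p)\<close>. The sum of these over \<open>j\<close> is \<open>p\<close> if
      \<open>p\<close> divides \<open>n\<close> and 0 otherwise, which produces both the factor
      \<open>p\<close> and the convention for \<open>n / p\<close>.\<close>
    have shift: "(\<Sum>j\<in>{0..<int p}. f (mat22 1 j 0 (int p) ** t)) =
        (if p dvd n then of_nat p * niebur_seed n s (moebius t \<tau> / of_nat p) else 0)" if t: "t \<in> cusp_reps" for t
    proof -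
      have "f (mat22 1 j 0 (int p) ** t) = niebur_seed n s (moebius t \<tau> / of_nat p) * ec p (j * (- int n))" for j
      proof -
        have "f (mat22 1 j 0 (int p) ** t) = niebur_seed n s (moebius t \<tau> / of_nat p + of_real (of_int j / real p))"
          by (simp add: f_def moebius_mult[OF dT[OF t] \<tau>] moebius_mat22 add_divide_distrib)
        thus ?thesis unfolding niebur_seed_add_real by (simp add: ec_def mult.commute)
      qed
      hence "(\<Sum>j\<in>{0..<int p}. f (mat22 1 j 0 (int p) ** t)) =
          niebur_seed n s (moebius t \<tau> / of_nat p) * (\<Sum>j\<in>{0..<int p}. ec p (j * (- int n)))"
        by (simp add: sum_distrib_left)
      thus ?thesis unfolding sum_ec[OF p0] by simp
    qed
    show ?thesis
    proof (cases "p dvd n")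
      case True
      then obtain m where m: "n = p * m" by blast
      hence m0: "m > 0" "n div p = m" using n p0 by auto
      have "(\<Sum>\<^sub>\<infinity>t\<in>cusp_reps. K n * (\<Sum>j\<in>{0..<int p}. f (mat22 1 j 0 (int p) ** t))) =
        (\<Sum>\<^sub>\<infinity>t\<in>cusp_reps. of_nat p * (K m * niebur_seed m s (moebius t \<tau>)))"
      proof (rule infsum_cong)
        fix t assume t: "t \<in> cusp_reps"
        show "K n * (\<Sum>j\<in>{0..<int p}. f (mat22 1 j 0 (int p) ** t)) = of_nat p * (K m * niebur_seed m s (moebius t \<tau>))"
          using niebur_seed_scale_down[OF p0 Im_moebius_pos[OF dT[OF t] \<tau>], of m s]
          unfolding shift[OF t] by (simp add: K_def m)
      qed
      thus ?thesis using Ft[OF m0(1)] True m0(2) by (simp add: infsum_cmult_right')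
    next
      case False
      thus ?thesis using shift by (simp cong: infsum_cong)
    qed
  qed
  finally show ?thesis .
qed

lemma hecke_JJ1_pos:
  assumes p: "prime p" and n: "n > 0" and \<tau>: "Im \<tau> > 0"
  shows "hecke p (JJ1 n) \<tau> = JJ1 (p * n) \<tau> + of_nat p * JJ1_quot n p \<tau>"
proof -
  have p0: "p > 0" using p by (simp add: prime_gt_0_nat)
  \<comment> \<open>A connected domain common to all functions in the relation, containing 1 as well
    as the region where the series converge absolutely.\<close>
  define H where "H = {s. Re s > 15/16}"
  have H: "open H" "connected H" "1 \<in> H" unfolding H_def
    by (auto simp only: open_halfspace_Re_gt convex_halfspace_Re_gt convex_connected) simp
  have \<tau>r: "Im (moebius r \<tau>) > 0" if "r \<in> hecke_reps p" for r
    using hecke_reps_subset[OF p] that p0 \<tau> by (intro Im_moebius_pos) (auto simp: int_mats_det_def)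
  define L where "L = (\<lambda>s. \<Sum>r\<in>hecke_reps p. niebur_F_ext n (moebius r \<tau>) s)"
  define Q where "Q = (\<lambda>s. if p dvd n then of_nat p * niebur_F_ext (n div p) \<tau> s else 0)"
  have pn: "p * n > 0" using p0 n by simp
  have np: "n div p > 0" if "p dvd n" using that n p0 by (auto elim!: dvdE)
  have hol: "niebur_F_ext m w holomorphic_on H" if "m > 0" "Im w > 0" for m w
    unfolding H_def by (rule holomorphic_niebur_F_ext[OF that])
  have L: "L holomorphic_on H" unfolding L_def using hol n \<tau>r by (intro holomorphic_intros) auto
  have Q: "Q holomorphic_on H" unfolding Q_def using hol np \<tau> by (cases "p dvd n") (auto intro!: holomorphic_intros)
  have "L s = niebur_F_ext (p * n) \<tau> s + Q s" if "s \<in> H" for s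
  proof (rule analytic_continuation_open[of "{s. Re s > 1}" H L "\<lambda>s. niebur_F_ext (p * n) \<tau> s + Q s"])
    show "open {s. Re s > 1}" by (rule open_halfspace_Re_gt)
    have "(2::complex) \<in> {s. Re s > 1}" by simp
    thus "{s. Re s > 1} \<noteq> {}" by blast
    show "{s. Re s > 1} \<subseteq> H" by (auto simp: H_def)
    show "L s = niebur_F_ext (p * n) \<tau> s + Q s" if "s \<in> {s. Re s > 1}" for s
      using hecke_niebur_F_ext[OF p n \<tau>, of s] that by (simp add: L_def Q_def)
  qed (use H L Q hol[OF pn \<tau>] that in \<open>auto intro!: holomorphic_intros\<close>)
  hence "\<forall>\<^sub>F s in nhds 1. L s = niebur_F_ext (p * n) \<tau> s + Q s"
    using H by (intro eventually_nhds_in_open[of H, THEN eventually_mono]) auto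
  hence "deriv L 1 = deriv (\<lambda>s. niebur_F_ext (p * n) \<tau> s + Q s) 1" by (rule deriv_cong_ev) simp
  moreover have fd: "g field_differentiable at 1" if "g holomorphic_on H" for g
    using that H by (metis holomorphic_on_imp_differentiable_at)
  have "deriv (\<lambda>s. niebur_F_ext (p * n) \<tau> s + Q s) 1 = deriv (niebur_F_ext (p * n) \<tau>) 1 + deriv Q 1"
    by (rule deriv_add[OF fd[OF hol[OF pn \<tau>]] fd[OF Q]])
  moreover have "deriv Q 1 = of_nat p * JJ1_quot n p \<tau>"
  proof (cases "p dvd n")
    case True
    have "deriv (\<lambda>s. of_nat p * niebur_F_ext (n div p) \<tau> s) 1 = of_nat p * deriv (niebur_F_ext (n div p) \<tau>) 1"
      by (rule deriv_cmult[OF fd[OF hol[OF np[OF True] \<tau>]]])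
    thus ?thesis using True np[OF True] \<tau> by (simp add: Q_def JJ1_quot_def JJ1_eq_deriv)
  qed (simp add: Q_def JJ1_quot_def)
  moreover have "deriv L 1 = (\<Sum>r\<in>hecke_reps p. deriv (niebur_F_ext n (moebius r \<tau>)) 1)"
    unfolding L_def
    by (intro DERIV_imp_deriv DERIV_sum field_differentiable_derivI fd hol n \<tau>r)
  ultimately have "(\<Sum>r\<in>hecke_reps p. JJ1 n (moebius r \<tau>)) = JJ1 (p * n) \<tau> + of_nat p * JJ1_quot n p \<tau>"
    using JJ1_eq_deriv[OF n \<tau>r] JJ1_eq_deriv[OF pn \<tau>] by simp
  moreover have "hecke p (JJ1 n) \<tau> = (\<Sum>r\<in>hecke_reps p. JJ1 n (moebius r \<tau>))"
    by (rule hecke_eq[OF p \<tau>]) (simp add: JJ1_SL2Z n)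
  ultimately show ?thesis by simp
qed

section \<open>Limits of series over the integers\<close>

text \<open>Dominated convergence as an exchange of limits: by the Weierstrass test the finite
  partial sums converge uniformly in \<open>k\<close>.\<close>

lemma tendsto_infsum_dominated:
  fixes f :: "nat \<Rightarrow> 'a \<Rightarrow> real"
  assumes lim: "\<And>i. i \<in> I \<Longrightarrow> (\<lambda>k. f k i) \<longlonglongrightarrow> g i"
    and le: "\<And>k i. i \<in> I \<Longrightarrow> \<bar>f k i\<bar> \<le> M i" and M: "M summable_on I"
  shows "g summable_on I" "(\<lambda>k. \<Sum>\<^sub>\<infinity>i\<in>I. f k i) \<longlonglongrightarrow> (\<Sum>\<^sub>\<infinity>i\<in>I. g i)"
proof -
  have "\<bar>g i\<bar> \<le> M i" if "i \<in> I" for i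
    by (rule tendsto_upperbound[OF tendsto_rabs[OF lim[OF that]]]) (use le that in auto)
  hence "(\<lambda>i. norm (g i)) summable_on I"
    by (intro summable_on_comparison_test[OF M]) auto
  thus g: "g summable_on I" by (rule abs_summable_summable)
  show "(\<lambda>k. \<Sum>\<^sub>\<infinity>i\<in>I. f k i) \<longlonglongrightarrow> (\<Sum>\<^sub>\<infinity>i\<in>I. g i)"
  proof (rule swap_uniform_limit'[where F = "finite_subsets_at_top I" and S = UNIV and f = "\<lambda>X k. \<Sum>i\<in>X. f k i" and g = "\<lambda>X. \<Sum>i\<in>X. g i"])
    show "((\<lambda>X. \<Sum>i\<in>X. g i) \<longlongrightarrow> (\<Sum>\<^sub>\<infinity>i\<in>I. g i)) (finite_subsets_at_top I)"
      using has_sum_infsum[OF g] unfolding has_sum_def .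
    show "uniform_limit UNIV (\<lambda>X k. \<Sum>i\<in>X. f k i) (\<lambda>k. \<Sum>\<^sub>\<infinity>i\<in>I. f k i) (finite_subsets_at_top I)"
      by (rule Weierstrass_m_test_general[OF _ M]) (use le in auto)
    show "\<forall>\<^sub>F X in finite_subsets_at_top I. ((\<lambda>k. \<Sum>i\<in>X. f k i) \<longlonglongrightarrow> (\<Sum>i\<in>X. g i))"
      by (rule eventually_finite_subsets_at_top_weakI) (auto intro!: tendsto_sum lim)
  qed auto
qed

text \<open>Pairing \<open>n\<close> with \<open>- 1 - n\<close> lets the partial sums run over the
  consecutive integers from \<open>- m\<close> to \<open>m - 1\<close>, on which differences
  telescope. The cotangent expansion is arranged in the same pairs.\<close>

lemma infsum_int_LIMSEQ:
  fixes f :: "int \<Rightarrow> real"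
  assumes "f summable_on UNIV"
  shows "(\<lambda>m. \<Sum>n<m. f (int n) + f (- 1 - int n)) \<longlonglongrightarrow> (\<Sum>\<^sub>\<infinity>d. f d)"
proof -
  have s: "f summable_on {0..}" "f summable_on {..<0}" using assms by (auto intro: summable_on_subset)
  have "(f has_sum (infsum f {0..})) {0..} \<longleftrightarrow> ((\<lambda>n. f (int n)) has_sum (infsum f {0..})) UNIV"
    by (rule has_sum_reindex_bij_witness[of _ int nat]) auto
  hence 1: "(\<lambda>n. f (int n)) sums infsum f {0..}" using s by (intro has_sum_imp_sums) simp
  have "(f has_sum (infsum f {..<0})) {..<0} \<longleftrightarrow> ((\<lambda>n. f (- 1 - int n)) has_sum (infsum f {..<0})) UNIV"
    by (rule has_sum_reindex_bij_witness[of _ "\<lambda>n. - 1 - int n" "\<lambda>d. nat (- 1 - d)"]) auto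
  hence 2: "(\<lambda>n. f (- 1 - int n)) sums infsum f {..<0}" using s by (intro has_sum_imp_sums) simp
  have "{0..} \<union> {..<0} = (UNIV :: int set)" by auto
  moreover have "infsum f ({0..} \<union> {..<0}) = infsum f {0..} + infsum f {..<0}"
    by (rule infsum_Un_disjoint[OF s]) auto
  ultimately show ?thesis using sums_add[OF 1 2] by (simp add: sums_def)
qed

text \<open>The derivative of the reflection formula
  \<open>\<Gamma>(z) \<Gamma>(1 - z) = pi / sin (pi z)\<close> expresses the cotangent as a
  difference of two Digamma values; in the difference of their limit formulas the logarithms
  cancel.\<close>

lemma cot_partial_fractions:
  fixes z :: complex
  assumes z: "Im z \<noteq> 0"
  shows "(\<lambda>m. \<Sum>n<m. 1 / (z + of_nat n) + 1 / (z - 1 - of_nat n)) \<longlonglongrightarrow> of_real pi * cos (of_real pi * z) / sin (of_real pi * z)"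
proof -
  have zi: "w \<notin> \<int>" if "Im w \<noteq> 0" for w :: complex using that by (auto elim!: Ints_cases)
  have nZ: "w \<notin> \<int>\<^sub>\<le>\<^sub>0" if "Im w \<noteq> 0" for w :: complex using zi[OF that] nonpos_Ints_Int by blast
  have z1: "Im (1 - z) \<noteq> 0" using z by simp
  have sin0: "sin (of_real pi * w) \<noteq> 0" if "Im w \<noteq> 0" for w :: complex
  proof
    assume "sin (of_real pi * w) = 0"
    then obtain k :: int where "of_real pi * w = of_real (of_int k * pi)" by (auto simp: sin_eq_0)
    hence "Im (of_real pi * w) = 0" by simp
    thus False using that by simp
  qed
  have d1: "((\<lambda>w. Gamma w * Gamma (1 - w)) has_field_derivative
      Gamma z * Digamma z * Gamma (1 - z) - Gamma z * (Gamma (1 - z) * Digamma (1 - z))) (at z)"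
    by (auto intro!: derivative_eq_intros nZ z z1 simp: algebra_simps)
  have d2: "((\<lambda>w. of_real pi / sin (of_real pi * w)) has_field_derivative
      - (of_real pi * (of_real pi * cos (of_real pi * z))) / (sin (of_real pi * z))\<^sup>2) (at z)"
    using sin0[OF z] by (auto intro!: derivative_eq_intros simp: power2_eq_square field_simps)
  have "((\<lambda>w. Gamma w * Gamma (1 - w)) has_field_derivative
      - (of_real pi * (of_real pi * cos (of_real pi * z))) / (sin (of_real pi * z))\<^sup>2) (at z)"
    using d2 by (simp add: Gamma_reflection_complex)
  from DERIV_unique[OF d1 this]
  have "Gamma z * Gamma (1 - z) * (Digamma z - Digamma (1 - z)) =
      - (of_real pi * (of_real pi * cos (of_real pi * z))) / (sin (of_real pi * z))\<^sup>2"
    by (simp add: algebra_simps)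
  then have eq: "Digamma (1 - z) - Digamma z = of_real pi * cos (of_real pi * z) / sin (of_real pi * z)"
  proof -
    define S where "S = sin (of_real pi * z)"
    assume h: "Gamma z * Gamma (1 - z) * (Digamma z - Digamma (1 - z)) =
        - (of_real pi * (of_real pi * cos (of_real pi * z))) / (sin (of_real pi * z))\<^sup>2"
    have "(of_real pi / S) * (Digamma (1 - z) - Digamma z) = - ((of_real pi / S) * (Digamma z - Digamma (1 - z)))"
      by (simp add: right_diff_distrib)
    also have "\<dots> = of_real pi * (of_real pi * cos (of_real pi * z)) / S\<^sup>2"
      using h unfolding Gamma_reflection_complex S_def [symmetric] by simp
    also have "\<dots> = (of_real pi / S) * (of_real pi * cos (of_real pi * z) / S)"
      by (simp add: power2_eq_square)
    finally have "(of_real pi / S) * (Digamma (1 - z) - Digamma z) = (of_real pi / S) * (of_real pi * cos (of_real pi * z) / S)" .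
    moreover have "of_real pi / S \<noteq> 0" using sin0[OF z] by (simp add: S_def)
    ultimately show ?thesis unfolding S_def [symmetric] by (metis mult_left_cancel)
  qed
  have "z \<noteq> 0" "1 - z \<noteq> 0" using z z1 by auto
  from tendsto_diff[OF Digamma_LIMSEQ[OF this(2)] Digamma_LIMSEQ[OF this(1)]]
  have "(\<lambda>m. (\<Sum>n<m. inverse (z + of_nat n)) - (\<Sum>n<m. inverse (1 - z + of_nat n))) \<longlonglongrightarrow> Digamma (1 - z) - Digamma z"
    by simp
  also have "(\<lambda>m. (\<Sum>n<m. inverse (z + of_nat n)) - (\<Sum>n<m. inverse (1 - z + of_nat n))) =
      (\<lambda>m. \<Sum>n<m. 1 / (z + of_nat n) + 1 / (z - 1 - of_nat n))"
  proof
    fix m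
    have "inverse (1 - z + of_nat n) = - (1 / (z - 1 - of_nat n))" for n
      by (simp add: divide_inverse flip: inverse_minus_eq)
    thus "(\<Sum>n<m. inverse (z + of_nat n)) - (\<Sum>n<m. inverse (1 - z + of_nat n)) =
      (\<Sum>n<m. 1 / (z + of_nat n) + 1 / (z - 1 - of_nat n))"
      by (simp add: sum.distrib sum_negf divide_inverse)
  qed
  finally show ?thesis unfolding eq .
qed

lemma cot_conv_e:
  assumes z: "Im z > 0"
  shows "cos (of_real pi * z) / sin (of_real pi * z) = - \<i> * ((1 + e z) / (1 - e z))" and "norm (e z) < 1"
proof -
  define u where "u = exp (\<i> * (of_real pi * z))"
  have u: "u \<noteq> 0" by (simp add: u_def)
  have eu: "e z = u ^ 2" by (simp add: e_def u_def exp_double [symmetric] mult_ac)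
  have "norm (e z) = exp (- 2 * pi * Im z)" by (simp add: e_def norm_exp_eq_Re)
  thus n: "norm (e z) < 1" using z by simp
  hence e1: "e z \<noteq> 1" by auto
  have c: "cos (of_real pi * z) = (u + 1 / u) / 2" and s: "sin (of_real pi * z) = (u - 1 / u) / (2 * \<i>)"
    by (simp_all add: cos_exp_eq sin_exp_eq u_def exp_minus field_simps)
  have "cos (of_real pi * z) = (1 + e z) / (2 * u)" "sin (of_real pi * z) = \<i> * (1 - e z) / (2 * u)"
    unfolding c s eu using u by (simp_all add: field_simps power2_eq_square)
  hence "cos (of_real pi * z) / sin (of_real pi * z) = (1 + e z) / (\<i> * (1 - e z))"
    using u by simp
  also have "\<dots> = (1 / \<i>) * ((1 + e z) / (1 - e z))" by (simp only: times_divide_times_eq mult_1_left)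
  also have "1 / \<i> = - \<i>" by simp
  finally show "cos (of_real pi * z) / sin (of_real pi * z) = - \<i> * ((1 + e z) / (1 - e z))" .
qed

text \<open>\<open>1 / \<bar>w\<bar>^2 = - Im (1 / w) / Im w\<close>, and all
  \<open>w = z + d\<close> share the imaginary part of \<open>z\<close>, so the sum is an imaginary
  part of the cotangent expansion.\<close>

lemma infsum_inverse_norm_square:
  fixes z :: complex
  assumes z: "Im z > 0" and sm: "(\<lambda>d::int. 1 / (norm (z + of_int d))\<^sup>2) summable_on UNIV"
  shows "(\<Sum>\<^sub>\<infinity>d::int. 1 / (norm (z + of_int d))\<^sup>2) = pi / Im z * (1 + 2 * Re (e z / (1 - e z)))"
proof -
  define w where "w = e z / (1 - e z)"
  have tm: "- Im (1 / w) / Im z = 1 / (norm w)\<^sup>2" if "Im w = Im z" for w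
  proof -
    have "Im (1 / w) = - Im w / (norm w)\<^sup>2" by (simp add: Im_divide cmod_power2)
    thus ?thesis using that z by simp
  qed
  have "(\<lambda>m. - Im (\<Sum>n<m. 1 / (z + of_nat n) + 1 / (z - 1 - of_nat n)) / Im z)
      \<longlonglongrightarrow> - Im (of_real pi * cos (of_real pi * z) / sin (of_real pi * z)) / Im z"
    using z by (intro tendsto_intros cot_partial_fractions) auto
  also have "(\<lambda>m. - Im (\<Sum>n<m. 1 / (z + of_nat n) + 1 / (z - 1 - of_nat n)) / Im z) =
      (\<lambda>m. \<Sum>n<m. 1 / (norm (z + of_int (int n)))\<^sup>2 + 1 / (norm (z + of_int (- 1 - int n)))\<^sup>2)"
  proof
    fix m
    have "- Im (1 / (z + of_nat n) + 1 / (z - 1 - of_nat n)) / Im z =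
        1 / (norm (z + of_int (int n)))\<^sup>2 + 1 / (norm (z + of_int (- 1 - int n)))\<^sup>2" for n
    proof -
      have "- Im (1 / (z + of_nat n) + 1 / (z - 1 - of_nat n)) / Im z =
          - Im (1 / (z + of_nat n)) / Im z + - Im (1 / (z - 1 - of_nat n)) / Im z"
        unfolding plus_complex.sel by (simp add: diff_divide_distrib)
      also have "\<dots> = 1 / (norm (z + of_nat n))\<^sup>2 + 1 / (norm (z - 1 - of_nat n))\<^sup>2"
        by (subst (1 2) tm) auto
      finally show ?thesis by (simp add: algebra_simps)
    qed
    hence "(\<Sum>n<m. - Im (1 / (z + of_nat n) + 1 / (z - 1 - of_nat n)) / Im z) =
        (\<Sum>n<m. 1 / (norm (z + of_int (int n)))\<^sup>2 + 1 / (norm (z + of_int (- 1 - int n)))\<^sup>2)" by simp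
    thus "- Im (\<Sum>n<m. 1 / (z + of_nat n) + 1 / (z - 1 - of_nat n)) / Im z =
        (\<Sum>n<m. 1 / (norm (z + of_int (int n)))\<^sup>2 + 1 / (norm (z + of_int (- 1 - int n)))\<^sup>2)"
      unfolding Im_sum sum_negf [symmetric] sum_divide_distrib .
  qed
  finally have "(\<Sum>\<^sub>\<infinity>d::int. 1 / (norm (z + of_int d))\<^sup>2) = - Im (of_real pi * cos (of_real pi * z) / sin (of_real pi * z)) / Im z"
    using infsum_int_LIMSEQ[OF sm] LIMSEQ_unique by blast
  also have "of_real pi * cos (of_real pi * z) / sin (of_real pi * z) = of_real pi * (- \<i> * ((1 + e z) / (1 - e z)))"
    by (simp only: cot_conv_e(1)[OF z] times_divide_eq_right [symmetric])
  also have "(1 + e z) / (1 - e z) = 1 + 2 * w"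
  proof -
    have "e z \<noteq> 1" using cot_conv_e(2)[OF z] by auto
    hence "1 - e z \<noteq> 0" by simp
    thus ?thesis by (simp add: field_simps w_def)
  qed
  finally show ?thesis using z by (simp add: w_def [symmetric])
qed

text \<open>The primitive of \<open>(1 + t^2)^(- s)\<close> after the substitution
  \<open>t = tan \<theta>\<close>. The line becomes a finite interval, so the total integral is the
  value at \<open>pi/2\<close> and the limit \<open>s \<rightarrow> 1\<close> is a bounded
  convergence problem.\<close>

definition kron_prim :: "real \<Rightarrow> real \<Rightarrow> real" where
  "kron_prim s b = integral {-(pi/2)..b} (\<lambda>\<theta>. cos \<theta> powr (2 * s - 2))"

context
  fixes s :: real
  assumes s: "s > 1"
begin

lemma continuous_on_cos_powr: "continuous_on {-(pi/2)..pi/2} (\<lambda>\<theta>. cos \<theta> powr (2 * s - 2))"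
  using s by (intro continuous_on_powr' continuous_intros) (auto simp: cos_ge_zero)

lemma kron_prim_has_derivative:
  "((\<lambda>t. kron_prim s (arctan t)) has_real_derivative (1 + t\<^sup>2) powr (- s)) (at t)"
proof -
  have at: "- (pi/2) < arctan t" "arctan t < pi/2" using arctan_lbound arctan_ubound by auto
  have "(kron_prim s has_real_derivative cos (arctan t) powr (2 * s - 2)) (at (arctan t) within {-(pi/2)..pi/2})"
    unfolding kron_prim_def using at by (intro integral_has_real_derivative continuous_on_cos_powr) auto
  hence "(kron_prim s has_real_derivative cos (arctan t) powr (2 * s - 2)) (at (arctan t))"
    using at by (simp add: at_within_Icc_at)
  from DERIV_chain2[OF this DERIV_arctan]
  have "((\<lambda>t. kron_prim s (arctan t)) has_real_derivative cos (arctan t) powr (2 * s - 2) * inverse (1 + t\<^sup>2)) (at t)" .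
  also have "cos (arctan t) powr (2 * s - 2) * inverse (1 + t\<^sup>2) = (1 + t\<^sup>2) powr (- s)"
  proof -
    have p: "1 + t\<^sup>2 > 0" by (simp add: add_pos_nonneg)
    have "cos (arctan t) = (1 + t\<^sup>2) powr (- 1/2)"
      using p by (simp add: cos_arctan powr_half_sqrt [symmetric] powr_minus_divide)
    hence "cos (arctan t) powr (2 * s - 2) = (1 + t\<^sup>2) powr (1 - s)"
      by (simp add: powr_powr algebra_simps)
    moreover have "inverse (1 + t\<^sup>2) = (1 + t\<^sup>2) powr (-1)" using p by (simp add: powr_minus)
    moreover have "(1 + t\<^sup>2) powr (- s) = (1 + t\<^sup>2) powr (1 - s) * (1 + t\<^sup>2) powr (-1)"
      by (subst powr_add [symmetric]) simp
    ultimately show ?thesis by (simp only:)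
  qed
  finally show ?thesis .
qed

lemma kron_prim_at_top: "((\<lambda>t. kron_prim s (arctan t)) \<longlongrightarrow> kron_prim s (pi/2)) at_top"
  and kron_prim_at_bot: "((\<lambda>t. kron_prim s (arctan t)) \<longlongrightarrow> 0) at_bot"
proof -
  have "continuous_on {-(pi/2)..pi/2} (kron_prim s)"
    unfolding kron_prim_def [abs_def]
    by (intro indefinite_integral_continuous_1 integrable_continuous_real continuous_on_cos_powr)
  hence c: "(kron_prim s \<longlongrightarrow> kron_prim s x) (at x within {-(pi/2)..pi/2})" if "x \<in> {-(pi/2)..pi/2}" for x
    using that by (simp add: continuous_on_def)
  have rng: "arctan t \<in> {-(pi/2)..pi/2} \<and> arctan t \<noteq> pi/2 \<and> arctan t \<noteq> -(pi/2)" for t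
    using arctan_lbound[of t] arctan_ubound[of t] by auto
  have "filterlim arctan (at (pi/2) within {-(pi/2)..pi/2}) at_top"
    using tendsto_arctan_at_top rng by (auto simp: filterlim_at)
  from filterlim_compose[OF c this] show "((\<lambda>t. kron_prim s (arctan t)) \<longlongrightarrow> kron_prim s (pi/2)) at_top" by simp
  have "filterlim arctan (at (-(pi/2)) within {-(pi/2)..pi/2}) at_bot"
    using tendsto_arctan_at_bot rng by (auto simp: filterlim_at)
  from filterlim_compose[OF c this] show "((\<lambda>t. kron_prim s (arctan t)) \<longlongrightarrow> 0) at_bot"
    by (simp add: kron_prim_def)
qed

end

text \<open>The limit \<open>s \<rightarrow> 1\<close> is taken along one concrete sequence in
  \<open>(1, 2]\<close>, the form that dominated convergence handles.\<close>

definition s_seq :: "nat \<Rightarrow> real" where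
  "s_seq k = 1 + 1 / real (Suc k)"

lemma s_seq_gt: "s_seq k > 1" and s_seq_le: "s_seq k \<le> 2"
  by (auto simp: s_seq_def)

lemma s_seq_tendsto: "s_seq \<longlonglongrightarrow> 1"
  using LIMSEQ_inverse_real_of_nat_add[of 1] by (simp add: s_seq_def [abs_def] divide_inverse)

lemma kron_prim_tendsto:
  assumes b: "b \<in> {-(pi/2)..pi/2}"
  shows "(\<lambda>k. kron_prim (s_seq k) b) \<longlonglongrightarrow> b + pi/2"
proof -
  \<comment> \<open>Where the cosine vanishes, \<open>0 powr a = 0\<close> for every exponent, so
    the pointwise limit is 0 there; it equals 1 off the endpoints.\<close>
  define h where "h = (\<lambda>\<theta>::real. if cos \<theta> = 0 then 0 else 1 :: real)"
  have "(\<lambda>k. integral {-(pi/2)..b} (\<lambda>\<theta>. cos \<theta> powr (2 * s_seq k - 2))) \<longlonglongrightarrow> integral {-(pi/2)..b} h"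
  proof (rule dominated_convergence(2))
    show "(\<lambda>\<theta>. cos \<theta> powr (2 * s_seq k - 2)) integrable_on {-(pi/2)..b}" for k
      using b by (intro integrable_continuous_real continuous_on_subset[OF continuous_on_cos_powr[OF s_seq_gt]]) auto
    show "(\<lambda>_. 1 :: real) integrable_on {-(pi/2)..b}" by (rule integrable_const_ivl)
    show "norm (cos \<theta> powr (2 * s_seq k - 2)) \<le> 1" if "\<theta> \<in> {-(pi/2)..b}" for k \<theta>
      using that b s_seq_gt[of k] by (simp add: powr_le1 cos_ge_zero)
    show "(\<lambda>k. cos \<theta> powr (2 * s_seq k - 2)) \<longlonglongrightarrow> h \<theta>" if "\<theta> \<in> {-(pi/2)..b}" for \<theta>
    proof (cases "cos \<theta> = 0")
      case False
      have "(\<lambda>k. cos \<theta> powr (2 * s_seq k - 2)) \<longlonglongrightarrow> cos \<theta> powr (2 * 1 - 2)"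
        using False by (intro tendsto_intros s_seq_tendsto) auto
      thus ?thesis using False by (simp add: h_def)
    qed (simp add: h_def)
  qed
  also have "integral {-(pi/2)..b} h = integral {-(pi/2)..b} (\<lambda>_. 1)"
  proof (rule integral_spike[of "{-(pi/2), pi/2}"])
    fix \<theta> assume "\<theta> \<in> {-(pi/2)..b} - {-(pi/2), pi/2}"
    hence "cos \<theta> > 0" using b by (intro cos_gt_zero_pi) auto
    thus "(1::real) = h \<theta>" by (simp add: h_def)
  qed auto
  also have "\<dots> = b + pi/2" using b by simp
  finally show ?thesis by (simp add: kron_prim_def)
qed

text \<open>The simple pole of zeta with residue 1, by an integral comparison: the mean value
  theorem places \<open>n^(- a) - (n + 1)^(- a)\<close> between consecutive terms times
  \<open>a\<close>, and these differences telescope to 1.\<close>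

lemma zeta_pole_bounds:
  fixes a :: real
  assumes a: "a > 0"
  defines "Z \<equiv> (\<Sum>n. real (Suc n) powr (- 1 - a))"
  shows "summable (\<lambda>n. real (Suc n) powr (- 1 - a))" "1 \<le> a * Z" "a * Z \<le> 1 + a"
proof -
  define g where "g = (\<lambda>n. real (Suc n) powr (- a))"
  show sm: "summable (\<lambda>n. real (Suc n) powr (- 1 - a))"
    using summable_ignore_initial_segment[of "\<lambda>n. real n powr (- 1 - a)" 1] a
    by (simp add: summable_real_powr_iff)
  have mvt: "\<exists>z. real (Suc n) < z \<and> z < real (Suc (Suc n)) \<and> g n - g (Suc n) = a * z powr (- 1 - a)" for n
  proof -
    have der: "((\<lambda>z. z powr (- a)) has_real_derivative (- a * x powr (- a - 1))) (at x)" if "real (Suc n) \<le> x" for x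
    proof -
      have "x > 0" using that by linarith
      thus ?thesis by (auto intro!: derivative_eq_intros)
    qed
    obtain z where "z > real (Suc n)" "z < real (Suc (Suc n))"
        "real (Suc (Suc n)) powr (- a) - real (Suc n) powr (- a) = (real (Suc (Suc n)) - real (Suc n)) * (- a * z powr (- a - 1))"
      using MVT2[of "real (Suc n)" "real (Suc (Suc n))", OF _ der] by auto
    moreover have "- a - 1 = - 1 - a" by simp
    ultimately show ?thesis by (intro exI[of _ z]) (simp add: g_def)
  qed
  have up: "g n - g (Suc n) \<le> a * real (Suc n) powr (- 1 - a)" for n
  proof -
    obtain z where z: "real (Suc n) < z" "g n - g (Suc n) = a * z powr (- 1 - a)" using mvt by blast
    thus ?thesis using a by (auto intro!: mult_left_mono powr_mono2')
  qed
  have lo: "a * real (Suc (Suc n)) powr (- 1 - a) \<le> g n - g (Suc n)" for n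
  proof -
    obtain z where z: "real (Suc n) < z" "z < real (Suc (Suc n))" "g n - g (Suc n) = a * z powr (- 1 - a)" using mvt by blast
    thus ?thesis using a by (auto intro!: mult_left_mono powr_mono2')
  qed
  have "g \<longlonglongrightarrow> 0" unfolding g_def using a
    by (intro LIMSEQ_Suc tendsto_neg_powr filterlim_real_sequentially) auto
  from telescope_sums'[OF this] have t: "(\<lambda>n. g n - g (Suc n)) sums 1" by (simp add: g_def)
  have "1 \<le> (\<Sum>n. a * real (Suc n) powr (- 1 - a))"
    using sums_le[OF up t summable_sums[OF summable_mult[OF sm]]] by simp
  thus "1 \<le> a * Z" unfolding Z_def using sm by (simp add: suminf_mult)
  have sm2: "summable (\<lambda>n. real (Suc (Suc n)) powr (- 1 - a))"
    using summable_Suc_iff[of "\<lambda>n. real (Suc n) powr (- 1 - a)"] sm by (simp only:)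
  have "(\<Sum>n. a * real (Suc (Suc n)) powr (- 1 - a)) \<le> 1"
    using sums_le[OF lo summable_sums[OF summable_mult[OF sm2]] t] .
  moreover have "(\<Sum>n. a * real (Suc (Suc n)) powr (- 1 - a)) = a * (Z - 1)"
    unfolding Z_def using suminf_split_head[OF sm] suminf_mult[OF sm2] by simp
  ultimately show "a * Z \<le> 1 + a" by (simp add: algebra_simps)
qed

section \<open>The Kronecker limit formula\<close>

abbreviation upper_rows :: "(int \<times> int) set" where
  "upper_rows \<equiv> {1..} \<times> UNIV"

lemma summable_on_int_product_powr:
  assumes "\<sigma> > 1"
  shows "(\<lambda>(c, d). ((1 + \<bar>of_int c\<bar>) * (1 + \<bar>of_int d\<bar>)) powr (-\<sigma>) :: real) summable_on (A :: (int \<times> int) set)"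
proof -
  define S where "S = (\<Sum>\<^sub>\<infinity>k::int. (1 + \<bar>of_int k\<bar>) powr (-\<sigma>) :: real)"
  have "(\<lambda>(c, d). ((1 + \<bar>of_int c\<bar>) * (1 + \<bar>of_int d\<bar>)) powr (-\<sigma>) :: real) summable_on (UNIV :: int set) \<times> (UNIV :: int set)"
  proof (rule summable_on_SigmaI)
    show "((\<lambda>d. case (c, d) of (c, d) \<Rightarrow> (((1 + \<bar>of_int c\<bar>) * (1 + \<bar>of_int d\<bar>)) powr (-\<sigma>) :: real)) has_sum
        (1 + \<bar>of_int c\<bar>) powr (-\<sigma>) * S) UNIV" for c :: int
      unfolding prod.case S_def powr_mult
      by (intro has_sum_cmult_right has_sum_infsum summable_on_int_powr assms)
    show "(\<lambda>c::int. (1 + \<bar>of_int c\<bar>) powr (-\<sigma>) * S) summable_on UNIV"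
      by (intro summable_on_cmult_left summable_on_int_powr assms)
  qed auto
  thus ?thesis by (rule summable_on_subset) auto
qed

text \<open>At \<open>u = 0\<close> this is \<open>\<bar>c \<tau> + d\<bar>^2\<close>; the parameter
  \<open>u\<close> interpolates between \<open>d\<close> and \<open>d + 1\<close> for the comparison
  with integrals.\<close>

definition lattice_Q :: "complex \<Rightarrow> int \<Rightarrow> int \<Rightarrow> real \<Rightarrow> real" where
  "lattice_Q \<tau> c d u = (of_int c * Re \<tau> + of_int d + u)\<^sup>2 + (of_int c * Im \<tau>)\<^sup>2"

lemma norm_square_conv_lattice_Q: "(norm (of_int c * \<tau> + of_int d))\<^sup>2 = lattice_Q \<tau> c d 0"
  by (simp add: cmod_power2 lattice_Q_def)

definition eisenstein :: "complex \<Rightarrow> real \<Rightarrow> real" where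
  "eisenstein \<tau> s = Im \<tau> powr s * (\<Sum>\<^sub>\<infinity>(c, d)\<in>UNIV - {(0, 0)}. lattice_Q \<tau> c d 0 powr (-s))"

definition zeta_int :: "real \<Rightarrow> real" where
  "zeta_int a = (\<Sum>\<^sub>\<infinity>c\<in>{1::int..}. of_int c powr (- a))"

lemma int_1_has_sum_conv:
  fixes f :: "int \<Rightarrow> real"
  shows "(f has_sum S) {1..} \<longleftrightarrow> ((\<lambda>n. f (int (Suc n))) has_sum S) UNIV"
  by (rule has_sum_reindex_bij_witness[of _ "\<lambda>n. int (Suc n)" "\<lambda>c. nat (c - 1)"]) auto

lemma zeta_int_has_sum:
  assumes "a > 1"
  shows "((\<lambda>c. of_int c powr (- a)) has_sum zeta_int a) {1::int..}"
proof -
  have "summable (\<lambda>n. real (Suc n) powr (- 1 - (a - 1)))" using assms by (intro zeta_pole_bounds) auto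
  hence "((\<lambda>n. real (Suc n) powr (- a)) has_sum (\<Sum>n. real (Suc n) powr (- a))) UNIV"
    by (intro norm_summable_imp_has_sum summable_sums) simp_all
  hence "((\<lambda>c. of_int c powr (- a)) has_sum (\<Sum>n. real (Suc n) powr (- a))) {1::int..}"
    unfolding int_1_has_sum_conv by simp
  thus ?thesis unfolding zeta_int_def by (rule has_sum_infsum[OF has_sum_imp_summable])
qed

lemma zeta_int_bounds:
  assumes "a > 1"
  shows "1 \<le> (a - 1) * zeta_int a" "(a - 1) * zeta_int a \<le> a"
proof -
  have sm: "summable (\<lambda>n. real (Suc n) powr (- 1 - (a - 1)))" using assms by (intro zeta_pole_bounds) auto
  have "((\<lambda>n. real (Suc n) powr (- 1 - (a - 1))) has_sum (\<Sum>n. real (Suc n) powr (- 1 - (a - 1)))) UNIV"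
    using sm by (intro norm_summable_imp_has_sum summable_sums) simp_all
  hence "((\<lambda>c. of_int c powr (- a)) has_sum (\<Sum>n. real (Suc n) powr (- 1 - (a - 1)))) {1::int..}"
    unfolding int_1_has_sum_conv by simp
  hence "zeta_int a = (\<Sum>n. real (Suc n) powr (- 1 - (a - 1)))" unfolding zeta_int_def by (rule infsumI)
  thus "1 \<le> (a - 1) * zeta_int a" "(a - 1) * zeta_int a \<le> a"
    using zeta_pole_bounds(2,3)[of "a - 1"] assms by simp_all
qed

lemma telescope_int_sum:
  fixes P :: "real \<Rightarrow> real"
  shows "(\<Sum>n<m. (P (\<theta> + of_int (int n) + 1) - P (\<theta> + of_int (int n))) +
      (P (\<theta> + of_int (- 1 - int n) + 1) - P (\<theta> + of_int (- 1 - int n)))) = P (\<theta> + real m) - P (\<theta> - real m)"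
  by (induction m) (simp_all add: algebra_simps)

context
  fixes \<tau> :: complex
  assumes \<tau>: "Im \<tau> > 0"
begin

lemma lattice_Q_pos: "c \<noteq> 0 \<Longrightarrow> lattice_Q \<tau> c d u > 0"
  using \<tau> by (simp add: lattice_Q_def add_nonneg_pos)

text \<open>The product on the left lets the double series over \<open>c\<close> and
  \<open>d\<close> split into two single ones. With \<open>r\<close> for \<open>c\<close> and
  \<open>Z\<close> for the real part, it comes from
  \<open>2 r \<bar>Z\<bar> \<le> r^2 + Z^2\<close>.\<close>

lemma lattice_Q_lower_bound:
  obtains C where "C \<ge> 1" "\<And>c d u. c \<ge> 1 \<Longrightarrow> u \<in> {0..1} \<Longrightarrow> (1 + \<bar>of_int c\<bar>) * (1 + \<bar>of_int d\<bar>) \<le> C * lattice_Q \<tau> c d u"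
proof -
  define x y where "x = Re \<tau>" and "y = Im \<tau>"
  have y: "y > 0" using \<tau> by (simp add: y_def)
  define b where "b = \<bar>x\<bar> + 2"
  define C where "C = 1 + 2 * ((1/2 + b) / y\<^sup>2 + 1/2)"
  show ?thesis
  proof (rule that)
    show "C \<ge> 1" using y by (simp add: C_def b_def add_nonneg_nonneg)
    fix c d :: int and u :: real assume c: "c \<ge> 1" and u: "u \<in> {0..1}"
    define Z where "Z = of_int c * x + of_int d + u"
    define r where "r = real_of_int c"
    have r: "r \<ge> 1" using c by (simp add: r_def)
    have "\<bar>r * x\<bar> = r * \<bar>x\<bar>" using r by (simp add: abs_mult)
    hence "1 + \<bar>of_int d\<bar> \<le> \<bar>Z\<bar> + (r * \<bar>x\<bar> + 2 * 1)" using u by (auto simp: Z_def r_def [symmetric])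
    also have "\<dots> \<le> \<bar>Z\<bar> + (r * \<bar>x\<bar> + 2 * r)" using r by (intro add_left_mono mult_left_mono) auto
    finally have "1 + \<bar>of_int d\<bar> \<le> \<bar>Z\<bar> + r * b" by (simp add: b_def algebra_simps)
    hence "r * (1 + \<bar>of_int d\<bar>) \<le> r * (\<bar>Z\<bar> + r * b)" using r by (intro mult_left_mono) auto
    also have "\<dots> = r * \<bar>Z\<bar> + r\<^sup>2 * b" by (simp add: power2_eq_square algebra_simps)
    also have "\<dots> \<le> (r\<^sup>2 + Z\<^sup>2) / 2 + r\<^sup>2 * b" using sum_squares_bound[of r "\<bar>Z\<bar>"] by simp
    also have "\<dots> = (1/2 + b) / y\<^sup>2 * (r * y)\<^sup>2 + 1/2 * Z\<^sup>2"
    proof -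
      have "(1/2 + b) / y\<^sup>2 * (r * y)\<^sup>2 = (1/2 + b) * r\<^sup>2" using y by (simp add: power_mult_distrib)
      thus ?thesis by (simp add: algebra_simps)
    qed
    also have "\<dots> \<le> ((1/2 + b) / y\<^sup>2 + 1/2) * (Z\<^sup>2 + (r * y)\<^sup>2)"
    proof -
      have "0 \<le> (1/2 + b) / y\<^sup>2 * Z\<^sup>2" by (simp add: b_def)
      moreover have "0 \<le> 1/2 * (r * y)\<^sup>2" by simp
      ultimately show ?thesis by (simp add: algebra_simps)
    qed
    finally have *: "r * (1 + \<bar>of_int d\<bar>) \<le> ((1/2 + b) / y\<^sup>2 + 1/2) * (Z\<^sup>2 + (r * y)\<^sup>2)" .
    have "(1 + \<bar>of_int c\<bar>) * (1 + \<bar>of_int d\<bar>) \<le> (2 * r) * (1 + \<bar>of_int d\<bar>)"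
      using c by (intro mult_right_mono) (auto simp: r_def)
    also have "\<dots> \<le> 2 * ((1/2 + b) / y\<^sup>2 + 1/2) * (Z\<^sup>2 + (r * y)\<^sup>2)"
      using mult_left_mono[OF *, of 2] by (simp only: mult.assoc)
    also have "\<dots> \<le> C * (Z\<^sup>2 + (r * y)\<^sup>2)" unfolding C_def by (intro mult_right_mono) auto
    finally show "(1 + \<bar>of_int c\<bar>) * (1 + \<bar>of_int d\<bar>) \<le> C * lattice_Q \<tau> c d u"
      by (simp add: lattice_Q_def Z_def r_def x_def y_def)
  qed
qed

text \<open>The cap 3 makes the constant independent of \<open>a\<close>; it covers the exponents
  \<open>s + 1/2\<close> with \<open>s \<le> 2\<close>.\<close>

lemma lattice_Q_powr_bound:
  assumes "\<sigma> > 0"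
  obtains K where "K \<ge> 0" "\<And>c d u a. c \<ge> 1 \<Longrightarrow> u \<in> {0..1} \<Longrightarrow> \<sigma> \<le> a \<Longrightarrow> a \<le> 3 \<Longrightarrow>
     lattice_Q \<tau> c d u powr (- a) \<le> K * ((1 + \<bar>of_int c\<bar>) * (1 + \<bar>of_int d\<bar>)) powr (- \<sigma>)"
proof -
  obtain C where C: "C \<ge> 1" "\<And>c d u. c \<ge> 1 \<Longrightarrow> u \<in> {0..1} \<Longrightarrow> (1 + \<bar>of_int c\<bar>) * (1 + \<bar>of_int d\<bar>) \<le> C * lattice_Q \<tau> c d u"
    by (fact lattice_Q_lower_bound)
  show ?thesis
  proof (rule that[of "C powr 3"])
    fix c d :: int and u a :: real assume c: "c \<ge> 1" and u: "u \<in> {0..1}" and a: "\<sigma> \<le> a" "a \<le> 3"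
    define W where "W = (1 + \<bar>real_of_int c\<bar>) * (1 + \<bar>real_of_int d\<bar>)"
    have W: "W \<ge> 1 * 1" unfolding W_def by (intro mult_mono) auto
    have "W / C \<le> lattice_Q \<tau> c d u" using C(2)[OF c u, of d] C(1) by (simp add: W_def field_simps)
    hence "lattice_Q \<tau> c d u powr (- a) \<le> (W / C) powr (- a)" using W C(1) a assms by (intro powr_mono2') auto
    also have "\<dots> = C powr a * W powr (- a)" using W C(1) by (simp add: powr_divide powr_minus_divide)
    also have "\<dots> \<le> C powr 3 * W powr (- \<sigma>)" using W C(1) a by (intro mult_mono powr_mono) auto
    finally show "lattice_Q \<tau> c d u powr (- a) \<le> C powr 3 * ((1 + \<bar>of_int c\<bar>) * (1 + \<bar>of_int d\<bar>)) powr (- \<sigma>)"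
      by (simp add: W_def)
  qed simp
qed

text \<open>\<open>kron_p s (c, d)\<close> is the integral of \<open>lattice_Q \<tau> c d u powr (- s)\<close> over \<open>0 \<le> u \<le> 1\<close>; the
  substitution \<open>t = r tan \<theta>\<close> with \<open>r = c Im \<tau>\<close> gives the primitive \<open>kron_P s c\<close> in \<open>t\<close>.\<close>

definition kron_P :: "real \<Rightarrow> int \<Rightarrow> real \<Rightarrow> real" where
  "kron_P s c t = (of_int c * Im \<tau>) powr (1 - 2 * s) * kron_prim s (arctan (t / (of_int c * Im \<tau>)))"

definition kron_p :: "real \<Rightarrow> int \<times> int \<Rightarrow> real" where
  "kron_p s = (\<lambda>(c, d). kron_P s c (of_int c * Re \<tau> + of_int d + 1) - kron_P s c (of_int c * Re \<tau> + of_int d))"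

definition kron_a :: "real \<Rightarrow> int \<times> int \<Rightarrow> real" where
  "kron_a s = (\<lambda>(c, d). lattice_Q \<tau> c d 0 powr (- s))"

lemma kron_P_has_derivative:
  assumes s: "s > 1" and c: "c \<ge> 1"
  shows "(kron_P s c has_real_derivative (t\<^sup>2 + (of_int c * Im \<tau>)\<^sup>2) powr (- s)) (at t)"
proof -
  define r where "r = of_int c * Im \<tau>"
  have r: "r > 0" using c \<tau> by (simp add: r_def)
  have "((\<lambda>t. kron_prim s (arctan (t / r))) has_real_derivative (1 + (t / r)\<^sup>2) powr (- s) * (1 / r)) (at t)"
    by (rule DERIV_chain2[OF kron_prim_has_derivative[OF s]]) (use r in \<open>auto intro!: derivative_eq_intros\<close>)
  hence "((\<lambda>t. r powr (1 - 2 * s) * kron_prim s (arctan (t / r))) has_real_derivative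
      r powr (1 - 2 * s) * ((1 + (t / r)\<^sup>2) powr (- s) * (1 / r))) (at t)"
    by (rule DERIV_cmult)
  also have "r powr (1 - 2 * s) * ((1 + (t / r)\<^sup>2) powr (- s) * (1 / r)) = (t\<^sup>2 + r\<^sup>2) powr (- s)"
  proof -
    have "t\<^sup>2 + r\<^sup>2 = r\<^sup>2 * (1 + (t / r)\<^sup>2)" using r by (simp add: power_divide distrib_left)
    hence "(t\<^sup>2 + r\<^sup>2) powr (- s) = (r\<^sup>2) powr (- s) * (1 + (t / r)\<^sup>2) powr (- s)" by (simp add: powr_mult)
    also have "(r\<^sup>2) powr (- s) = r powr (1 - 2 * s) * (1 / r)"
    proof -
      have "(r\<^sup>2) powr (- s) = (r powr 2) powr (- s)" using r by simp
      also have "\<dots> = r powr ((1 - 2 * s) + - 1)" by (simp add: powr_powr)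
      also have "\<dots> = r powr (1 - 2 * s) * r powr (- 1)" by (rule powr_add)
      finally show ?thesis using r by (simp add: powr_minus_divide)
    qed
    finally show ?thesis by simp
  qed
  finally show ?thesis unfolding kron_P_def [abs_def] r_def .
qed

text \<open>The lattice sum itself diverges at \<open>s = 1\<close>, but a value minus the mean over
  a unit interval is controlled by a derivative. That gains half a power of the quadratic form, so
  the exponent is at least 3/2 and the majorant is independent of \<open>s\<close>, as dominated
  convergence requires.\<close>

lemma kron_diff_bound:
  obtains K where "\<And>s z. s > 1 \<Longrightarrow> s \<le> 2 \<Longrightarrow> z \<in> upper_rows \<Longrightarrow>
    \<bar>kron_a s z - kron_p s z\<bar> \<le> K * (case z of (c, d) \<Rightarrow> ((1 + \<bar>of_int c\<bar>) * (1 + \<bar>of_int d\<bar>)) powr (- (3/2)))"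
proof -
  obtain K where K: "K \<ge> 0" "\<And>c d u a. c \<ge> 1 \<Longrightarrow> u \<in> {0..1} \<Longrightarrow> 3/2 \<le> a \<Longrightarrow> a \<le> 3 \<Longrightarrow>
     lattice_Q \<tau> c d u powr (- a) \<le> K * ((1 + \<bar>of_int c\<bar>) * (1 + \<bar>of_int d\<bar>)) powr (- (3/2))"
    by (rule lattice_Q_powr_bound[of "3/2"]) auto
  show ?thesis
  proof (rule that[of "4 * K"])
    fix s :: real and z :: "int \<times> int" assume s: "s > 1" "s \<le> 2" and z: "z \<in> upper_rows"
    obtain c d where cd: "z = (c, d)" by (cases z)
    have c: "c \<ge> 1" using z by (simp add: cd)
    define t where "t = of_int c * Re \<tau> + real_of_int d"
    define r where "r = of_int c * Im \<tau>"
    have r: "r > 0" using c \<tau> by (simp add: r_def)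
    define f where "f = (\<lambda>v. (v\<^sup>2 + r\<^sup>2) powr (- s))"
    have Q: "lattice_Q \<tau> c d u = (t + u)\<^sup>2 + r\<^sup>2" for u by (simp add: lattice_Q_def t_def r_def)
    have pos: "v\<^sup>2 + r\<^sup>2 > 0" for v :: real using r by (simp add: add_nonneg_pos)
    have "kron_p s z = kron_P s c (t + 1) - kron_P s c t" by (simp add: kron_p_def cd t_def)
    moreover obtain \<xi> where \<xi>: "t < \<xi>" "\<xi> < t + 1" "kron_P s c (t + 1) - kron_P s c t = (t + 1 - t) * f \<xi>"
      using MVT2[of t "t + 1" "kron_P s c" f] kron_P_has_derivative[OF s(1) c] unfolding f_def r_def by auto
    ultimately have p: "kron_p s z = f \<xi>" by simp
    have a: "kron_a s z = f t" using Q[of 0] by (simp add: kron_a_def cd f_def)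
    define f' where "f' = (\<lambda>v. - s * (v\<^sup>2 + r\<^sup>2) powr (- s - 1) * (2 * v))"
    have df: "(f has_real_derivative f' v) (at v)" for v
      unfolding f_def f'_def using pos[of v] by (auto intro!: derivative_eq_intros)
    obtain \<zeta> where \<zeta>: "t < \<zeta>" "\<zeta> < \<xi>" "f \<xi> - f t = (\<xi> - t) * f' \<zeta>"
      using MVT2[OF \<xi>(1), of f f'] df by auto
    \<comment> \<open>The constant 4 bounds \<open>2 s\<close>; the factor
      \<open>\<bar>\<zeta>\<bar>\<close> takes back half of the power gained by
      differentiating.\<close>
    have "\<bar>f' \<zeta>\<bar> \<le> 4 * (\<zeta>\<^sup>2 + r\<^sup>2) powr (- (s + 1/2))"
    proof -
      have "\<bar>\<zeta>\<bar> \<le> (\<zeta>\<^sup>2 + r\<^sup>2) powr (1/2)"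
        using pos[of \<zeta>] by (simp add: powr_half_sqrt real_le_rsqrt)
      hence "(\<zeta>\<^sup>2 + r\<^sup>2) powr (- s - 1) * \<bar>\<zeta>\<bar> \<le> (\<zeta>\<^sup>2 + r\<^sup>2) powr (- s - 1) * (\<zeta>\<^sup>2 + r\<^sup>2) powr (1/2)"
        by (intro mult_left_mono) auto
      also have "\<dots> = (\<zeta>\<^sup>2 + r\<^sup>2) powr (- (s + 1/2))"
      proof -
        have "- s - 1 + 1/2 = - (s + 1/2)" by simp
        thus ?thesis by (simp only: powr_add [symmetric])
      qed
      finally have "s * ((\<zeta>\<^sup>2 + r\<^sup>2) powr (- s - 1) * \<bar>\<zeta>\<bar>) \<le> 2 * (\<zeta>\<^sup>2 + r\<^sup>2) powr (- (s + 1/2))"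
        using s by (intro mult_mono) auto
      moreover have "\<bar>f' \<zeta>\<bar> = 2 * (s * ((\<zeta>\<^sup>2 + r\<^sup>2) powr (- s - 1) * \<bar>\<zeta>\<bar>))"
        using s by (simp add: f'_def abs_mult)
      ultimately show ?thesis by linarith
    qed
    also have "\<dots> \<le> 4 * (K * ((1 + \<bar>of_int c\<bar>) * (1 + \<bar>of_int d\<bar>)) powr (- (3/2)))"
      using K(2)[OF c, of "\<zeta> - t" "s + 1/2" d] Q[of "\<zeta> - t"] \<xi> \<zeta> s by simp
    finally have f': "\<bar>f' \<zeta>\<bar> \<le> 4 * (K * ((1 + \<bar>of_int c\<bar>) * (1 + \<bar>of_int d\<bar>)) powr (- (3/2)))" .
    have "\<bar>kron_a s z - kron_p s z\<bar> = (\<xi> - t) * \<bar>f' \<zeta>\<bar>"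
      using \<zeta>(3) \<xi>(1) unfolding a p by (simp add: abs_minus_commute abs_mult)
    also have "\<dots> \<le> 1 * \<bar>f' \<zeta>\<bar>" using \<xi> by (intro mult_right_mono) auto
    finally show "\<bar>kron_a s z - kron_p s z\<bar> \<le> 4 * K * (case z of (c, d) \<Rightarrow> ((1 + \<bar>of_int c\<bar>) * (1 + \<bar>of_int d\<bar>)) powr (- (3/2)))"
      using f' by (simp add: cd)
  qed
qed

lemma kron_a_summable:
  assumes "s > 1" "s \<le> 2"
  shows "kron_a s summable_on upper_rows"
proof -
  obtain K where "K \<ge> 0" "\<And>c d u a. c \<ge> 1 \<Longrightarrow> u \<in> {0..1} \<Longrightarrow> s \<le> a \<Longrightarrow> a \<le> 3 \<Longrightarrow>
     lattice_Q \<tau> c d u powr (- a) \<le> K * ((1 + \<bar>of_int c\<bar>) * (1 + \<bar>of_int d\<bar>)) powr (- s)"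
    by (rule lattice_Q_powr_bound[of s]) (use assms in auto)
  thus ?thesis using assms
    by (intro summable_on_comparison_test[OF summable_on_cmult_right[OF summable_on_int_product_powr[OF assms(1)]], of _ _ K])
       (auto simp: kron_a_def)
qed

lemma kron_diff_summable:
  assumes "s > 1" "s \<le> 2"
  shows "(\<lambda>z. kron_a s z - kron_p s z) summable_on upper_rows"
proof -
  obtain K where "\<And>s z. s > 1 \<Longrightarrow> s \<le> 2 \<Longrightarrow> z \<in> upper_rows \<Longrightarrow>
    \<bar>kron_a s z - kron_p s z\<bar> \<le> K * (case z of (c, d) \<Rightarrow> ((1 + \<bar>of_int c\<bar>) * (1 + \<bar>of_int d\<bar>)) powr (- (3/2)))"
    by (fact kron_diff_bound)
  hence "(\<lambda>z. norm (kron_a s z - kron_p s z)) summable_on upper_rows"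
    using assms by (intro summable_on_comparison_test[OF summable_on_cmult_right[OF summable_on_int_product_powr[of "3/2"]], of _ _ K]) auto
  thus ?thesis by (rule abs_summable_summable)
qed

lemma kron_p_summable:
  assumes "s > 1" "s \<le> 2"
  shows "kron_p s summable_on upper_rows"
  using summable_on_add[OF kron_a_summable[OF assms] summable_on_uminus[THEN iffD2, OF kron_diff_summable[OF assms]]] by simp

text \<open>The integrals over unit intervals telescope to the integral over the whole line.\<close>

lemma infsum_kron_p_row:
  assumes s: "s > 1" "s \<le> 2" and c: "c \<ge> 1"
  shows "(\<Sum>\<^sub>\<infinity>d. kron_p s (c, d)) = (of_int c * Im \<tau>) powr (1 - 2 * s) * kron_prim s (pi/2)"
proof -
  define r where "r = of_int c * Im \<tau>"
  have r: "r > 0" using c \<tau> by (simp add: r_def)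
  have "(\<lambda>d. kron_p s (c, d)) summable_on UNIV"
    using summable_on_SigmaD1[of "\<lambda>c d. kron_p s (c, d)" "{1..}" "\<lambda>_. UNIV" c] kron_p_summable[OF s] c by simp
  from infsum_int_LIMSEQ[OF this]
  have "(\<lambda>m. kron_P s c (of_int c * Re \<tau> + real m) - kron_P s c (of_int c * Re \<tau> - real m)) \<longlonglongrightarrow> (\<Sum>\<^sub>\<infinity>d. kron_p s (c, d))"
    unfolding kron_p_def prod.case telescope_int_sum .
  moreover have "(\<lambda>m. kron_P s c (of_int c * Re \<tau> + real m) - kron_P s c (of_int c * Re \<tau> - real m))
      \<longlonglongrightarrow> r powr (1 - 2 * s) * kron_prim s (pi/2) - r powr (1 - 2 * s) * 0"
    unfolding kron_P_def r_def [symmetric]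
  proof (intro tendsto_diff tendsto_mult tendsto_const)
    have "filterlim (\<lambda>m. (of_int c * Re \<tau> + real m) / r) at_top sequentially" using r by real_asymp
    from filterlim_compose[OF kron_prim_at_top[OF s(1)] this]
    show "(\<lambda>m. kron_prim s (arctan ((of_int c * Re \<tau> + real m) / r))) \<longlonglongrightarrow> kron_prim s (pi/2)" .
    have "filterlim (\<lambda>m. (of_int c * Re \<tau> - real m) / r) at_bot sequentially" using r by real_asymp
    from filterlim_compose[OF kron_prim_at_bot[OF s(1)] this]
    show "(\<lambda>m. kron_prim s (arctan ((of_int c * Re \<tau> - real m) / r))) \<longlonglongrightarrow> 0" .
  qed
  ultimately show ?thesis using LIMSEQ_unique by (simp add: r_def)
qed

lemma infsum_kron_p:
  assumes s: "s > 1" "s \<le> 2"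
  shows "(\<Sum>\<^sub>\<infinity>z\<in>upper_rows. kron_p s z) = Im \<tau> powr (1 - 2 * s) * kron_prim s (pi/2) * zeta_int (2 * s - 1)"
proof -
  have "(\<Sum>\<^sub>\<infinity>z\<in>upper_rows. kron_p s z) = (\<Sum>\<^sub>\<infinity>c\<in>{1..}. \<Sum>\<^sub>\<infinity>d. kron_p s (c, d))"
    by (rule infsum_Sigma_banach[OF kron_p_summable[OF s], symmetric])
  also have "\<dots> = (\<Sum>\<^sub>\<infinity>c\<in>{1::int..}. (Im \<tau> powr (1 - 2 * s) * kron_prim s (pi/2)) * of_int c powr (- (2 * s - 1)))"
    using infsum_kron_p_row[OF s] \<tau> by (intro infsum_cong) (simp add: powr_mult mult_ac)
  also have "\<dots> = (Im \<tau> powr (1 - 2 * s) * kron_prim s (pi/2)) * zeta_int (2 * s - 1)"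
    unfolding zeta_int_def by (rule infsum_cmult_right')
  finally show ?thesis .
qed

text \<open>The pairs with \<open>c = 0\<close> give the two copies of zeta, and
  \<open>(c, d) \<mapsto> (- c, - d)\<close> folds the rows with \<open>c < 0\<close> onto those
  with \<open>c > 0\<close>.\<close>

lemma eisenstein_eq:
  assumes s: "s > 1" "s \<le> 2"
  shows "eisenstein \<tau> s = Im \<tau> powr s * (2 * zeta_int (2 * s) + 2 * (\<Sum>\<^sub>\<infinity>z\<in>upper_rows. kron_a s z))"
proof -
  define f where "f = (\<lambda>z::int \<times> int. lattice_Q \<tau> (fst z) (snd z) 0 powr (- s))"
  have neg: "lattice_Q \<tau> (- c) (- d) 0 = lattice_Q \<tau> c d 0" for c d
  proof -
    have "- (of_int c * Re \<tau>) - of_int d = - (of_int c * Re \<tau> + real_of_int d)" by simp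
    thus ?thesis unfolding lattice_Q_def by (simp only: of_int_minus mult_minus_left add_0_right power2_minus diff_conv_add_uminus [symmetric])
  qed
  have up: "(f has_sum (\<Sum>\<^sub>\<infinity>z\<in>upper_rows. kron_a s z)) upper_rows"
    using has_sum_infsum[OF kron_a_summable[OF s]] by (simp add: f_def kron_a_def case_prod_unfold)
  have down: "(f has_sum (\<Sum>\<^sub>\<infinity>z\<in>upper_rows. kron_a s z)) ({..-1} \<times> UNIV)"
  proof -
    have "(f has_sum (\<Sum>\<^sub>\<infinity>z\<in>upper_rows. kron_a s z)) ({..-1} \<times> UNIV) \<longleftrightarrow> (f has_sum (\<Sum>\<^sub>\<infinity>z\<in>upper_rows. kron_a s z)) upper_rows"
      by (rule has_sum_reindex_bij_witness[of _ "\<lambda>z. (- fst z, - snd z)" "\<lambda>z. (- fst z, - snd z)"]) (auto simp: f_def neg)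
    thus ?thesis using up by simp
  qed
  have z: "((\<lambda>c. of_int c powr (- (2 * s))) has_sum zeta_int (2 * s)) {1::int..}"
    using s by (intro zeta_int_has_sum) auto
  have sq: "f (0, d) = \<bar>of_int d\<bar> powr (- (2 * s))" for d
  proof (cases "d = 0")
    case False
    have "f (0, d) = (\<bar>of_int d\<bar>\<^sup>2) powr (- s)" by (simp add: f_def lattice_Q_def)
    also have "\<bar>of_int d\<bar>\<^sup>2 = \<bar>real_of_int d\<bar> powr 2" using False by simp
    finally show ?thesis by (simp only: powr_powr) simp
  qed (simp add: f_def lattice_Q_def)
  have right: "(f has_sum zeta_int (2 * s)) ({0} \<times> {1..})"
  proof -
    have "(f has_sum zeta_int (2 * s)) ({0} \<times> {1..}) \<longleftrightarrow> ((\<lambda>c. of_int c powr (- (2 * s))) has_sum zeta_int (2 * s)) {1::int..}"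
      by (rule has_sum_reindex_bij_witness[of _ "\<lambda>d. (0, d)" snd]) (auto simp: sq)
    thus ?thesis using z by simp
  qed
  have left: "(f has_sum zeta_int (2 * s)) ({0} \<times> {..-1})"
  proof -
    have "(f has_sum zeta_int (2 * s)) ({0} \<times> {..-1}) \<longleftrightarrow> ((\<lambda>c. of_int c powr (- (2 * s))) has_sum zeta_int (2 * s)) {1::int..}"
      by (rule has_sum_reindex_bij_witness[of _ "\<lambda>d. (0, - d)" "\<lambda>z. - snd z"]) (auto simp: sq)
    thus ?thesis using z by simp
  qed
  have "(f has_sum ((zeta_int (2 * s) + zeta_int (2 * s)) + ((\<Sum>\<^sub>\<infinity>z\<in>upper_rows. kron_a s z) + (\<Sum>\<^sub>\<infinity>z\<in>upper_rows. kron_a s z))))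
     (({0} \<times> {1..} \<union> {0} \<times> {..-1}) \<union> (upper_rows \<union> {..-1} \<times> UNIV))"
    by (intro has_sum_Un_disjoint left right up down) auto
  also have "({0} \<times> {1..} \<union> {0} \<times> {..-1}) \<union> (upper_rows \<union> {..-1} \<times> UNIV) = UNIV - {(0, 0)}"
    by auto
  finally show ?thesis
    unfolding eisenstein_def using infsumI by (fastforce simp: f_def case_prod_unfold)
qed

text \<open>The subtracted term carries the pole and does not involve \<open>\<tau>\<close>. Each of
  the three remaining terms has a limit: the row \<open>c = 0\<close>, the dominated difference, and
  a product in which the zero of \<open>y^(1 - s) - 1\<close> meets the pole of zeta.\<close>

lemma eisenstein_s_seq_eq:
  defines "y \<equiv> Im \<tau>"
  shows "eisenstein \<tau> (s_seq k) - 2 * kron_prim (s_seq k) (pi/2) * zeta_int (2 * s_seq k - 1) =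
     2 * y powr s_seq k * zeta_int (2 * s_seq k) + 2 * y powr s_seq k * (\<Sum>\<^sub>\<infinity>z\<in>upper_rows. kron_a (s_seq k) z - kron_p (s_seq k) z)
     + 2 * kron_prim (s_seq k) (pi/2) * ((y powr (1 - s_seq k) - 1) * zeta_int (2 * s_seq k - 1))"
proof -
  define s where "s = s_seq k"
  have s: "s > 1" "s \<le> 2" using s_seq_gt s_seq_le by (auto simp: s_def)
  have "(\<Sum>\<^sub>\<infinity>z\<in>upper_rows. kron_a s z) =
      (\<Sum>\<^sub>\<infinity>z\<in>upper_rows. (kron_a s z - kron_p s z) + kron_p s z)" by simp
  also have "\<dots> = (\<Sum>\<^sub>\<infinity>z\<in>upper_rows. kron_a s z - kron_p s z) + (\<Sum>\<^sub>\<infinity>z\<in>upper_rows. kron_p s z)"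
    by (rule infsum_add[OF kron_diff_summable[OF s] kron_p_summable[OF s]])
  finally have "eisenstein \<tau> s = y powr s * (2 * zeta_int (2 * s) + 2 * ((\<Sum>\<^sub>\<infinity>z\<in>upper_rows. kron_a s z - kron_p s z) +
      y powr (1 - 2 * s) * kron_prim s (pi/2) * zeta_int (2 * s - 1)))"
    by (simp add: eisenstein_eq[OF s] infsum_kron_p[OF s] y_def)
  moreover have "y powr s * y powr (1 - 2 * s) = y powr (1 - s)" by (simp flip: powr_add)
  hence "y powr s * (y powr (1 - 2 * s) * w) = y powr (1 - s) * w" for w by (simp flip: mult.assoc)
  ultimately show ?thesis unfolding s_def [symmetric] by (simp add: algebra_simps)
qed

end

section \<open>Logarithms of the eta product\<close>

lemma ln_norm_1_minus_sums:
  assumes "norm w < 1"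
  shows "(\<lambda>c. Re (w ^ Suc c) / real (Suc c)) sums (- ln (norm (1 - w)))"
proof -
  have w1: "1 - w \<noteq> 0" using assms by auto
  have "(\<lambda>n. - (w ^ n) / of_nat n) sums Ln (1 - w)"
    using Ln_series'[of "- w"] assms by simp
  from sums_Re[OF sums_minus[OF this]] have "(\<lambda>n. Re (w ^ n / of_nat n)) sums (- ln (norm (1 - w)))"
    using w1 by simp
  hence "(\<lambda>n. Re (w ^ n) / real n) sums (- ln (norm (1 - w)))" by simp
  thus ?thesis using sums_Suc_iff[of "\<lambda>n. Re (w ^ n) / real n" "- ln (norm (1 - w))"]
    by (simp del: power_Suc of_nat_Suc)
qed

lemma e_nonzero [simp]: "e z \<noteq> 0"
  by (simp add: e_def)

lemma norm_e_lt_1: "Im \<tau> > 0 \<Longrightarrow> norm (e \<tau>) < 1"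
  by (rule cot_conv_e(2))

lemma e_of_nat_mult: "e (of_nat k * \<tau>) = e \<tau> ^ k"
  by (induction k) (simp_all add: distrib_right e_add, simp add: e_def)

lemma convergent_prod_eta:
  assumes "Im \<tau> > 0"
  shows "convergent_prod (\<lambda>n. 1 - e (of_nat (Suc n) * \<tau>))"
proof -
  have "summable (\<lambda>n. norm (e \<tau>) ^ Suc n)"
    using norm_e_lt_1[OF assms] by (intro summable_Suc_iff[THEN iffD2] summable_geometric) auto
  hence "summable (\<lambda>n. norm ((1 - e (of_nat (Suc n) * \<tau>)) - 1))"
    by (simp add: e_of_nat_mult norm_power norm_mult del: of_nat_Suc)
  thus ?thesis by (intro abs_convergent_prod_imp_convergent_prod summable_imp_abs_convergent_prod)
qed

lemma eta_factor_nonzero: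
  assumes "Im \<tau> > 0"
  shows "1 - e (of_nat (Suc n) * \<tau>) \<noteq> 0"
proof
  assume "1 - e (of_nat (Suc n) * \<tau>) = 0"
  hence "norm (e \<tau> ^ Suc n) = 1" by (simp add: e_of_nat_mult del: of_nat_Suc power_Suc)
  moreover have "norm (e \<tau>) ^ Suc n < 1" using norm_e_lt_1[OF assms] by (intro power_Suc_less_one) auto
  ultimately show False by (simp add: norm_power norm_mult)
qed

lemma eta_log_sums:
  assumes "Im \<tau> > 0"
  shows "dedekind_eta \<tau> \<noteq> 0"
    and "(\<lambda>n. ln (norm (1 - e (of_nat (Suc n) * \<tau>)))) sums (ln (norm (dedekind_eta \<tau>)) + pi * Im \<tau> / 12)"
proof -
  define P where "P = (\<Prod>n. 1 - e (of_nat (Suc n) * \<tau>))"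
  have hp: "(\<lambda>n. 1 - e (of_nat (Suc n) * \<tau>)) has_prod P"
    unfolding P_def by (rule convergent_prod_has_prod[OF convergent_prod_eta[OF assms]])
  have P0: "P \<noteq> 0" using has_prod_0_iff[of "\<lambda>n. 1 - e (of_nat (Suc n) * \<tau>)"] hp eta_factor_nonzero[OF assms] by blast
  show "dedekind_eta \<tau> \<noteq> 0" using P0 by (simp add: dedekind_eta_def P_def)
  have "norm (e (\<tau> / 24)) = exp (- pi * Im \<tau> / 12)" by (simp add: e_def norm_exp_eq_Re)
  hence lnP: "ln (norm P) = ln (norm (dedekind_eta \<tau>)) + pi * Im \<tau> / 12"
    using P0 by (simp add: dedekind_eta_def P_def norm_mult ln_mult)
  have "(\<lambda>n. \<Prod>i\<le>n. 1 - e (of_nat (Suc i) * \<tau>)) \<longlonglongrightarrow> P" by (rule has_prod_imp_tendsto[OF hp])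
  hence "(\<lambda>n. ln (norm (\<Prod>i\<le>n. 1 - e (of_nat (Suc i) * \<tau>)))) \<longlonglongrightarrow> ln (norm P)"
    using P0 by (intro tendsto_ln tendsto_norm) auto
  also have "(\<lambda>n. ln (norm (\<Prod>i\<le>n. 1 - e (of_nat (Suc i) * \<tau>)))) = (\<lambda>n. \<Sum>i\<le>n. ln (norm (1 - e (of_nat (Suc i) * \<tau>))))"
    using eta_factor_nonzero[OF assms] by (simp add: prod_norm [symmetric] ln_prod)
  finally show "(\<lambda>n. ln (norm (1 - e (of_nat (Suc n) * \<tau>)))) sums (ln (norm (dedekind_eta \<tau>)) + pi * Im \<tau> / 12)"
    unfolding sums_def_le lnP .
qed

text \<open>One double series in powers of \<open>e \<tau>\<close>, summed in both orders: over
  \<open>k\<close> first it gives the Lambert series produced by the cotangent rows, over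
  \<open>n\<close> first the logarithms of the eta factors.\<close>

lemma lambert_sum_eq:
  assumes \<tau>: "Im \<tau> > 0"
  shows "((\<lambda>n. Re (e (of_nat (Suc n) * \<tau>) / (1 - e (of_nat (Suc n) * \<tau>))) / real (Suc n))
     has_sum - (ln (norm (dedekind_eta \<tau>)) + pi * Im \<tau> / 12)) UNIV"
    and "((\<lambda>k. ln (norm (1 - e (of_nat (Suc k) * \<tau>)))) has_sum (ln (norm (dedekind_eta \<tau>)) + pi * Im \<tau> / 12)) UNIV"
proof -
  define q where "q = e \<tau>"
  define x where "x = norm q"
  have x: "0 < x" "x < 1" using norm_e_lt_1[OF \<tau>] by (auto simp: x_def q_def)
  define f where "f = (\<lambda>(n, k). Re (q ^ (Suc n * Suc k)) / real (Suc n))"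
  have row: "((\<lambda>k. f (n, k)) has_sum Re (e (of_nat (Suc n) * \<tau>) / (1 - e (of_nat (Suc n) * \<tau>))) / real (Suc n)) UNIV" for n
  proof -
    define w where "w = q ^ Suc n"
    have nw: "norm w < 1" using power_Suc_less_one[OF x, of n] by (simp add: w_def norm_power x_def del: power_Suc)
    have "(\<lambda>k. w ^ k) sums (1 / (1 - w))" using nw by (rule geometric_sums)
    hence s: "(\<lambda>k. w * w ^ k) sums (w * (1 / (1 - w)))" by (rule sums_mult)
    have "summable (\<lambda>k. norm (w * w ^ k))"
      using nw by (simp add: norm_mult norm_power summable_mult summable_geometric)
    from norm_summable_imp_has_sum[OF this s] have "((\<lambda>k. w * w ^ k) has_sum (w / (1 - w))) UNIV" by simp
    hence "((\<lambda>k. Re (w * w ^ k) / real (Suc n)) has_sum (Re (w / (1 - w)) / real (Suc n))) UNIV"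
      by (intro has_sum_divide_const has_sum_Re)
    moreover have "w * w ^ k = q ^ (Suc n * Suc k)" for k
      by (simp only: w_def power_mult power_Suc)
    ultimately show ?thesis by (simp only: f_def prod.case w_def q_def e_of_nat_mult)
  qed
  have col: "((\<lambda>n. f (n, k)) has_sum (- ln (norm (1 - e (of_nat (Suc k) * \<tau>))))) UNIV" for k
  proof -
    define w where "w = q ^ Suc k"
    have nw: "norm w < 1" using power_Suc_less_one[OF x, of k] by (simp add: w_def norm_power x_def del: power_Suc)
    have "summable (\<lambda>n. norm (Re (w ^ Suc n) / real (Suc n)))"
    proof (rule summable_comparison_test')
      show "summable (\<lambda>n. norm w ^ Suc n)"
        using nw by (intro summable_Suc_iff[THEN iffD2] summable_geometric) auto
      fix n
      have "\<bar>Re (w ^ Suc n)\<bar> / real (Suc n) \<le> norm (w ^ Suc n) / 1"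
        by (intro frac_le abs_Re_le_cmod) auto
      thus "norm (norm (Re (w ^ Suc n) / real (Suc n))) \<le> norm w ^ Suc n" by (simp add: norm_power norm_mult)
    qed
    from norm_summable_imp_has_sum[OF this ln_norm_1_minus_sums[OF nw]]
    have "((\<lambda>n. Re (w ^ Suc n) / real (Suc n)) has_sum (- ln (norm (1 - w)))) UNIV" .
    moreover have "w ^ Suc n = q ^ (Suc n * Suc k)" for n
      by (simp only: w_def power_mult [symmetric] mult.commute)
    ultimately show ?thesis by (simp only: f_def prod.case w_def q_def e_of_nat_mult)
  qed
  have "(\<lambda>(n, k). x ^ Suc n * x ^ k) summable_on UNIV \<times> UNIV"
  proof (rule summable_on_SigmaI)
    show "((\<lambda>k. case (n, k) of (n, k) \<Rightarrow> x ^ Suc n * x ^ k) has_sum (x ^ Suc n * (1 / (1 - x)))) UNIV" for n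
      unfolding prod.case using x
      by (intro has_sum_cmult_right norm_summable_imp_has_sum geometric_sums) (auto intro: summable_geometric simp: norm_power)
    show "(\<lambda>n. x ^ Suc n * (1 / (1 - x))) summable_on UNIV"
      using x by (intro summable_on_cmult_left norm_summable_imp_summable_on summable_Suc_iff[THEN iffD2])
        (auto intro: summable_geometric simp: norm_power)
  qed (use x in auto)
  hence sm: "f summable_on UNIV \<times> UNIV"
  proof (rule abs_summable_summable[OF summable_on_comparison_test])
    fix z :: "nat \<times> nat"
    obtain n k where z: "z = (n, k)" by (cases z)
    have "\<bar>Re (q ^ (Suc n * Suc k))\<bar> / real (Suc n) \<le> norm (q ^ (Suc n * Suc k)) / 1"
      by (intro frac_le abs_Re_le_cmod) auto
    also have "\<dots> = x ^ (Suc n * Suc k)" by (simp add: norm_power norm_mult x_def)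
    \<comment> \<open>\<open>(n + 1)(k + 1) \<ge> n + 1 + k\<close>, so a product of two geometric
      series dominates.\<close>
    also have "\<dots> \<le> x ^ (Suc n + k)" using x by (intro power_decreasing) auto
    finally show "norm (f z) \<le> (case z of (n, k) \<Rightarrow> x ^ Suc n * x ^ k)"
      by (simp add: f_def z power_add)
  qed auto
  have tot: "(f has_sum infsum f (UNIV \<times> UNIV)) (UNIV \<times> UNIV)" using sm by (rule has_sum_infsum)
  from has_sum_SigmaD[OF tot row]
  have 1: "((\<lambda>n. Re (e (of_nat (Suc n) * \<tau>) / (1 - e (of_nat (Suc n) * \<tau>))) / real (Suc n)) has_sum infsum f (UNIV \<times> UNIV)) UNIV" .
  have "((\<lambda>(k, n). f (n, k)) has_sum infsum f (UNIV \<times> UNIV)) (UNIV \<times> UNIV)"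
    using tot has_sum_swap[where f = f and A = UNIV and B = UNIV] by blast
  from has_sum_SigmaD[OF this, of "\<lambda>k. - ln (norm (1 - e (of_nat (Suc k) * \<tau>)))"] col
  have neg: "((\<lambda>k. - ln (norm (1 - e (of_nat (Suc k) * \<tau>)))) has_sum infsum f (UNIV \<times> UNIV)) UNIV" by simp
  from has_sum_imp_sums[OF this] have eq: "infsum f (UNIV \<times> UNIV) = - (ln (norm (dedekind_eta \<tau>)) + pi * Im \<tau> / 12)"
    using sums_minus[OF eta_log_sums(2)[OF \<tau>]] sums_unique2 by blast
  show "((\<lambda>n. Re (e (of_nat (Suc n) * \<tau>) / (1 - e (of_nat (Suc n) * \<tau>))) / real (Suc n))
     has_sum - (ln (norm (dedekind_eta \<tau>)) + pi * Im \<tau> / 12)) UNIV"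
    using 1 unfolding eq .
  show "((\<lambda>k. ln (norm (1 - e (of_nat (Suc k) * \<tau>)))) has_sum (ln (norm (dedekind_eta \<tau>)) + pi * Im \<tau> / 12)) UNIV"
    using has_sum_uminus[THEN iffD2, OF neg[unfolded eq]] by (simp add: has_sum_uminus)
qed

text \<open>The limit may be taken term by term and the result summed by rows. In row
  \<open>c\<close> the cotangent evaluates the lattice sum, the integral removes its main term
  \<open>pi / (c y)\<close>, and the Lambert term of \<open>c\<close> remains.\<close>

lemma kron_diff_limit:
  assumes \<tau>: "Im \<tau> > 0"
  shows "(\<lambda>k. \<Sum>\<^sub>\<infinity>z\<in>upper_rows. kron_a \<tau> (s_seq k) z - kron_p \<tau> (s_seq k) z)
    \<longlonglongrightarrow> - 2 * pi / Im \<tau> * (ln (norm (dedekind_eta \<tau>)) + pi * Im \<tau> / 12)"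
proof -
  define y where "y = Im \<tau>"
  have y: "y > 0" using \<tau> by (simp add: y_def)
  \<comment> \<open>The value of \<open>kron_P\<close> at \<open>s = 1\<close>: an arctangent
    primitive of \<open>1 / (t^2 + (c y)^2)\<close>, normalized to vanish at minus infinity.\<close>
  define P where "P = (\<lambda>c t. (1 / (of_int c * y)) * (arctan (t / (of_int c * y)) + pi/2))"
  define g where "g = (\<lambda>(c, d). 1 / lattice_Q \<tau> c d 0 - (P c (of_int c * Re \<tau> + of_int d + 1) - P c (of_int c * Re \<tau> + of_int d)))"
  obtain K where K: "\<And>s z. s > 1 \<Longrightarrow> s \<le> 2 \<Longrightarrow> z \<in> upper_rows \<Longrightarrow>
    \<bar>kron_a \<tau> s z - kron_p \<tau> s z\<bar> \<le> K * (case z of (c, d) \<Rightarrow> ((1 + \<bar>of_int c\<bar>) * (1 + \<bar>of_int d\<bar>)) powr (- (3/2)))"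
    by (fact kron_diff_bound[OF \<tau>])
  have P: "(\<lambda>k. kron_P \<tau> (s_seq k) c t) \<longlonglongrightarrow> P c t" if c: "c \<ge> 1" for c t
  proof -
    have r: "of_int c * y > 0" using c y by simp
    have "(\<lambda>k. (of_int c * y) powr (1 - 2 * s_seq k) * kron_prim (s_seq k) (arctan (t / (of_int c * y))))
       \<longlonglongrightarrow> (of_int c * y) powr (1 - 2 * 1) * (arctan (t / (of_int c * y)) + pi/2)"
      using r arctan_lbound arctan_ubound
      by (intro tendsto_mult tendsto_powr tendsto_diff tendsto_const s_seq_tendsto kron_prim_tendsto) (auto intro: less_imp_le)
    also have "(of_int c * y) powr (1 - 2 * 1) = 1 / (of_int c * y)" using r by (simp add: powr_minus_divide)
    finally show ?thesis by (simp add: kron_P_def[OF \<tau>] P_def y_def)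
  qed
  have lim: "(\<lambda>k. kron_a \<tau> (s_seq k) z - kron_p \<tau> (s_seq k) z) \<longlonglongrightarrow> g z" if z: "z \<in> upper_rows" for z
  proof -
    obtain c d where cd: "z = (c, d)" by (cases z)
    have c: "c \<ge> 1" using z by (simp add: cd)
    have Q: "lattice_Q \<tau> c d 0 > 0" using c by (intro lattice_Q_pos[OF \<tau>]) auto
    have "(\<lambda>k. lattice_Q \<tau> c d 0 powr (- s_seq k)) \<longlonglongrightarrow> lattice_Q \<tau> c d 0 powr (- 1)"
      using Q by (intro tendsto_intros s_seq_tendsto) auto
    also have "lattice_Q \<tau> c d 0 powr (- 1) = 1 / lattice_Q \<tau> c d 0" using Q by (simp add: powr_minus_divide)
    finally show ?thesis unfolding cd kron_a_def[OF \<tau>] kron_p_def[OF \<tau>] g_def prod.case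
      by (intro tendsto_diff P c)
  qed
  have le: "\<bar>kron_a \<tau> (s_seq k) z - kron_p \<tau> (s_seq k) z\<bar> \<le> K * (case z of (c, d) \<Rightarrow> ((1 + \<bar>of_int c\<bar>) * (1 + \<bar>of_int d\<bar>)) powr (- (3/2)))"
    if "z \<in> upper_rows" for k z by (rule K[OF s_seq_gt s_seq_le that])
  have sm: "(\<lambda>z. K * (case z of (c, d) \<Rightarrow> ((1 + \<bar>of_int c\<bar>) * (1 + \<bar>of_int d\<bar>)) powr (- (3/2)))) summable_on upper_rows"
    by (intro summable_on_cmult_right summable_on_int_product_powr) auto
  note dom = tendsto_infsum_dominated[OF lim le sm]
  have row: "(\<Sum>\<^sub>\<infinity>d. g (c, d)) = 2 * pi / y * (Re (e (of_int c * \<tau>) / (1 - e (of_int c * \<tau>))) / of_int c)" if c: "c \<ge> 1" for c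
  proof -
    define \<theta> where "\<theta> = of_int c * Re \<tau>"
    define r where "r = of_int c * y"
    have r: "r > 0" using c y by (simp add: r_def)
    have Im: "Im (of_int c * \<tau>) = r" by (simp add: r_def y_def)
    have gs: "(\<lambda>d. g (c, d)) summable_on UNIV"
      using summable_on_SigmaD1[of "\<lambda>c d. g (c, d)" "{1..}" "\<lambda>_. UNIV" c] dom(1) c by simp
    \<comment> \<open>A single row still converges at \<open>s = 1\<close>, so within it the lattice
      sum and the integral may be separated.\<close>
    have qs: "(\<lambda>d. 1 / lattice_Q \<tau> c d 0) summable_on UNIV"
    proof -
      define K1 where "K1 = 4 * (1 + \<theta>\<^sup>2 + r\<^sup>2) * (1 + 1 / r\<^sup>2)"
      have 2: "(\<lambda>d::int. K1 * (1 + \<bar>of_int d\<bar>) powr (- 2)) summable_on UNIV"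
        by (intro summable_on_cmult_right summable_on_int_powr) auto
      show ?thesis
      proof (rule summable_on_comparison_test[OF 2])
        fix d :: int
        define Z where "Z = \<theta> + of_int d"
        have Q: "lattice_Q \<tau> c d 0 = Z\<^sup>2 + r\<^sup>2" by (simp add: lattice_Q_def Z_def \<theta>_def r_def y_def)
        have Qp: "Z\<^sup>2 + r\<^sup>2 > 0" using r by (simp add: add_nonneg_pos)
        show "0 \<le> 1 / lattice_Q \<tau> c d 0" unfolding Q using Qp by simp
        have "1 + \<bar>of_int d\<bar> \<le> (1 + \<bar>\<theta>\<bar>) + \<bar>Z\<bar>" by (simp add: Z_def)
        hence "(1 + \<bar>of_int d\<bar>)\<^sup>2 \<le> ((1 + \<bar>\<theta>\<bar>) + \<bar>Z\<bar>)\<^sup>2" by (intro power_mono) auto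
        also have "\<dots> \<le> 2 * (1 + \<bar>\<theta>\<bar>)\<^sup>2 + 2 * Z\<^sup>2"
          using sum_squares_bound[of "1 + \<bar>\<theta>\<bar>" "\<bar>Z\<bar>"] by (simp add: power2_sum)
        also have "\<dots> \<le> 2 * (2 + 2 * \<theta>\<^sup>2) + 2 * Z\<^sup>2"
          using sum_squares_bound[of 1 "\<bar>\<theta>\<bar>"] by (simp add: power2_sum)
        also have "\<dots> \<le> 4 * (1 + \<theta>\<^sup>2 + r\<^sup>2) * (1 + Z\<^sup>2)"
        proof -
          have "0 \<le> \<theta>\<^sup>2 * Z\<^sup>2" "0 \<le> r\<^sup>2 * Z\<^sup>2" by auto
          thus ?thesis by (simp add: algebra_simps)
        qed
        also have "1 + Z\<^sup>2 \<le> (1 + 1 / r\<^sup>2) * (Z\<^sup>2 + r\<^sup>2)" using r by (simp add: field_simps)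
        finally have "(1 + \<bar>of_int d\<bar>)\<^sup>2 \<le> K1 * (Z\<^sup>2 + r\<^sup>2)"
          by (simp add: K1_def mult_left_mono mult.assoc)
        hence "1 / (Z\<^sup>2 + r\<^sup>2) \<le> K1 / (1 + \<bar>of_int d\<bar>)\<^sup>2"
          using Qp by (simp add: field_simps)
        thus "1 / lattice_Q \<tau> c d 0 \<le> K1 * (1 + \<bar>of_int d\<bar>) powr (- 2)"
          unfolding Q by (simp add: powr_minus_divide)
      qed
    qed
    define h where "h = (\<lambda>d::int. P c (\<theta> + of_int d + 1) - P c (\<theta> + of_int d))"
    have g: "g (c, d) = 1 / lattice_Q \<tau> c d 0 - h d" for d by (simp add: g_def h_def \<theta>_def)
    have hs: "h summable_on UNIV"
      using summable_on_add[OF qs summable_on_uminus[THEN iffD2, OF gs]] by (simp add: g)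
    have "(\<lambda>m. P c (\<theta> + real m) - P c (\<theta> - real m)) \<longlonglongrightarrow> (\<Sum>\<^sub>\<infinity>d. h d)"
      using infsum_int_LIMSEQ[OF hs] unfolding h_def telescope_int_sum .
    moreover have "(\<lambda>m. P c (\<theta> + real m) - P c (\<theta> - real m)) \<longlonglongrightarrow> 1 / r * (pi/2 + pi/2) - 1 / r * (- (pi/2) + pi/2)"
      unfolding P_def r_def [symmetric]
    proof (intro tendsto_intros)
      have "filterlim (\<lambda>m. (\<theta> + real m) / r) at_top sequentially" using r by real_asymp
      thus "(\<lambda>m. arctan ((\<theta> + real m) / r)) \<longlonglongrightarrow> pi/2" by (rule filterlim_compose[OF tendsto_arctan_at_top])
      have "filterlim (\<lambda>m. (\<theta> - real m) / r) at_bot sequentially" using r by real_asymp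
      thus "(\<lambda>m. arctan ((\<theta> - real m) / r)) \<longlonglongrightarrow> - (pi/2)" by (rule filterlim_compose[OF tendsto_arctan_at_bot])
    qed
    ultimately have h: "(\<Sum>\<^sub>\<infinity>d. h d) = pi / r" using LIMSEQ_unique by fastforce
    have "(\<Sum>\<^sub>\<infinity>d. 1 / lattice_Q \<tau> c d 0) = pi / r * (1 + 2 * Re (e (of_int c * \<tau>) / (1 - e (of_int c * \<tau>))))"
      using infsum_inverse_norm_square[of "of_int c * \<tau>"] qs r unfolding Im norm_square_conv_lattice_Q by simp
    moreover have "(\<Sum>\<^sub>\<infinity>d. 1 / lattice_Q \<tau> c d 0) = (\<Sum>\<^sub>\<infinity>d. g (c, d) + h d)" by (simp add: g)
    moreover have "\<dots> = (\<Sum>\<^sub>\<infinity>d. g (c, d)) + (\<Sum>\<^sub>\<infinity>d. h d)" by (rule infsum_add[OF gs hs])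
    ultimately have "(\<Sum>\<^sub>\<infinity>d. g (c, d)) = pi / r * (2 * Re (e (of_int c * \<tau>) / (1 - e (of_int c * \<tau>))))"
      unfolding h by (simp add: algebra_simps)
    thus ?thesis by (simp add: r_def mult_ac)
  qed
  have "(\<Sum>\<^sub>\<infinity>z\<in>upper_rows. g z) = (\<Sum>\<^sub>\<infinity>c\<in>{1..}. \<Sum>\<^sub>\<infinity>d. g (c, d))"
    by (rule infsum_Sigma_banach[OF dom(1), symmetric])
  also have "\<dots> = (\<Sum>\<^sub>\<infinity>c\<in>{1..}. 2 * pi / y * (Re (e (of_int c * \<tau>) / (1 - e (of_int c * \<tau>))) / of_int c))"
    by (rule infsum_cong) (simp add: row)
  also have "\<dots> = 2 * pi / y * (\<Sum>\<^sub>\<infinity>c\<in>{1::int..}. Re (e (of_int c * \<tau>) / (1 - e (of_int c * \<tau>))) / of_int c)"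
    by (rule infsum_cmult_right')
  also have "(\<Sum>\<^sub>\<infinity>c\<in>{1::int..}. Re (e (of_int c * \<tau>) / (1 - e (of_int c * \<tau>))) / of_int c)
      = - (ln (norm (dedekind_eta \<tau>)) + pi * Im \<tau> / 12)"
    using lambert_sum_eq(1)[OF \<tau>] by (intro infsumI int_1_has_sum_conv[THEN iffD2]) simp
  finally have "(\<Sum>\<^sub>\<infinity>z\<in>upper_rows. g z) = 2 * pi / y * - (ln (norm (dedekind_eta \<tau>)) + pi * Im \<tau> / 12)" .
  also have "\<dots> = - 2 * pi / Im \<tau> * (ln (norm (dedekind_eta \<tau>)) + pi * Im \<tau> / 12)"
    unfolding y_def by (simp only: minus_mult_right minus_mult_left times_divide_eq_left times_divide_eq_right divide_minus_left minus_divide_left)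
  finally have eq: "(\<Sum>\<^sub>\<infinity>z\<in>upper_rows. g z) = - 2 * pi / Im \<tau> * (ln (norm (dedekind_eta \<tau>)) + pi * Im \<tau> / 12)" .
  show ?thesis using dom(2) unfolding eq .
qed

lemma kronecker_limit:
  assumes \<tau>: "Im \<tau> > 0"
  shows "(\<lambda>k. eisenstein \<tau> (s_seq k) - 2 * kron_prim (s_seq k) (pi/2) * zeta_int (2 * s_seq k - 1))
    \<longlonglongrightarrow> - pi * ln (Im \<tau> * norm (dedekind_eta \<tau>) ^ 4)"
proof -
  define y where "y = Im \<tau>"
  have y: "y > 0" using \<tau> by (simp add: y_def)
  define N where "N = norm (dedekind_eta \<tau>)"
  have N: "N > 0" using eta_log_sums(1)[OF \<tau>] by (simp add: N_def)
  have kap: "(\<lambda>k. kron_prim (s_seq k) (pi/2)) \<longlonglongrightarrow> pi"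
    using kron_prim_tendsto[of "pi/2"] by simp
  have ypow: "(\<lambda>k. y powr s_seq k) \<longlonglongrightarrow> y"
    using tendsto_powr[OF tendsto_const s_seq_tendsto, of y] y by simp
  have z2: "(\<lambda>k. zeta_int (2 * s_seq k)) \<longlonglongrightarrow> pi\<^sup>2 / 6"
  proof -
    have "(\<lambda>k. \<Sum>\<^sub>\<infinity>c\<in>{1::int..}. of_int c powr (- (2 * s_seq k))) \<longlonglongrightarrow> (\<Sum>\<^sub>\<infinity>c\<in>{1::int..}. of_int c powr (- (2 * 1)))"
    proof (rule tendsto_infsum_dominated(2)[where M = "\<lambda>c. of_int c powr (- 2)"])
      show "(\<lambda>c::int. real_of_int c powr (- 2)) summable_on {1..}"
        using zeta_int_has_sum[of 2] by (auto intro: has_sum_imp_summable)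
      fix c :: int assume c: "c \<in> {1..}"
      show "(\<lambda>k. of_int c powr (- (2 * s_seq k))) \<longlonglongrightarrow> real_of_int c powr (- (2 * 1))"
        using c by (intro tendsto_intros s_seq_tendsto) auto
      show "\<bar>real_of_int c powr (- (2 * s_seq k))\<bar> \<le> of_int c powr (- 2)" for k
        using c s_seq_gt[of k] by (auto intro!: powr_mono)
    qed
    also have "(\<Sum>\<^sub>\<infinity>c\<in>{1::int..}. of_int c powr (- (2 * 1))) = pi\<^sup>2 / 6"
    proof (rule infsumI, rule int_1_has_sum_conv[THEN iffD2])
      have "(\<lambda>n. 1 / (real n + 1)\<^sup>2) sums (pi\<^sup>2 / 6)" using inverse_squares_sums by (simp add: add.commute)
      hence "((\<lambda>n. 1 / (real n + 1)\<^sup>2) has_sum (pi\<^sup>2 / 6)) UNIV"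
        by (intro norm_summable_imp_has_sum) (auto simp: sums_iff)
      thus "((\<lambda>n. of_int (int (Suc n)) powr (- (2 * 1))) has_sum pi\<^sup>2 / 6) UNIV"
        by (simp add: powr_minus_divide add.commute)
    qed
    finally show ?thesis by (simp add: zeta_int_def)
  qed
  \<comment> \<open>A difference quotient at 0 with limit \<open>- ln y\<close>, times
    \<open>(s - 1) \<zeta>(2 s - 1)\<close> with limit 1/2; the half comes from the argument
    \<open>2 s - 1\<close>.\<close>
  have pole: "(\<lambda>k. (y powr (1 - s_seq k) - 1) * zeta_int (2 * s_seq k - 1)) \<longlonglongrightarrow> - ln y * (1/2)"
  proof -
    have "(\<lambda>k. (y powr (- (s_seq k - 1)) - 1) / (s_seq k - 1)) \<longlonglongrightarrow> - ln y"
    proof -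
      have "((\<lambda>h. y powr (- h)) has_real_derivative - ln y) (at 0)"
        using y by (auto intro!: derivative_eq_intros)
      hence "((\<lambda>h. (y powr (- h) - 1) / h) \<longlongrightarrow> - ln y) (at 0)"
        using y by (simp add: DERIV_def)
      moreover have "filterlim (\<lambda>k. s_seq k - 1) (at 0) sequentially"
        using tendsto_diff[OF s_seq_tendsto tendsto_const[of 1]] s_seq_gt
        by (auto simp: filterlim_at less_imp_neq[symmetric])
      ultimately show ?thesis by (rule filterlim_compose)
    qed
    moreover have "(\<lambda>k. (s_seq k - 1) * zeta_int (2 * s_seq k - 1)) \<longlonglongrightarrow> 1/2"
    proof (rule tendsto_sandwich)
      have half: "x \<le> b / 2" if "2 * x \<le> b" for x b :: real using that by simp
      have gt: "2 * s_seq k - 1 > 1" for k using s_seq_gt[of k] by simp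
      show "\<forall>\<^sub>F k in sequentially. 1/2 \<le> (s_seq k - 1) * zeta_int (2 * s_seq k - 1)"
      proof (intro always_eventually allI)
        fix k
        have "(2 * s_seq k - 1 - 1) * zeta_int (2 * s_seq k - 1) = 2 * ((s_seq k - 1) * zeta_int (2 * s_seq k - 1))"
          by (simp add: algebra_simps)
        thus "1/2 \<le> (s_seq k - 1) * zeta_int (2 * s_seq k - 1)"
          using zeta_int_bounds(1)[OF gt[of k]] by linarith
      qed
      show "\<forall>\<^sub>F k in sequentially. (s_seq k - 1) * zeta_int (2 * s_seq k - 1) \<le> (2 * s_seq k - 1) / 2"
      proof (intro always_eventually allI)
        fix k
        have "(2 * s_seq k - 1 - 1) * zeta_int (2 * s_seq k - 1) = 2 * ((s_seq k - 1) * zeta_int (2 * s_seq k - 1))"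
          by (simp add: algebra_simps)
        with zeta_int_bounds(2)[OF gt[of k]]
        have "2 * ((s_seq k - 1) * zeta_int (2 * s_seq k - 1)) \<le> 2 * s_seq k - 1" by (simp only:)
        thus "(s_seq k - 1) * zeta_int (2 * s_seq k - 1) \<le> (2 * s_seq k - 1) / 2" by (rule half)
      qed
      show "(\<lambda>k. (2 * s_seq k - 1) / 2) \<longlonglongrightarrow> 1/2"
        by (rule tendsto_eq_intros s_seq_tendsto refl | simp)+
    qed auto
    ultimately have "(\<lambda>k. (y powr (- (s_seq k - 1)) - 1) / (s_seq k - 1) * ((s_seq k - 1) * zeta_int (2 * s_seq k - 1)))
       \<longlonglongrightarrow> - ln y * (1/2)" by (rule tendsto_mult)
    moreover have "s_seq k - 1 \<noteq> 0" for k using s_seq_gt[of k] by simp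
    ultimately show ?thesis by simp
  qed
  have "(\<lambda>k. eisenstein \<tau> (s_seq k) - 2 * kron_prim (s_seq k) (pi/2) * zeta_int (2 * s_seq k - 1))
    \<longlonglongrightarrow> 2 * y * (pi\<^sup>2 / 6) + 2 * y * (- 2 * pi / y * (ln N + pi * y / 12)) + 2 * pi * (- ln y * (1/2))"
    unfolding eisenstein_s_seq_eq[OF \<tau>] y_def [symmetric]
    by (intro tendsto_intros ypow z2 kron_diff_limit[OF \<tau>, folded y_def N_def] kap pole)
  \<comment> \<open>The term \<open>pi^2 y / 3\<close> from \<open>\<zeta>(2)\<close> cancels
    against the exponential prefactor of eta.\<close>
  also have "2 * y * (pi\<^sup>2 / 6) + 2 * y * (- 2 * pi / y * (ln N + pi * y / 12)) + 2 * pi * (- ln y * (1/2))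
     = - pi * (ln y + 4 * ln N)"
    using y by (simp add: field_simps power2_eq_square)
  also have "ln y + 4 * ln N = ln (y * N ^ 4)" using y N by (simp add: ln_mult ln_realpow)
  finally show ?thesis by (simp add: y_def N_def)
qed

section \<open>Modular invariance of \<open>y \<bar>\<eta>\<bar>^4\<close>\<close>

lemma eisenstein_SL2Z:
  assumes \<tau>: "Im \<tau> > 0" and A: "A \<in> SL2Z"
  shows "eisenstein (moebius A \<tau>) s = eisenstein \<tau> s"
proof -
  define a b c d where "a = A $ 1 $ 1" and "b = A $ 1 $ 2" and "c = A $ 2 $ 1" and "d = A $ 2 $ 2"
  have det: "a * d - b * c = 1" using A by (simp add: int_mats_det_def det_2 a_def b_def c_def d_def)
  have dA: "det A > 0" using A by (simp add: int_mats_det_def)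
  define j where "j = of_int c * \<tau> + of_int d"
  have j: "j \<noteq> 0" unfolding j_def c_def d_def by (rule moebius_denom_nonzero[OF dA \<tau>])
  have Im: "Im (moebius A \<tau>) = Im \<tau> / (norm j)\<^sup>2"
    using Im_moebius[OF dA \<tau>] A by (simp add: int_mats_det_def j_def c_def d_def)
  have Q: "lattice_Q (moebius A \<tau>) m n 0 = lattice_Q \<tau> (m * a + n * c) (m * b + n * d) 0 / (norm j)\<^sup>2" for m n
  proof -
    have "of_int m * moebius A \<tau> + of_int n = (of_int (m * a + n * c) * \<tau> + of_int (m * b + n * d)) / j"
      using j by (simp add: moebius_def j_def a_def b_def c_def d_def field_simps)
    thus ?thesis unfolding norm_square_conv_lattice_Q [symmetric] by (simp add: norm_divide power_divide)
  qed
  have J: "(norm j)\<^sup>2 > 0" using j by simp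
  have "(\<Sum>\<^sub>\<infinity>(m, n)\<in>UNIV - {(0, 0)}. lattice_Q (moebius A \<tau>) m n 0 powr (- s)) =
     (\<Sum>\<^sub>\<infinity>(m, n)\<in>UNIV - {(0, 0)}. lattice_Q \<tau> m n 0 powr (- s) * ((norm j)\<^sup>2) powr s)"
  proof (rule infsum_reindex_bij_witness[of _ "\<lambda>(m, n). (m * d - n * c, n * a - m * b)" "\<lambda>(m, n). (m * a + n * c, m * b + n * d)"])
    have 1: "(m * a + n * c) * d - (m * b + n * d) * c = m" "(m * b + n * d) * a - (m * a + n * c) * b = n" for m n
    proof -
      have "(m * a + n * c) * d - (m * b + n * d) * c = m * (a * d - b * c)" by (simp add: algebra_simps)
      thus "(m * a + n * c) * d - (m * b + n * d) * c = m" by (simp add: det)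
      have "(m * b + n * d) * a - (m * a + n * c) * b = n * (a * d - b * c)" by (simp add: algebra_simps)
      thus "(m * b + n * d) * a - (m * a + n * c) * b = n" by (simp add: det)
    qed
    have 2: "(m * d - n * c) * a + (n * a - m * b) * c = m" "(m * d - n * c) * b + (n * a - m * b) * d = n" for m n
    proof -
      have "(m * d - n * c) * a + (n * a - m * b) * c = m * (a * d - b * c)" by (simp add: algebra_simps)
      thus "(m * d - n * c) * a + (n * a - m * b) * c = m" by (simp add: det)
      have "(m * d - n * c) * b + (n * a - m * b) * d = n * (a * d - b * c)" by (simp add: algebra_simps)
      thus "(m * d - n * c) * b + (n * a - m * b) * d = n" by (simp add: det)
    qed
    fix z :: "int \<times> int" assume z: "z \<in> UNIV - {(0, 0)}"
    obtain m n where mn: "z = (m, n)" by (cases z)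
    show "(case case z of (m, n) \<Rightarrow> (m * a + n * c, m * b + n * d) of (m, n) \<Rightarrow> (m * d - n * c, n * a - m * b)) = z"
      by (simp only: mn prod.case 1)
    show "(case case z of (m, n) \<Rightarrow> (m * d - n * c, n * a - m * b) of (m, n) \<Rightarrow> (m * a + n * c, m * b + n * d)) = z"
      by (simp only: mn prod.case 2)
    show "(case z of (m, n) \<Rightarrow> (m * a + n * c, m * b + n * d)) \<in> UNIV - {(0, 0)}"
      using z 1[of m n] by (auto simp: mn)
    show "(case z of (m, n) \<Rightarrow> (m * d - n * c, n * a - m * b)) \<in> UNIV - {(0, 0)}"
      using z 2[of m n] by (auto simp: mn)
    show "(case case z of (m, n) \<Rightarrow> (m * a + n * c, m * b + n * d) of (m, n) \<Rightarrow> lattice_Q \<tau> m n 0 powr (- s) * ((norm j)\<^sup>2) powr s) =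
      (case z of (m, n) \<Rightarrow> lattice_Q (moebius A \<tau>) m n 0 powr (- s))"
      using J by (simp add: mn Q powr_divide powr_minus_divide)
  qed
  also have "\<dots> = (\<Sum>\<^sub>\<infinity>z\<in>UNIV - {(0, 0)}. (case z of (m, n) \<Rightarrow> lattice_Q \<tau> m n 0 powr (- s)) * ((norm j)\<^sup>2) powr s)"
    by (simp add: case_prod_unfold)
  also have "\<dots> = (\<Sum>\<^sub>\<infinity>(m, n)\<in>UNIV - {(0, 0)}. lattice_Q \<tau> m n 0 powr (- s)) * ((norm j)\<^sup>2) powr s"
    by (rule infsum_cmult_left')
  finally show ?thesis unfolding eisenstein_def Im using J \<tau> by (simp add: powr_divide)
qed

text \<open>The Eisenstein sum is invariant and the subtracted pole term does not depend on
  \<open>\<tau>\<close>, so the two limits are limits of the same sequence.\<close>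

lemma eta_SL2Z:
  assumes \<tau>: "Im \<tau> > 0" and A: "A \<in> SL2Z"
  shows "ln (Im (moebius A \<tau>) * norm (dedekind_eta (moebius A \<tau>)) ^ 4) = ln (Im \<tau> * norm (dedekind_eta \<tau>) ^ 4)"
proof -
  have "Im (moebius A \<tau>) > 0" using A \<tau> by (intro Im_moebius_pos) (auto simp: int_mats_det_def)
  from LIMSEQ_unique[OF kronecker_limit[OF this, unfolded eisenstein_SL2Z[OF \<tau> A]] kronecker_limit[OF \<tau>]]
  show ?thesis by simp
qed

lemma JJ1_0_SL2Z:
  assumes "Im \<tau> > 0" "A \<in> SL2Z"
  shows "JJ1 0 (moebius A \<tau>) = JJ1 0 \<tau>"
  using eta_SL2Z[OF assms] by (simp add: JJ1_def)

section \<open>The Hecke sum of the logarithm of eta\<close>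

lemma sum_ln_norm_root_twists:
  fixes n :: int
  assumes p: "p > 0" and cop: "coprime (int p) n" and w: "norm w < 1"
  shows "(\<Sum>j\<in>{0..<int p}. ln (norm (1 - w * ec p (j * n)))) = ln (norm (1 - w ^ p))"
proof -
  \<comment> \<open>The product formula is proved on the power series of the logarithm: summing
    powers of the roots of unity keeps only the exponents divisible by \<open>p\<close>.\<close>
  have "(\<lambda>c. \<Sum>j\<in>{0..<int p}. Re ((w * ec p (j * n)) ^ Suc c) / real (Suc c))
      sums (\<Sum>j\<in>{0..<int p}. - ln (norm (1 - w * ec p (j * n))))"
    using w by (intro sums_sum ln_norm_1_minus_sums) (simp add: norm_mult)
  also have "(\<lambda>c. \<Sum>j\<in>{0..<int p}. Re ((w * ec p (j * n)) ^ Suc c) / real (Suc c)) =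
      (\<lambda>c. if p dvd Suc c then real p * Re (w ^ Suc c) / real (Suc c) else 0)"
  proof
    fix c
    have "(\<Sum>j\<in>{0..<int p}. Re ((w * ec p (j * n)) ^ Suc c) / real (Suc c)) =
        Re (w ^ Suc c * (\<Sum>j\<in>{0..<int p}. ec p (j * (int (Suc c) * n)))) / real (Suc c)"
      unfolding sum_divide_distrib [symmetric] Re_sum [symmetric] power_mult_distrib ec_power sum_distrib_left
      by (simp only: mult.left_commute)
    also have "\<dots> = (if p dvd Suc c then real p * Re (w ^ Suc c) / real (Suc c) else 0)"
    proof -
      have "int p dvd int (Suc c) * n \<longleftrightarrow> p dvd Suc c"
        using cop by (metis coprime_dvd_mult_left_iff int_dvd_int_iff)
      thus ?thesis unfolding sum_ec[OF p] by (simp add: mult.commute)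
    qed
    finally show "(\<Sum>j\<in>{0..<int p}. Re ((w * ec p (j * n)) ^ Suc c) / real (Suc c)) =
        (if p dvd Suc c then real p * Re (w ^ Suc c) / real (Suc c) else 0)" .
  qed
  finally have 1: "(\<lambda>c. if p dvd Suc c then real p * Re (w ^ Suc c) / real (Suc c) else 0)
      sums (\<Sum>j\<in>{0..<int p}. - ln (norm (1 - w * ec p (j * n))))" .
  \<comment> \<open>Exponents are \<open>Suc c\<close>, so the multiples of \<open>p\<close> sit at
    the indices \<open>p (m + 1) - 1\<close>.\<close>
  define g where "g = (\<lambda>m. p * Suc m - 1)"
  have Sg: "Suc (g m) = p * Suc m" for m using p by (simp add: g_def)
  have mono: "strict_mono g"
  proof (rule strict_monoI)
    fix a b :: nat assume "a < b"
    hence "p * Suc a < p * Suc b" using p by simp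
    thus "g a < g b" using Sg[of a] Sg[of b] by linarith
  qed
  have "(\<lambda>m. if p dvd Suc (g m) then real p * Re (w ^ Suc (g m)) / real (Suc (g m)) else 0)
      sums (\<Sum>j\<in>{0..<int p}. - ln (norm (1 - w * ec p (j * n))))"
  proof (rule sums_mono_reindex[OF mono, THEN iffD2, OF _ 1])
    fix c assume c: "c \<notin> range g"
    have "\<not> p dvd Suc c"
    proof
      assume "p dvd Suc c"
      then obtain k where k: "Suc c = p * k" by blast
      then obtain m where "k = Suc m" by (cases k) auto
      hence "c = g m" using k by (simp add: g_def)
      thus False using c by blast
    qed
    thus "(if p dvd Suc c then real p * Re (w ^ Suc c) / real (Suc c) else 0) = 0" by simp
  qed
  also have "(\<lambda>m. if p dvd Suc (g m) then real p * Re (w ^ Suc (g m)) / real (Suc (g m)) else 0) =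
     (\<lambda>m. Re ((w ^ p) ^ Suc m) / real (Suc m))"
    unfolding Sg using p by (simp only: dvd_triv_left if_True power_mult of_nat_mult) simp
  finally have "(\<lambda>m. Re ((w ^ p) ^ Suc m) / real (Suc m)) sums (\<Sum>j\<in>{0..<int p}. - ln (norm (1 - w * ec p (j * n))))" .
  moreover have "norm (w ^ p) < 1" using w p by (simp add: norm_power power_less_one_iff)
  hence "(\<lambda>m. Re ((w ^ p) ^ Suc m) / real (Suc m)) sums (- ln (norm (1 - w ^ p)))" by (rule ln_norm_1_minus_sums)
  ultimately have "(\<Sum>j\<in>{0..<int p}. - ln (norm (1 - w * ec p (j * n)))) = - ln (norm (1 - w ^ p))"
    by (rule sums_unique2)
  thus ?thesis by (simp add: sum_negf)
qed

lemma eta_log_has_sum: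
  assumes "Im \<tau> > 0"
  shows "((\<lambda>n. ln (norm (1 - e (of_nat n * \<tau>)))) has_sum (ln (norm (dedekind_eta \<tau>)) + pi * Im \<tau> / 12)) {1..}"
proof -
  have "((\<lambda>n. ln (norm (1 - e (of_nat n * \<tau>)))) has_sum (ln (norm (dedekind_eta \<tau>)) + pi * Im \<tau> / 12)) {1..} \<longleftrightarrow>
     ((\<lambda>n. ln (norm (1 - e (of_nat (Suc n) * \<tau>)))) has_sum (ln (norm (dedekind_eta \<tau>)) + pi * Im \<tau> / 12)) UNIV"
    by (rule has_sum_reindex_bij_witness[of _ Suc "\<lambda>n. n - 1"]) auto
  thus ?thesis using lambert_sum_eq(2)[OF assms] by simp
qed

text \<open>The factors are split by whether \<open>p\<close> divides \<open>n\<close>. On multiples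
  of \<open>p\<close> all translates by \<open>j\<close> agree and contribute
  \<open>p L \<tau>\<close>; on the rest the roots of unity collapse to the factors of
  \<open>\<tau>\<close> itself. The multiples that are then missing are exactly the factors
  belonging to \<open>p \<tau>\<close>.\<close>

lemma eta_hecke_product:
  assumes p: "prime p" and \<tau>: "Im \<tau> > 0"
  shows "ln (norm (dedekind_eta (of_nat p * \<tau>))) + (\<Sum>j\<in>{0..<int p}. ln (norm (dedekind_eta ((\<tau> + of_int j) / of_nat p))))
     = (real p + 1) * ln (norm (dedekind_eta \<tau>))"
proof -
  have p0: "p > 0" using p by (simp add: prime_gt_0_nat)
  define L where "L = (\<lambda>\<tau>. ln (norm (dedekind_eta \<tau>)) + pi * Im \<tau> / 12)"
  define l where "l = (\<lambda>n. ln (norm (1 - e (of_nat n * \<tau>))))"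
  define t where "t = (\<lambda>n. \<Sum>j\<in>{0..<int p}. ln (norm (1 - e (of_nat n * ((\<tau> + of_int j) / of_nat p)))))"
  define D where "D = {n::nat. n \<ge> 1 \<and> p dvd n}"
  define N where "N = {n::nat. n \<ge> 1 \<and> \<not> p dvd n}"
  have DN: "{1..} = D \<union> N" "D \<inter> N = {}" by (auto simp: D_def N_def)
  have Im_j: "Im ((\<tau> + of_int j) / of_nat p) = Im \<tau> / real p" for j
    by (simp add: Im_divide_of_nat)
  have l: "(l has_sum L \<tau>) {1..}" unfolding l_def L_def by (rule eta_log_has_sum[OF \<tau>])
  have t: "(t has_sum (\<Sum>j\<in>{0..<int p}. L ((\<tau> + of_int j) / of_nat p))) {1..}"
    unfolding t_def L_def
    by (intro has_sum_finite_sum eta_log_has_sum) (use \<tau> p0 Im_j in auto)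
  have lD: "(l has_sum L (of_nat p * \<tau>)) D"
  proof -
    have "(l has_sum L (of_nat p * \<tau>)) D \<longleftrightarrow> ((\<lambda>n. ln (norm (1 - e (of_nat n * (of_nat p * \<tau>))))) has_sum L (of_nat p * \<tau>)) {1..}"
      using p0 by (intro has_sum_reindex_bij_witness[of _ "\<lambda>m. p * m" "\<lambda>n. n div p"])
        (auto simp: D_def l_def Suc_le_eq mult_ac elim!: dvdE)
    moreover have "((\<lambda>n. ln (norm (1 - e (of_nat n * (of_nat p * \<tau>))))) has_sum L (of_nat p * \<tau>)) {1..}"
      unfolding L_def by (rule eta_log_has_sum) (use \<tau> p0 in simp)
    ultimately show ?thesis by blast
  qed
  have tD: "(t has_sum (real p * L \<tau>)) D"
  proof -
    have "(t has_sum (real p * L \<tau>)) D \<longleftrightarrow> ((\<lambda>n. real p * l n) has_sum (real p * L \<tau>)) {1..}"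
    proof (rule has_sum_reindex_bij_witness[of _ "\<lambda>m. p * m" "\<lambda>n. n div p"])
      fix n assume "n \<in> D"
      then obtain m where m: "n = p * m" "m \<ge> 1" using p0 by (auto simp: D_def Suc_le_eq elim!: dvdE)
      have "e (of_nat n * ((\<tau> + of_int j) / of_nat p)) = e (of_nat m * \<tau>)" for j
      proof -
        have "of_nat n * ((\<tau> + of_int j) / of_nat p) = of_nat m * \<tau> + of_int (int m * j)"
          using p0 by (simp add: m field_simps)
        thus ?thesis by (simp only: e_add e_of_int mult_1_right)
      qed
      thus "real p * l (n div p) = t n" using m p0 by (simp add: t_def l_def)
    qed (use p0 in \<open>auto simp: D_def Suc_le_eq elim!: dvdE\<close>)
    thus ?thesis using has_sum_cmult_right[OF l] by simp
  qed
  have lsum: "l summable_on N" "l summable_on D"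
    by (rule summable_on_subset_banach[OF has_sum_imp_summable[OF l]], simp only: DN(1) Un_upper1 Un_upper2)+
  have tN: "t n = l n" if n: "n \<in> N" for n
  proof -
    define w where "w = e (of_nat n * (\<tau> / of_nat p))"
    have n1: "n \<ge> 1" "\<not> p dvd n" using n by (auto simp: N_def)
    have "Im (of_nat n * (\<tau> / of_nat p)) > 0" using n1 \<tau> p0 by (simp add: Im_divide_of_nat)
    hence w: "norm w < 1" unfolding w_def by (rule norm_e_lt_1)
    have "e (of_nat n * ((\<tau> + of_int j) / of_nat p)) = w * ec p (j * int n)" for j
    proof -
      have "of_nat n * ((\<tau> + of_int j) / of_nat p) = of_nat n * (\<tau> / of_nat p) + of_real (of_int (j * int n) / real p)"
        using p0 by (simp add: field_simps)
      thus ?thesis by (simp only: e_add w_def ec_def)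
    qed
    hence "t n = (\<Sum>j\<in>{0..<int p}. ln (norm (1 - w * ec p (j * int n))))" by (simp add: t_def)
    also have "\<dots> = ln (norm (1 - w ^ p))"
    proof (rule sum_ln_norm_root_twists[OF p0 _ w])
      show "coprime (int p) (int n)" using prime_imp_coprime[OF p n1(2)] by simp
    qed
    also have "w ^ p = e (of_nat n * \<tau>)" unfolding w_def e_of_nat_mult [symmetric] using p0 by simp
    finally show ?thesis by (simp add: l_def)
  qed
  have "(t has_sum infsum l N) N" using has_sum_infsum[OF lsum(1)] tN by (simp cong: has_sum_cong)
  from has_sum_Un_disjoint[OF tD this DN(2)] have "(t has_sum (real p * L \<tau> + infsum l N)) {1..}" by (simp only: DN(1))
  hence 1: "(\<Sum>j\<in>{0..<int p}. L ((\<tau> + of_int j) / of_nat p)) = real p * L \<tau> + infsum l N"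
    using t has_sum_unique by blast
  have "(l has_sum (L (of_nat p * \<tau>) + infsum l N)) {1..}"
    using has_sum_Un_disjoint[OF lD has_sum_infsum[OF lsum(1)] DN(2)] by (simp only: DN(1))
  hence 2: "L \<tau> = L (of_nat p * \<tau>) + infsum l N" using l has_sum_unique by blast
  have "L (of_nat p * \<tau>) + (\<Sum>j\<in>{0..<int p}. L ((\<tau> + of_int j) / of_nat p)) = (real p + 1) * L \<tau>"
    using 1 2 by (simp add: algebra_simps)
  \<comment> \<open>The exponential prefactors balance: \<open>p y\<close> from
    \<open>p \<tau>\<close> plus \<open>p\<close> times \<open>y / p\<close> from the translates
    equals \<open>(p + 1) y\<close>.\<close>
  moreover have "(\<Sum>j\<in>{0..<int p}. L ((\<tau> + of_int j) / of_nat p)) =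
      (\<Sum>j\<in>{0..<int p}. ln (norm (dedekind_eta ((\<tau> + of_int j) / of_nat p)))) + pi * Im \<tau> / 12"
    using p0 by (simp add: L_def Im_j sum.distrib)
  ultimately show ?thesis by (simp add: L_def algebra_simps add_divide_distrib)
qed

lemma hecke_JJ1_0:
  assumes p: "prime p" and \<tau>: "Im \<tau> > 0"
  shows "hecke p (JJ1 0) \<tau> = (of_nat p + 1) * JJ1 0 \<tau> - (of_nat p - 1) * of_real (ln (real p))"
proof -
  have p0: "p > 0" using p by (simp add: prime_gt_0_nat)
  define N where "N = (\<lambda>w. ln (norm (dedekind_eta w)))"
  have J: "JJ1 0 w = of_real (ln (Im w) + 4 * N w + 1)" if "Im w > 0" for w
    using that eta_log_sums(1)[OF that] by (simp add: JJ1_def N_def ln_mult ln_realpow)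
  have Im_j: "Im ((\<tau> + of_int j) / of_nat p) = Im \<tau> / real p" for j by (simp add: Im_divide_of_nat)
  have "hecke p (JJ1 0) \<tau> = (\<Sum>r\<in>hecke_reps p. JJ1 0 (moebius r \<tau>))"
    by (rule hecke_eq[OF p \<tau>]) (simp add: JJ1_0_SL2Z)
  also have "\<dots> = JJ1 0 (of_nat p * \<tau>) + (\<Sum>j\<in>{0..<int p}. JJ1 0 ((\<tau> + of_int j) / of_nat p))"
    by (simp add: sum_hecke_reps[OF p] moebius_mat22)
  also have "\<dots> = of_real (ln (real p * Im \<tau>) + 4 * N (of_nat p * \<tau>) + 1 +
      (\<Sum>j\<in>{0..<int p}. ln (Im \<tau> / real p) + 4 * N ((\<tau> + of_int j) / of_nat p) + 1))"
    using \<tau> p0 by (simp add: J Im_j)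
  also have "ln (real p * Im \<tau>) + 4 * N (of_nat p * \<tau>) + 1 +
      (\<Sum>j\<in>{0..<int p}. ln (Im \<tau> / real p) + 4 * N ((\<tau> + of_int j) / of_nat p) + 1) =
      ln (real p * Im \<tau>) + real p * ln (Im \<tau> / real p) + 4 * (N (of_nat p * \<tau>) + (\<Sum>j\<in>{0..<int p}. N ((\<tau> + of_int j) / of_nat p))) + real p + 1"
    by (simp add: sum.distrib sum_distrib_left [symmetric] algebra_simps)
  also have "N (of_nat p * \<tau>) + (\<Sum>j\<in>{0..<int p}. N ((\<tau> + of_int j) / of_nat p)) = (real p + 1) * N \<tau>"
    unfolding N_def by (rule eta_hecke_product[OF p \<tau>])
  \<comment> \<open>The point \<open>p \<tau>\<close> contributes \<open>ln p\<close> once, the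
    \<open>p\<close> translates contribute \<open>- ln p\<close> each: this is the constant
    \<open>- (p - 1) ln p\<close>.\<close>
  also have "ln (real p * Im \<tau>) + real p * ln (Im \<tau> / real p) + 4 * ((real p + 1) * N \<tau>) + real p + 1 =
      (real p + 1) * (ln (Im \<tau>) + 4 * N \<tau> + 1) - (real p - 1) * ln (real p)"
    using \<tau> p0 by (simp add: ln_mult ln_div algebra_simps)
  finally show ?thesis by (simp add: J[OF \<tau>])
qed

theorem corollary1p2:
  fixes p :: nat
  assumes "prime p"
  shows "(\<forall>n::nat. n > 0 \<longrightarrow> (\<forall>\<tau>. Im \<tau> > 0 \<longrightarrow>
            hecke p (JJ1 n) \<tau> = JJ1 (p * n) \<tau> + of_nat p * JJ1_quot n p \<tau>)) \<and>
         (\<forall>\<tau>. Im \<tau> > 0 \<longrightarrow>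
            hecke p (JJ1 0) \<tau> =
              (of_nat p + 1) * JJ1 0 \<tau> - (of_nat p - 1) * of_real (ln (real p)))"
  using hecke_JJ1_pos[OF assms] hecke_JJ1_0[OF assms] by blast

end
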